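(* Let $\alpha>0$, $\ell\in\mathbb{N}$, $b\in H^{\infty,\ell}_\alpha$ and $1\le p<\infty$. Then $\mathfrak{h}^{\ell}_{b,\alpha}$ is a bounded operator from $F^{p,\ell}_\alpha$ to $\overline{F^{p,\ell}_\alpha}$ if and only if $b\in F^{\infty,\ell}_{\alpha/2}$. In such case, $\|\mathfrak{h}^{\ell}_{b,\alpha}\|_{F^{p,\ell}_\alpha}\simeq\|b\|_{F^{\infty,\ell}_{\alpha/2}}$. Analogously, $\mathfrak{h}^{\ell}_{b,\alpha}$ is a bounded operator from $\mathfrak{f}^{\infty,\ell}_\alpha$ to $\overline{\mathfrak{f}^{\infty,\ell}_\alpha}$ if and only if $b\in F^{\infty,\ell}_{\alpha/2}$, and in such case $\|\mathfrak{h}^{\ell}_{b,\alpha}\|_{\mathfrak{f}^{\infty,\ell}_\alpha}\simeq\|b\|_{F^{\infty,\ell}_{\alpha/2}}$.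
   Context: $\mathbb{N}=\{1,2,3,\dots\}$, $\nu$ is Lebesgue measure on $\mathbb{C}$, $H(\mathbb{C})$ is the space of entire functions. For $\alpha>0$ and $\ell\in\mathbb{N}$: for $1\le p<\infty$, $L^{p,\ell}_\alpha$ is the space of measurable $f$ on $\mathbb{C}$ with $\|f\|_{L^{p,\ell}_\alpha}^p:=\int_{\mathbb{C}}|f(z)e^{-\alpha|z|^{2\ell}/2}|^p\,d\nu(z)<\infty$; $L^{\infty,\ell}_\alpha$ is the space of measurable $f$ with $\|f\|_{L^{\infty,\ell}_\alpha}:=\operatorname{ess\,sup}_{z\in\mathbb{C}}|f(z)|e^{-\alpha|z|^{2\ell}/2}<\infty$. For $1\le p\le\infty$, $F^{p,\ell}_\alpha:=H(\mathbb{C})\cap L^{p,\ell}_\alpha$ with the norm of $L^{p,\ell}_\alpha$. The little Fock space is $\mathfrak{f}^{\infty,\ell}_\alpha:=\{f\in H(\mathbb{C}):\lim_{|z|\to\infty}|f(z)|e^{-\alpha|z|^{2\ell}/2}=0\}$, normed as a subspace of $F^{\infty,\ell}_\alpha$. For a space $X$ of functions, $\overline{X}:=\{\overline f:f\in X\}$ with $\|\overline f\|=\|f\|$. $H^{\infty,\ell}_\alpha:=\{b\in H(\mathbb{C}):|b(z)|=O((1+|z|)^{2\ell-2}e^{\alpha|z|^{2\ell}/2})\}$. $E:=\{f\in H(\mathbb{C}):|f(z)|=O(e^{\beta|z|^\ell})\text{ for some }\beta>0\}$; it is a dense subspace of $F^{p,\ell}_\alpha$ ($1\le p<\infty$) and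 of $\mathfrak{f}^{\infty,\ell}_\alpha$. $K^\ell_\alpha(z,w)=\frac{\ell\alpha^{1/\ell}}{\pi}\sum_{m=0}^\infty\frac{\alpha^{m/\ell}z^m\overline{w}^m}{\Gamma((m+1)/\ell)}$ is the Bergman (reproducing) kernel of $F^{2,\ell}_\alpha$ with respect to $\langle f,g\rangle^\ell_\alpha=\int_{\mathbb{C}}f\overline{g}\,e^{-\alpha|z|^{2\ell}}d\nu(z)$. For $b\in H^{\infty,\ell}_\alpha$, the small Hankel operator is defined on $f\in E$ by $$\mathfrak{h}^{\ell}_{b,\alpha}(f)(z):=\int_{\mathbb{C}}K^\ell_\alpha(w,z)f(w)\overline{b(w)}e^{-\alpha|w|^{2\ell}}\,d\nu(w),$$ i.e. $\mathfrak{h}^{\ell}_{b,\alpha}(f)=\overline{P^\ell_\alpha(b\overline f)}$, where $P^\ell_\alpha$ is the integral operator $P^\ell_\alpha g(z)=\int_{\mathbb{C}}K^\ell_\alpha(z,w)g(w)e^{-\alpha|w|^{2\ell}}d\nu(w)$. "$\mathfrak{h}^{\ell}_{b,\alpha}$ is bounded from $X$ to $\overline{X}$" (for $X=F^{p,\ell}_\alpha$ or $X=\mathfrak{f}^{\infty,\ell}_\alpha$) means that this operator, defined on the dense subspace $E$, extends to a bounded operator from $X$ to $\overline{X}$; its operator norm is denoted $\|\mathfrak{h}^{\ell}_{b,\alpha}\|_X$. $A\simeq B$ means $C^{-1}B\le A\le CB$ with a constant $C>0$ independent of $b$. *)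

theory Defs
  imports
    "HOL-Analysis.Analysis"
    "HOL-Complex_Analysis.Complex_Analysis"
    "HOL-Probability.Essential_Supremum"
    "HOL-Library.Landau_Symbols"
begin

definition weight :: "real \<Rightarrow> nat \<Rightarrow> complex \<Rightarrow> real" where
  "weight \<alpha> l z = exp (- (\<alpha> * cmod z ^ (2 * l) / 2))"

definition entire :: "(complex \<Rightarrow> complex) set" where
  "entire = {f. f holomorphic_on UNIV}"

definition Lp_int :: "real \<Rightarrow> real \<Rightarrow> nat \<Rightarrow> (complex \<Rightarrow> complex) \<Rightarrow> ennreal" where
  "Lp_int p \<alpha> l f = (\<integral>\<^sup>+ z. ennreal ((cmod (f z) * weight \<alpha> l z) powr p) \<partial>lebesgue)"

definition Lp_space :: "real \<Rightarrow> real \<Rightarrow> nat \<Rightarrow> (complex \<Rightarrow> complex) set" where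
  "Lp_space p \<alpha> l = {f \<in> borel_measurable lebesgue. Lp_int p \<alpha> l f < \<infinity>}"

definition Lp_norm :: "real \<Rightarrow> real \<Rightarrow> nat \<Rightarrow> (complex \<Rightarrow> complex) \<Rightarrow> real" where
  "Lp_norm p \<alpha> l f = enn2real (Lp_int p \<alpha> l f) powr (1 / p)"

definition Linf_esssup :: "real \<Rightarrow> nat \<Rightarrow> (complex \<Rightarrow> complex) \<Rightarrow> ereal" where
  "Linf_esssup \<alpha> l f = esssup lebesgue (\<lambda>z. ereal (cmod (f z) * weight \<alpha> l z))"

definition Linf_space :: "real \<Rightarrow> nat \<Rightarrow> (complex \<Rightarrow> complex) set" where
  "Linf_space \<alpha> l = {f \<in> borel_measurable lebesgue. Linf_esssup \<alpha> l f < \<infinity>}"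

definition Linf_norm :: "real \<Rightarrow> nat \<Rightarrow> (complex \<Rightarrow> complex) \<Rightarrow> real" where
  "Linf_norm \<alpha> l f = real_of_ereal (Linf_esssup \<alpha> l f)"

definition Fp :: "real \<Rightarrow> real \<Rightarrow> nat \<Rightarrow> (complex \<Rightarrow> complex) set" where
  "Fp p \<alpha> l = entire \<inter> Lp_space p \<alpha> l"

definition Finf :: "real \<Rightarrow> nat \<Rightarrow> (complex \<Rightarrow> complex) set" where
  "Finf \<alpha> l = entire \<inter> Linf_space \<alpha> l"

definition little_Fock :: "real \<Rightarrow> nat \<Rightarrow> (complex \<Rightarrow> complex) set" where
  "little_Fock \<alpha> l =
     {f \<in> entire. ((\<lambda>z. cmod (f z) * weight \<alpha> l z) \<longlongrightarrow> 0) at_infinity}"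

definition H_space :: "real \<Rightarrow> nat \<Rightarrow> (complex \<Rightarrow> complex) set" where
  "H_space \<alpha> l =
     {b \<in> entire. (\<lambda>z. cmod (b z)) \<in>
        O[at_infinity](\<lambda>z. (1 + cmod z) ^ (2 * l - 2) * exp (\<alpha> * cmod z ^ (2 * l) / 2))}"

definition E_space :: "nat \<Rightarrow> (complex \<Rightarrow> complex) set" where
  "E_space l =
     {f \<in> entire. \<exists>\<beta>>0. (\<lambda>z. cmod (f z)) \<in> O[at_infinity](\<lambda>z. exp (\<beta> * cmod z ^ l))}"

definition bergman_kernel :: "real \<Rightarrow> nat \<Rightarrow> complex \<Rightarrow> complex \<Rightarrow> complex" where
  "bergman_kernel \<alpha> l z w =
     complex_of_real (real l * \<alpha> powr (1 / real l) / pi) *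
     (\<Sum>m. complex_of_real (\<alpha> powr (real m / real l)) * z ^ m * cnj w ^ m
           / complex_of_real (Gamma (real (m + 1) / real l)))"

definition small_hankel ::
  "real \<Rightarrow> nat \<Rightarrow> (complex \<Rightarrow> complex) \<Rightarrow> (complex \<Rightarrow> complex) \<Rightarrow> complex \<Rightarrow> complex" where
  "small_hankel \<alpha> l b f z =
     (LINT w|lebesgue. bergman_kernel \<alpha> l w z * f w * cnj (b w)
        * complex_of_real (exp (- (\<alpha> * cmod w ^ (2 * l)))))"

definition conj_space :: "(complex \<Rightarrow> complex) set \<Rightarrow> (complex \<Rightarrow> complex) set" where
  "conj_space X = (\<lambda>f z. cnj (f z)) ` X"

definition conj_norm ::
  "((complex \<Rightarrow> complex) \<Rightarrow> real) \<Rightarrow> (complex \<Rightarrow> complex) \<Rightarrow> real" where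
  "conj_norm N g = N (\<lambda>z. cnj (g z))"

(* Function spaces are carrier sets X with a norm function N; only the values of an operator
   on its carrier matter. *)
definition bounded_operator ::
  "(complex \<Rightarrow> complex) set \<Rightarrow> ((complex \<Rightarrow> complex) \<Rightarrow> real) \<Rightarrow>
   (complex \<Rightarrow> complex) set \<Rightarrow> ((complex \<Rightarrow> complex) \<Rightarrow> real) \<Rightarrow>
   ((complex \<Rightarrow> complex) \<Rightarrow> (complex \<Rightarrow> complex)) \<Rightarrow> bool" where
  "bounded_operator X N Y M T \<longleftrightarrow>
     (\<forall>f\<in>X. T f \<in> Y) \<and>
     (\<forall>f\<in>X. \<forall>g\<in>X. T (\<lambda>z. f z + g z) = (\<lambda>z. T f z + T g z)) \<and>
     (\<forall>c. \<forall>f\<in>X. T (\<lambda>z. c * f z) = (\<lambda>z. c * T f z)) \<and>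
     (\<exists>B. \<forall>f\<in>X. M (T f) \<le> B * N f)"

definition operator_norm ::
  "(complex \<Rightarrow> complex) set \<Rightarrow> ((complex \<Rightarrow> complex) \<Rightarrow> real) \<Rightarrow>
   ((complex \<Rightarrow> complex) \<Rightarrow> real) \<Rightarrow>
   ((complex \<Rightarrow> complex) \<Rightarrow> (complex \<Rightarrow> complex)) \<Rightarrow> real" where
  "operator_norm X N M T = (SUP f\<in>{f \<in> X. N f \<le> 1}. M (T f))"

(* E_space l is dense in the spaces X considered, so all bounded extensions T agree on X and
   have the same operator norm: quantifying over T avoids choosing one. *)
definition hankel_extension ::
  "real \<Rightarrow> nat \<Rightarrow> (complex \<Rightarrow> complex) \<Rightarrow>
   (complex \<Rightarrow> complex) set \<Rightarrow> ((complex \<Rightarrow> complex) \<Rightarrow> real) \<Rightarrow>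
   ((complex \<Rightarrow> complex) \<Rightarrow> (complex \<Rightarrow> complex)) \<Rightarrow> bool" where
  "hankel_extension \<alpha> l b X N T \<longleftrightarrow>
     bounded_operator X N (conj_space X) (conj_norm N) T \<and>
     (\<forall>f\<in>E_space l. T f = small_hankel \<alpha> l b f)"

definition hankel_bounded ::
  "real \<Rightarrow> nat \<Rightarrow> (complex \<Rightarrow> complex) \<Rightarrow>
   (complex \<Rightarrow> complex) set \<Rightarrow> ((complex \<Rightarrow> complex) \<Rightarrow> real) \<Rightarrow> bool" where
  "hankel_bounded \<alpha> l b X N \<longleftrightarrow> (\<exists>T. hankel_extension \<alpha> l b X N T)"

end

theory Submission
  imports Defs "HOL-Real_Asymp.Real_Asymp"
begin

text \<open>Write \<open>K\<close> for the Bergman kernel, \<open>P\<close> for the projection with kernel \<open>K\<close>, and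
  \<open>\<langle>F, b\<rangle>\<close> for the integral of \<open>F cnj b\<close> against the Gaussian \<open>exp (- \<alpha> |w|\<^sup>2\<^sup>l)\<close>. The Hankel operator
  applied to \<open>f\<close> has the value \<open>\<langle>f K(\<cdot>,z), b\<rangle>\<close> at \<open>z\<close>, so it depends on \<open>b\<close> only through the moments
  \<open>\<langle>w\<^sup>m, b\<rangle>\<close>.

  Sufficiency. Let \<open>c\<close> be the positive number with \<open>c\<^sup>l = 2\<close>. The function
  \<open>\<psi>(w) = c b(c w) exp (- \<alpha> |w|\<^sup>2\<^sup>l)\<close> is bounded exactly when \<open>b\<close> lies in the space with weight parameter
  \<open>\<alpha>/2\<close>, and it has the same moments as \<open>b\<close>: replacing \<open>\<alpha>\<close> by \<open>2\<alpha>\<close> multiplies the \<open>m\<close>-th kernel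
  coefficient by \<open>c\<^sup>m\<^sup>+\<^sup>1\<close>, and the dilation of \<open>b\<close> compensates this (\<open>bdd_symbol_moments\<close>). Hence the operator
  is \<open>f \<mapsto> cnj (P (\<psi> cnj f))\<close>, and it remains to bound \<open>P\<close> on the weighted spaces. Schur's test reduces
  this to a uniform bound on the integral of \<open>|K(z,w)|\<close> times both weights (\<open>kernel_row_integral\<close>).
  Here it matters that \<open>l\<close> is an integer: multiplication by \<open>w\<^sup>l\<close> shifts monomials by \<open>l\<close>, and its adjoint
  has weights that are linear in the index (up to truncation at \<open>0\<close>); a second difference therefore shows that \<open>(w\<^sup>l - z\<^sup>l)\<^sup>2 K(w,z)\<close> has squared norm
  at most a constant times \<open>K(z,z)\<close> (\<open>kernel_bracket_norm\<close>). Together with the size of \<open>K(z,z)\<close>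
  (\<open>kser_bound\<close>) and the integral of \<open>(1 + |w\<^sup>l - z\<^sup>l|\<^sup>2)\<^sup>-\<^sup>2\<close> (\<open>nn_integral_power_distance\<close>), the
  inequality between arithmetic and geometric means gives the row bound.

  Necessity. Test the operator on \<open>F(w) = exp (\<alpha> (w cnj z)\<^sup>l)\<close> and evaluate at \<open>z\<close>. The product
  \<open>F K(\<cdot>,z)\<close> is a constant times \<open>K(\<cdot>, c z)\<close> plus a remainder, and pairing \<open>K(\<cdot>, c z)\<close> with \<open>b\<close> gives
  \<open>cnj (b (c z))\<close>. The remainder has Taylor coefficients that are smaller by Taylor's formula for a power of
  \<open>1 + x\<close> (\<open>conv_coef_close\<close>), and its pairing with \<open>b\<close> is controlled by the values at \<open>0\<close> of the operator on
  monomials. Both contributions are at most a constant times the operator norm times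
  \<open>exp (\<alpha> |z|\<^sup>2\<^sup>l)\<close>, which is the inverse of the weight with parameter \<open>\<alpha>/2\<close> at \<open>c z\<close> (\<open>hankel_lower\<close>).

  An arbitrary bounded extension is compared with its values on \<open>E\<close> by cutting \<open>f\<close> off outside a disc
  and projecting back, which gives an element of \<open>E\<close> close to \<open>f = P f\<close> (\<open>hankel_upper\<close>). All this uses
  only a few properties of the space, collected in the locale \<open>fock_type_space\<close>, which hold for
  the Fock spaces with finite exponent and for the little Fock space.\<close>

section \<open>Lebesgue measure on the plane\<close>

lemma lborel_complex_eq_distr:
  "(lborel :: complex measure) = distr (lborel \<Otimes>\<^sub>M lborel) borel (\<lambda>(x, y). Complex x y)"
proof (rule lborel_eqI)
  have [measurable]: "(\<lambda>(x, y). Complex x y) \<in> borel_measurable (lborel \<Otimes>\<^sub>M lborel)"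
    unfolding lborel_prod split_beta Complex_eq
    by (simp, intro borel_measurable_continuous_onI continuous_intros)
  show "sets (distr (lborel \<Otimes>\<^sub>M lborel) borel (\<lambda>(x, y). Complex x y)) = sets borel"
    by simp
  fix a b :: complex
  assume le: "\<And>i. i \<in> Basis \<Longrightarrow> a \<bullet> i \<le> b \<bullet> i"
  have le': "Re a \<le> Re b" "Im a \<le> Im b"
    using le[of 1] le[of \<i>] by (auto simp: Basis_complex_def)
  have pre: "(\<lambda>(x, y). Complex x y) -` box a b \<inter> space (lborel \<Otimes>\<^sub>M lborel)
     = box (Re a) (Re b) \<times> box (Im a) (Im b)"
    by (auto simp: box_def Basis_complex_def space_pair_measure)
  have "emeasure (distr (lborel \<Otimes>\<^sub>M lborel) borel (\<lambda>(x, y). Complex x y)) (box a b)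
     = emeasure lborel (box (Re a) (Re b)) * emeasure lborel (box (Im a) (Im b))"
    by (subst emeasure_distr) (simp_all add: pre lborel.emeasure_pair_measure_Times)
  also have "\<dots> = ennreal ((Re b - Re a) * (Im b - Im a))"
    using le' by (simp add: ennreal_mult)
  also have "(Re b - Re a) * (Im b - Im a) = (\<Prod>i\<in>Basis. (b - a) \<bullet> i)"
    by (simp add: Basis_complex_def)
  finally show "emeasure (distr (lborel \<Otimes>\<^sub>M lborel) borel (\<lambda>(x, y). Complex x y)) (box a b)
      = ennreal (\<Prod>i\<in>Basis. (b - a) \<bullet> i)" by simp
qed

lemma measurable_Complex [measurable (raw)]:
  "f \<in> borel_measurable M \<Longrightarrow> g \<in> borel_measurable M \<Longrightarrow>
    (\<lambda>x. Complex (f x) (g x)) \<in> borel_measurable M"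
  unfolding Complex_eq
  by (intro borel_measurable_add borel_measurable_times borel_measurable_const
      measurable_compose[OF _ borel_measurable_continuous_onI[OF continuous_on_of_real_id]])

lemma nn_integral_complex_iterated:
  fixes f :: "complex \<Rightarrow> ennreal"
  assumes [measurable]: "f \<in> borel_measurable borel"
  shows "(\<integral>\<^sup>+z. f z \<partial>lborel) = (\<integral>\<^sup>+y. \<integral>\<^sup>+x. f (Complex x y) \<partial>lborel \<partial>lborel)"
    and "(\<integral>\<^sup>+z. f z \<partial>lborel) = (\<integral>\<^sup>+x. \<integral>\<^sup>+y. f (Complex x y) \<partial>lborel \<partial>lborel)"
proof -
  have "(\<integral>\<^sup>+z. f z \<partial>lborel) = (\<integral>\<^sup>+p. f (case p of (x, y) \<Rightarrow> Complex x y) \<partial>(lborel \<Otimes>\<^sub>M lborel))"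
    by (subst lborel_complex_eq_distr, subst nn_integral_distr) simp_all
  moreover have "\<dots> = (\<integral>\<^sup>+x. \<integral>\<^sup>+y. f (Complex x y) \<partial>lborel \<partial>lborel)"
    by (subst lborel.nn_integral_fst[symmetric]) auto
  moreover have "(\<integral>\<^sup>+x. \<integral>\<^sup>+y. f (Complex x y) \<partial>lborel \<partial>lborel)
      = (\<integral>\<^sup>+y. \<integral>\<^sup>+x. f (Complex x y) \<partial>lborel \<partial>lborel)"
    by (rule lborel_pair.Fubini'[symmetric]) measurable
  ultimately show "(\<integral>\<^sup>+z. f z \<partial>lborel) = (\<integral>\<^sup>+y. \<integral>\<^sup>+x. f (Complex x y) \<partial>lborel \<partial>lborel)"
    and "(\<integral>\<^sup>+z. f z \<partial>lborel) = (\<integral>\<^sup>+x. \<integral>\<^sup>+y. f (Complex x y) \<partial>lborel \<partial>lborel)"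
    by simp_all
qed

lemma nn_integral_shear:
  fixes f :: "complex \<Rightarrow> ennreal"
  assumes [measurable]: "f \<in> borel_measurable borel"
  shows "(\<integral>\<^sup>+z. f (Complex (Re z + k * Im z) (Im z)) \<partial>lborel) = (\<integral>\<^sup>+z. f z \<partial>lborel)"
    and "(\<integral>\<^sup>+z. f (Complex (Re z) (Im z + k * Re z)) \<partial>lborel) = (\<integral>\<^sup>+z. f z \<partial>lborel)"
proof -
  have translate: "(\<integral>\<^sup>+x. g (x + t) \<partial>lborel) = (\<integral>\<^sup>+x. g x \<partial>lborel)"
    if "g \<in> borel_measurable borel" for g :: "real \<Rightarrow> ennreal" and t
    using nn_integral_real_affine[OF that, of 1 t] by (simp add: add.commute)
  show "(\<integral>\<^sup>+z. f (Complex (Re z + k * Im z) (Im z)) \<partial>lborel) = (\<integral>\<^sup>+z. f z \<partial>lborel)"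
    by (subst (1 2) nn_integral_complex_iterated(1))
      (simp_all add: translate[of "\<lambda>x. f (Complex x _)"])
  show "(\<integral>\<^sup>+z. f (Complex (Re z) (Im z + k * Re z)) \<partial>lborel) = (\<integral>\<^sup>+z. f z \<partial>lborel)"
    by (subst (1 2) nn_integral_complex_iterated(2))
      (simp_all add: translate[of "\<lambda>y. f (Complex _ y)"])
qed

text \<open>A rotation, other than the half turn, is a product of three shears.\<close>

lemma nn_integral_rotate:
  fixes f :: "complex \<Rightarrow> ennreal"
  assumes [measurable]: "f \<in> borel_measurable borel" and u: "cmod u = 1" "u \<noteq> -1"
  shows "(\<integral>\<^sup>+z. f (u * z) \<partial>lborel) = (\<integral>\<^sup>+z. f z \<partial>lborel)"
proof -
  define c s where "c = Re u" and "s = Im u"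
  have cs: "c\<^sup>2 + s\<^sup>2 = 1"
    using u by (simp add: c_def s_def cmod_def)
  have "c \<noteq> -1"
  proof
    assume "c = -1"
    with cs have "s = 0" by simp
    with \<open>c = -1\<close> show False using u by (simp add: c_def s_def complex_eq_iff)
  qed
  define t where "t = - s / (1 + c)"
  have t1: "1 + t * s = c"
    using cs \<open>c \<noteq> -1\<close> by (simp add: t_def field_simps power2_eq_square)
  have "1 + c \<noteq> 0"
    using \<open>c \<noteq> -1\<close> by (simp add: add_eq_0_iff eq_commute[of c])
  then have "t * (1 + c) = - s"
    by (simp add: t_def)
  then have t2: "t + t * c = - s"
    by (simp add: distrib_left)
  define A where "A z = Complex (Re z + t * Im z) (Im z)" for z
  define B where "B z = Complex (Re z) (Im z + s * Re z)" for z
  have rot: "A (B (A z)) = u * z" for z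
  proof (rule complex_eqI)
    have "Re (A (B (A z))) = (1 + t * s) * Re z + (t + t * (1 + t * s)) * Im z"
      by (simp add: A_def B_def algebra_simps)
    also have "\<dots> = c * Re z - s * Im z"
      by (simp only: t1 t2)
    finally show "Re (A (B (A z))) = Re (u * z)" by (simp add: c_def s_def)
    have "Im (A (B (A z))) = s * Re z + (1 + t * s) * Im z"
      by (simp add: A_def B_def algebra_simps)
    then show "Im (A (B (A z))) = Im (u * z)"
      by (simp only: t1) (simp add: c_def s_def)
  qed
  have [measurable]: "A \<in> borel_measurable borel" "B \<in> borel_measurable borel"
    unfolding A_def B_def by measurable
  have "(\<integral>\<^sup>+z. f z \<partial>lborel) = (\<integral>\<^sup>+z. f (A z) \<partial>lborel)"
    unfolding A_def by (rule nn_integral_shear(1)[symmetric]) simp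
  also have "\<dots> = (\<integral>\<^sup>+z. f (A (B z)) \<partial>lborel)"
    unfolding B_def by (rule nn_integral_shear(2)[symmetric]) simp
  also have "\<dots> = (\<integral>\<^sup>+z. f (A (B (A z))) \<partial>lborel)"
    by (subst (3) A_def, rule nn_integral_shear(1)[symmetric]) simp
  finally show ?thesis by (simp add: rot)
qed

lemma lborel_distr_rotate:
  assumes "cmod u = 1" "u \<noteq> -1"
  shows "distr lborel lborel (\<lambda>z. u * z) = (lborel :: complex measure)"
proof (rule measure_eqI)
  fix A assume "A \<in> sets (distr lborel lborel (\<lambda>z. u * z))"
  then have [measurable]: "A \<in> sets borel" by simp
  have "emeasure (distr lborel lborel (\<lambda>z. u * z)) A = (\<integral>\<^sup>+z. indicator A (u * z) \<partial>lborel)"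
    by (subst nn_integral_indicator[symmetric], simp, subst nn_integral_distr) simp_all
  also have "\<dots> = emeasure lborel A"
    by (subst nn_integral_rotate[OF _ assms]) simp_all
  finally show "emeasure (distr lborel lborel (\<lambda>z. u * z)) A = emeasure lborel A" .
qed simp

lemma nn_integral_complex_translate_scale:
  fixes f :: "complex \<Rightarrow> ennreal"
  assumes [measurable]: "f \<in> borel_measurable borel" and c: "c > 0"
  shows "(\<integral>\<^sup>+z. f (of_real c * (z - a)) \<partial>lborel) = ennreal (1 / c\<^sup>2) * (\<integral>\<^sup>+z. f z \<partial>lborel)"
proof -
  have "(\<integral>\<^sup>+z. f (of_real c * (z - a)) \<partial>lborel)
      = (\<integral>\<^sup>+z. f (of_real c * (z - a))
          \<partial>density (distr lborel borel (\<lambda>x. a + (1/c) *\<^sub>R x)) (\<lambda>_. \<bar>1/c\<bar>^DIM(complex)))"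
    using c by (subst lborel_affine[of "1/c" a]) auto
  also have "\<dots> = ennreal (1 / c\<^sup>2) * (\<integral>\<^sup>+z. f (of_real c * (a + (1/c) *\<^sub>R z - a)) \<partial>lborel)"
    using c by (subst nn_integral_density) (auto simp: nn_integral_cmult nn_integral_distr power_divide)
  also have "(\<lambda>z. f (of_real c * (a + (1/c) *\<^sub>R z - a))) = f"
    using c by (auto simp: scaleR_conv_of_real)
  finally show ?thesis .
qed

lemma nn_integral_powr_from_0:
  assumes "a > 0"
  shows "(\<integral>\<^sup>+s. ennreal (a * s powr (a - 1)) * indicator {0..x} s \<partial>lborel) = ennreal (if x \<le> 0 then 0 else x powr a)"
proof (cases "x \<le> 0")
  case True
  have "(\<integral>\<^sup>+s. ennreal (a * s powr (a - 1)) * indicator {0..x} s \<partial>lborel) = integral\<^sup>N lborel (\<lambda>_::real. 0)"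
  proof (rule nn_integral_cong)
    fix s :: real
    have "s = 0" if "0 \<le> s" "s \<le> x" using that True by simp
    then show "ennreal (a * s powr (a - 1)) * indicator {0..x} s = 0"
      by (auto simp: indicator_def)
  qed
  then show ?thesis using True by simp
next
  case False
  have "((\<lambda>s. a * s powr (a - 1)) has_integral a * (x powr (a - 1 + 1) / (a - 1 + 1))) {0..x}"
    using assms False by (intro has_integral_mult_right has_integral_powr_from_0) auto
  then have "((\<lambda>s. a * s powr (a - 1)) has_integral x powr a) {0..x}"
    using assms by simp
  from nn_integral_has_integral_lebesgue'[OF _ this] False assms show ?thesis by simp
qed

text \<open>In the variable \<open>s = \<gamma>|w|\<^sup>2\<^sup>l\<close> every integral of a radial function becomes an integral over the
  half line; it suffices to compare both measures on the sets \<open>{..x}\<close>, that is, to know the area of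
  a disc.\<close>

lemma distr_radial:
  fixes \<gamma> :: real and l :: nat
  assumes \<gamma>: "\<gamma> > 0" and l: "l \<ge> 1"
  shows "distr lborel borel (\<lambda>w::complex. \<gamma> * cmod w ^ (2 * l))
      = density lborel (\<lambda>s. ennreal (pi * \<gamma> powr (- 1 / l)) * (ennreal ((1 / l) * s powr (1 / l - 1)) * indicator {0..} s))"
    (is "?M = ?N")
proof (rule measure_eqI_generator_eq[where \<Omega>=UNIV and E="range (\<lambda>x. {..x::real})"
      and A="\<lambda>i. {..real i}"])
  have eM: "emeasure ?M {..x} = ennreal (pi * \<gamma> powr (- 1 / l) * (if x \<le> 0 then 0 else x powr (1 / l)))" for x
  proof -
    have "emeasure ?M {..x} = emeasure lborel {w::complex. \<gamma> * cmod w ^ (2 * l) \<le> x}"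
      by (subst emeasure_distr) (auto intro!: arg_cong[where f="emeasure lborel"])
    also have "\<dots> = ennreal (pi * \<gamma> powr (- 1 / l) * (if x \<le> 0 then 0 else x powr (1 / l)))"
    proof (cases "x < 0")
      case True
      have "{w::complex. \<gamma> * cmod w ^ (2 * l) \<le> x} = {}"
        using True \<gamma> by (auto simp: not_le intro: less_le_trans[OF True])
      then show ?thesis using True by (simp add: zero_ennreal_def)
    next
      case False
      define r where "r = (x / \<gamma>) powr (1 / (2 * l))"
      have r2l: "r ^ (2 * l) = x / \<gamma>"
      proof (cases "x = 0")
        case True then show ?thesis using l by (simp add: r_def)
      next
        case nz: False
        then have "x / \<gamma> > 0" using False \<gamma> by auto
        then show ?thesis
          using l by (subst powr_realpow[symmetric]) (auto simp: r_def powr_powr abs_of_pos simp del: abs_divide)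
      qed
      have set: "{w::complex. \<gamma> * cmod w ^ (2 * l) \<le> x} = cball 0 r"
      proof -
        have "\<gamma> * cmod w ^ (2 * l) \<le> x \<longleftrightarrow> cmod w \<le> r" for w :: complex
        proof -
          have "\<gamma> * cmod w ^ (2 * l) \<le> x \<longleftrightarrow> cmod w ^ (2 * l) \<le> r ^ (2 * l)"
            unfolding r2l using \<gamma> by (simp add: pos_le_divide_eq mult.commute)
          also have "\<dots> \<longleftrightarrow> cmod w \<le> r"
            by (subst power_mono_iff) (use l in \<open>auto simp: r_def\<close>)
          finally show ?thesis .
        qed
        then show ?thesis by (auto simp only: set_eq_iff mem_Collect_eq mem_cball_0)
      qed
      have "r ^ 2 = \<gamma> powr (- 1 / l) * (if x \<le> 0 then 0 else x powr (1 / l))"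
      proof (cases "x = 0")
        case True then show ?thesis by (simp add: r_def)
      next
        case nz: False
        then have "x / \<gamma> > 0" using False \<gamma> by auto
        then have "r ^ 2 = (x / \<gamma>) powr (1 / l)"
          by (subst powr_realpow[symmetric]) (auto simp: r_def powr_powr abs_of_pos simp del: abs_divide)
        also have "\<dots> = \<gamma> powr (- 1 / l) * x powr (1 / l)"
          using False \<gamma> by (simp add: powr_divide powr_minus_divide)
        finally show ?thesis using nz False by simp
      qed
      moreover have "emeasure lborel (cball (0::complex) r) = ennreal (pi * r ^ 2)"
        by (subst emeasure_cball) (simp_all add: r_def unit_ball_vol_2)
      ultimately show ?thesis
        unfolding set by (simp add: mult.assoc)
    qed
    finally show ?thesis .
  qed
  have eN: "emeasure ?N {..x} = ennreal (pi * \<gamma> powr (- 1 / l) * (if x \<le> 0 then 0 else x powr (1 / l)))" for x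
  proof -
    have "emeasure ?N {..x} = (\<integral>\<^sup>+s. ennreal (pi * \<gamma> powr (- 1 / l)) * (ennreal ((1 / l) * s powr (1 / l - 1)) * indicator {0..} s) * indicator {..x} s \<partial>lborel)"
      by (subst emeasure_density) simp_all
    also have "\<dots> = (\<integral>\<^sup>+s. ennreal (pi * \<gamma> powr (- 1 / l)) * (ennreal ((1 / l) * s powr (1 / l - 1)) * indicator {0..x} s) \<partial>lborel)"
      by (intro nn_integral_cong) (auto simp: indicator_def)
    also have "\<dots> = ennreal (pi * \<gamma> powr (- 1 / l)) * ennreal (if x \<le> 0 then 0 else x powr (1 / l))"
      using l by (subst nn_integral_cmult) (simp_all add: nn_integral_powr_from_0 del: times_divide_eq_left)
    also have "\<dots> = ennreal (pi * \<gamma> powr (- 1 / l) * (if x \<le> 0 then 0 else x powr (1 / l)))"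
      by (subst ennreal_mult) auto
    finally show ?thesis .
  qed
  show "emeasure ?M X = emeasure ?N X" if "X \<in> range (\<lambda>x. {..x::real})" for X
    using that eM eN by auto
  show "emeasure ?M {..real i} \<noteq> \<infinity>" for i
    by (simp add: eM)
  show "Int_stable (range (\<lambda>x. {..x::real}))"
  proof (rule Int_stableI)
    fix a b assume "a \<in> range (\<lambda>x. {..x::real})" "b \<in> range (\<lambda>x. {..x::real})"
    then obtain x y where "a = {..x}" "b = {..y}" by auto
    then have "a \<inter> b = {..min x y}" by auto
    then show "a \<inter> b \<in> range (\<lambda>x. {..x::real})" by blast
  qed
  show "sets ?M = sigma_sets UNIV (range (\<lambda>x. {..x::real}))" "sets ?N = sigma_sets UNIV (range (\<lambda>x. {..x::real}))"
    by (simp_all add: borel_eq_atMost)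
  show "(\<Union>i. {..real i}) = UNIV"
    by (auto intro: real_arch_simple)
qed auto

lemma nn_integral_radial:
  fixes \<gamma> :: real and l :: nat and h :: "real \<Rightarrow> ennreal"
  assumes "\<gamma> > 0" "l \<ge> 1" and [measurable]: "h \<in> borel_measurable borel"
  shows "(\<integral>\<^sup>+w. h (\<gamma> * cmod w ^ (2 * l)) \<partial>lborel)
    = ennreal (pi / l * \<gamma> powr (- 1 / l)) * (\<integral>\<^sup>+s. ennreal (s powr (1 / l - 1)) * indicator {0..} s * h s \<partial>lborel)"
proof -
  have "(\<integral>\<^sup>+w. h (\<gamma> * cmod w ^ (2 * l)) \<partial>lborel)
      = (\<integral>\<^sup>+s. h s \<partial>distr lborel borel (\<lambda>w::complex. \<gamma> * cmod w ^ (2 * l)))"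
    by (subst nn_integral_distr) simp_all
  also have "\<dots> = (\<integral>\<^sup>+s. ennreal (pi * \<gamma> powr (- 1 / l)) * (ennreal ((1 / l) * s powr (1 / l - 1)) * indicator {0..} s) * h s \<partial>lborel)"
    unfolding distr_radial[OF assms(1,2)] by (subst nn_integral_density) simp_all
  also have "\<dots> = (\<integral>\<^sup>+s. ennreal (pi / l * \<gamma> powr (- 1 / l)) * (ennreal (s powr (1 / l - 1)) * indicator {0..} s * h s) \<partial>lborel)"
  proof (rule nn_integral_cong)
    fix s :: real
    have "ennreal (pi * \<gamma> powr (- 1 / l)) * ennreal ((1 / l) * s powr (1 / l - 1))
        = ennreal (pi / l * \<gamma> powr (- 1 / l)) * ennreal (s powr (1 / l - 1))"
      by (subst (1 2) ennreal_mult[symmetric]) (auto simp: field_simps)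
    then show "ennreal (pi * \<gamma> powr (- 1 / l)) * (ennreal ((1 / l) * s powr (1 / l - 1)) * indicator {0..} s) * h s
        = ennreal (pi / l * \<gamma> powr (- 1 / l)) * (ennreal (s powr (1 / l - 1)) * indicator {0..} s * h s)"
      by (simp add: mult.assoc[symmetric])
  qed
  finally show ?thesis
    by (simp add: nn_integral_cmult)
qed

text \<open>The squared norms of the monomials. Substituting \<open>s = \<gamma>|w|\<^sup>2\<^sup>l\<close> turns them into Gamma integrals, so their
  inverses are the coefficients of the Bergman kernel.\<close>

lemma nn_integral_gaussian_moment:
  fixes \<gamma> :: real and l m :: nat
  assumes \<gamma>: "\<gamma> > 0" and l: "l \<ge> 1"
  shows "(\<integral>\<^sup>+w. ennreal (cmod w ^ (2 * m) * exp (- (\<gamma> * cmod w ^ (2 * l)))) \<partial>lborel)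
     = ennreal (pi / l * \<gamma> powr (- real (m + 1) / l) * Gamma (real (m + 1) / l))"
proof -
  define h where "h s = ennreal (if s \<le> 0 then (if m = 0 then exp (- s) else 0) else (s / \<gamma>) powr (m / l) * exp (- s))" for s :: real
  have [measurable]: "h \<in> borel_measurable borel"
    unfolding h_def by measurable
  have "ennreal (cmod w ^ (2 * m) * exp (- (\<gamma> * cmod w ^ (2 * l)))) = h (\<gamma> * cmod w ^ (2 * l))" for w :: complex
  proof (cases "w = 0")
    case True
    then show ?thesis using l by (cases "m = 0") (auto simp: h_def power_0_left)
  next
    case False
    have "(cmod w ^ (2 * l)) powr (m / l) = cmod w ^ (2 * m)"
      using False l by (simp add: powr_realpow[symmetric] powr_powr del: powr_realpow)
    then show ?thesis using False \<gamma> by (simp add: h_def not_le)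
  qed
  then have "(\<integral>\<^sup>+w. ennreal (cmod w ^ (2 * m) * exp (- (\<gamma> * cmod w ^ (2 * l)))) \<partial>lborel)
     = (\<integral>\<^sup>+w. h (\<gamma> * cmod w ^ (2 * l)) \<partial>lborel)"
    by simp
  also have "\<dots> = ennreal (pi / l * \<gamma> powr (- 1 / l)) * (\<integral>\<^sup>+s. ennreal (s powr (1 / l - 1)) * indicator {0..} s * h s \<partial>lborel)"
    by (rule nn_integral_radial[OF assms]) simp
  also have "(\<integral>\<^sup>+s. ennreal (s powr (1 / l - 1)) * indicator {0..} s * h s \<partial>lborel)
      = (\<integral>\<^sup>+s. ennreal (\<gamma> powr (- real m / l)) * ennreal (indicator {0..} s * s powr (real (m + 1) / l - 1) / exp s) \<partial>lborel)"
  proof (rule nn_integral_cong)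
    fix s :: real
    show "ennreal (s powr (1 / l - 1)) * indicator {0..} s * h s
        = ennreal (\<gamma> powr (- real m / l)) * ennreal (indicator {0..} s * s powr (real (m + 1) / l - 1) / exp s)"
    proof (cases "s > 0")
      case True
      have "s powr (1 / l - 1) * ((s / \<gamma>) powr (m / l) * exp (- s))
          = \<gamma> powr (- real m / l) * (s powr (real (m + 1) / l - 1) / exp s)"
      proof -
        have "s powr (real (m + 1) / l - 1) = s powr (1 / l - 1) * s powr (m / l)"
          by (simp add: powr_add[symmetric] add_divide_distrib algebra_simps)
        then show ?thesis using True \<gamma>
          by (simp add: powr_divide powr_minus_divide exp_minus field_simps)
      qed
      then show ?thesis
        using True by (simp add: h_def ennreal_mult[symmetric])
    next
      case False
      then show ?thesis by (cases "s = 0") auto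
    qed
  qed
  also have "\<dots> = ennreal (\<gamma> powr (- real m / l)) * ennreal (Gamma (real (m + 1) / l))"
    using l by (subst nn_integral_cmult) (simp_all add: Gamma_conv_nn_integral_real[symmetric] del: of_nat_add)
  also have "ennreal (pi / l * \<gamma> powr (- 1 / l)) * (ennreal (\<gamma> powr (- real m / l)) * ennreal (Gamma (real (m + 1) / l)))
     = ennreal (pi / l * \<gamma> powr (- 1 / l) * (\<gamma> powr (- real m / l) * Gamma (real (m + 1) / l)))"
    using l by (subst ennreal_mult, simp_all add: ennreal_mult' Gamma_real_pos less_imp_le)
  also have "pi / l * \<gamma> powr (- 1 / l) * (\<gamma> powr (- real m / l) * Gamma (real (m + 1) / l))
     = pi / l * \<gamma> powr (- real (m + 1) / l) * Gamma (real (m + 1) / l)"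
  proof -
    have "- 1 / real l + - real m / real l = - real (m + 1) / l"
      by (simp add: add_divide_distrib diff_divide_distrib)
    then have "\<gamma> powr (- 1 / l) * \<gamma> powr (- real m / l) = \<gamma> powr (- real (m + 1) / l)"
      by (simp only: powr_add[symmetric])
    then show ?thesis by (metis mult.assoc)
  qed
  finally show ?thesis .
qed

lemma nn_integral_inverse_square_finite:
  "(\<integral>\<^sup>+w. ennreal (1 / (1 + (cmod w)\<^sup>2)\<^sup>2) \<partial>lborel) < \<infinity>"
proof -
  have "(\<integral>\<^sup>+w. ennreal (1 / (1 + (cmod w)\<^sup>2)\<^sup>2) \<partial>lborel)
     = (\<integral>\<^sup>+w. ennreal (1 / (1 + (1 * cmod w ^ (2 * 1)))\<^sup>2) \<partial>lborel)" by simp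
  also have "\<dots> = ennreal (pi / real 1 * 1 powr (- 1 / real 1)) * (\<integral>\<^sup>+s. ennreal (s powr (1 / real 1 - 1)) * indicator {0..} s * ennreal (1 / (1 + s)\<^sup>2) \<partial>lborel)"
    by (rule nn_integral_radial[where h="\<lambda>s. ennreal (1 / (1 + s)\<^sup>2)"]) simp_all
  also have "\<dots> \<le> ennreal pi * (\<integral>\<^sup>+s. ennreal (1 / (1 + s)\<^sup>2) * indicator {0..} s \<partial>lborel)"
    by (auto intro!: mult_left_mono nn_integral_mono simp: indicator_def)
  also have "(\<integral>\<^sup>+s. ennreal (1 / (1 + s)\<^sup>2) * indicator {0..} s \<partial>lborel) = ennreal (0 - (- 1 / (1 + (0::real))))"
  proof (rule nn_integral_FTC_atLeast)
    show "((\<lambda>s::real. - 1 / (1 + s)) \<longlongrightarrow> 0) at_top" by real_asymp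
    show "DERIV (\<lambda>s. - 1 / (1 + s)) s :> 1 / (1 + s)\<^sup>2" if "s \<ge> 0" for s :: real
      using that by (auto intro!: derivative_eq_intros simp: power2_eq_square)
  qed auto
  finally show ?thesis
    by (simp add: ennreal_mult_less_top less_top[symmetric])
       (metis ennreal_less_top ennreal_mult_less_top le_less_trans mult_1_right one_ennreal_def top.not_eq_extremum)
qed

section \<open>The coefficients of the kernel\<close>

lemma Gamma_real_plus1: "Gamma (x + 1) = x * Gamma x" if "x > 0" for x :: real
  using that nonpos_Ints_nonpos[of x] by (intro Gamma_plus1) auto

text \<open>Gautschi's inequality: \<open>j + 1\<close> is the convex combination of \<open>j + a\<close> and \<open>j + a + 1\<close> with weights
  \<open>a\<close> and \<open>1 - a\<close>, and \<open>Gamma\<close> is logarithmically convex.\<close>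

lemma inverse_Gamma_le:
  fixes a :: real
  assumes a: "0 < a" "a \<le> 1"
  shows "inverse (Gamma (real j + a)) \<le> (real j + 1) powr (1 - a) / fact j"
proof -
  define G where "G = (ln \<circ> (Gamma :: real \<Rightarrow> real))"
  define x y where "x = real j + a" and "y = real j + a + 1"
  have pos: "x > 0" "y > 0" using a by (auto simp: x_def y_def)
  obtain g where g: "Gamma x = g" "g > 0"
    using pos Gamma_real_pos by blast
  have mid: "(1 - (1 - a)) *\<^sub>R x + (1 - a) *\<^sub>R y = real j + 1"
    by (simp add: x_def y_def algebra_simps)
  have "G ((1 - (1 - a)) *\<^sub>R x + (1 - a) *\<^sub>R y) \<le> (1 - (1 - a)) * G x + (1 - a) * G y"
    unfolding G_def using a pos by (intro convex_onD[OF log_convex_Gamma_real]) auto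
  then have "ln (Gamma (real j + 1)) \<le> a * ln g + (1 - a) * ln (Gamma y)"
    unfolding mid by (simp add: G_def g)
  also have "Gamma (real j + 1) = fact j"
    using Gamma_fact[of j, where 'a = real] by (simp add: add.commute)
  also have "Gamma y = x * g"
    using Gamma_real_plus1[OF pos(1)] g by (simp add: y_def flip: x_def)
  also have "ln (x * g) = ln x + ln g"
    using pos g by (simp add: ln_mult)
  finally have "ln (fact j) \<le> ln g + (1 - a) * ln x"
    by (simp add: algebra_simps)
  also have "\<dots> = ln (g * x powr (1 - a))"
    using pos g by (simp add: ln_mult ln_powr)
  finally have "fact j \<le> g * x powr (1 - a)"
    using pos g by simp
  also have "\<dots> \<le> g * (real j + 1) powr (1 - a)"
    using a g pos by (intro mult_left_mono powr_mono2) (auto simp: x_def)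
  finally show ?thesis
    unfolding x_def[symmetric] g using g by (simp add: field_simps)
qed

lemma exp_partial_sum_le:
  fixes s :: real
  assumes "s \<ge> 1"
  shows "(\<Sum>j<N. s ^ j / fact j * (1 + (real j + 1) / s)) \<le> 3 * exp s"
proof -
  have e: "(\<lambda>j. s ^ j / fact j) sums exp s"
    using exp_converges[of s] by (simp add: divide_inverse mult.commute)
  have "(\<lambda>j. real (Suc j) * (s ^ Suc j / fact (Suc j))) sums (s * exp s)"
    using sums_mult[OF e, of s] by (simp add: field_simps del: of_nat_Suc)
  then have "(\<lambda>j. real j * (s ^ j / fact j)) sums (s * exp s)"
    by (subst (asm) sums_Suc_iff) simp
  from sums_add[OF sums_mult[OF e, of "1 + 1 / s"] sums_mult[OF this, of "1 / s"]]
  have tot: "(\<lambda>j. (1 + 1 / s) * (s ^ j / fact j) + 1 / s * (real j * (s ^ j / fact j)))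
      sums ((1 + 1 / s) * exp s + 1 / s * (s * exp s))" .
  have "(\<Sum>j<N. s ^ j / fact j * (1 + (real j + 1) / s))
      = (\<Sum>j<N. (1 + 1 / s) * (s ^ j / fact j) + 1 / s * (real j * (s ^ j / fact j)))"
  proof (rule sum.cong[OF refl])
    fix j
    have "t * (1 + (real j + 1) / s) = (1 + 1 / s) * t + 1 / s * (real j * t)" for t
      by (simp add: add_divide_distrib algebra_simps)
    then show "s ^ j / fact j * (1 + (real j + 1) / s)
       = (1 + 1 / s) * (s ^ j / fact j) + 1 / s * (real j * (s ^ j / fact j))" .
  qed
  also have "\<dots> \<le> (1 + 1 / s) * exp s + 1 / s * (s * exp s)"
    using sum_le_suminf[OF sums_summable[OF tot], of "{..<N}"] assms
    unfolding sums_unique[OF tot, symmetric] by simp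
  also have "\<dots> \<le> 3 * exp s"
    using assms by (simp add: field_simps)
  finally show ?thesis .
qed

lemma powr_le_one_plus:
  fixes y e :: real
  assumes "y > 0" "0 \<le> e" "e \<le> 1"
  shows "y powr e \<le> 1 + y"
proof (cases "y \<le> 1")
  case True
  then have "y powr e \<le> 1" using assms by (simp add: powr_le1)
  then show ?thesis using assms by simp
next
  case False
  then have "y powr e \<le> y powr 1" using assms by (intro powr_mono) auto
  then show ?thesis using False by simp
qed

text \<open>The coefficients of the Bergman kernel; their inverses are the squared norms of the monomials.\<close>

definition kcoef :: "real \<Rightarrow> nat \<Rightarrow> nat \<Rightarrow> real" where
  "kcoef \<alpha> l m = l * \<alpha> powr (1 / l) / pi * (\<alpha> powr (m / l) / Gamma (real (m + 1) / l))"

text \<open>The Bergman kernel is dominated by this series at \<open>|z||w|\<close>, and on the diagonal it equals the series at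
  \<open>|z|\<^sup>2\<close>.\<close>

definition kser :: "real \<Rightarrow> nat \<Rightarrow> real \<Rightarrow> real" where
  "kser \<alpha> l x = (\<Sum>m. kcoef \<alpha> l m * x ^ m)"

definition gauss :: "real \<Rightarrow> nat \<Rightarrow> complex \<Rightarrow> real" where
  "gauss \<alpha> l w = exp (- (\<alpha> * cmod w ^ (2 * l)))"

lemma gauss_measurable [measurable]: "gauss \<alpha> l \<in> borel_measurable borel"
  unfolding gauss_def by measurable

lemma gauss_pos [simp]: "gauss \<alpha> l w > 0" "gauss \<alpha> l w \<ge> 0"
  by (auto simp: gauss_def)

locale fock_params =
  fixes \<alpha> :: real and l :: nat
  assumes \<alpha>_pos: "\<alpha> > 0" and l_pos: "l \<ge> 1"
begin

lemma kcoef_pos: "kcoef \<alpha> l m > 0"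
  using \<alpha>_pos l_pos unfolding kcoef_def
  by (intro mult_pos_pos divide_pos_pos Gamma_real_pos) auto

lemma kcoef_eq_moment: "kcoef \<alpha> l m * (pi / l * \<alpha> powr (- real (m + 1) / l) * Gamma (real (m + 1) / l)) = 1"
proof -
  obtain g where G: "Gamma (real (m + 1) / l) = g" and g: "g > 0"
    using l_pos Gamma_real_pos[of "real (m + 1) / l"] by auto
  have "1 / real l + (real m / l + (- real (m + 1) / l)) = 0"
    by (simp add: add_divide_distrib diff_divide_distrib)
  then have "\<alpha> powr (1 / l) * (\<alpha> powr (m / l) * \<alpha> powr (- real (m + 1) / l)) = 1"
    using \<alpha>_pos by (simp only: powr_add[symmetric]) simp
  moreover have "kcoef \<alpha> l m * (pi / l * \<alpha> powr (- real (m + 1) / l) * Gamma (real (m + 1) / l))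
    = \<alpha> powr (1 / l) * (\<alpha> powr (m / l) * \<alpha> powr (- real (m + 1) / l))"
    unfolding kcoef_def G using g l_pos by (simp add: field_simps)
  ultimately show ?thesis by simp
qed

text \<open>Stepping by \<open>l\<close> turns the Gamma quotient into a linear function of the index.\<close>

lemma kcoef_shift: "kcoef \<alpha> l (m + l) * (real (m + 1) / (l * \<alpha>)) = kcoef \<alpha> l m"
proof -
  have pos: "real (m + 1) / l > 0" using l_pos by auto
  have "real (m + l + 1) / l = real (m + 1) / l + 1"
    using l_pos by (simp add: field_simps)
  then have G: "Gamma (real (m + l + 1) / l) = real (m + 1) / l * Gamma (real (m + 1) / l)"
    using Gamma_real_plus1[OF pos] by (simp only:)
  have "real (m + l) / l = real m / l + 1"
    using l_pos by (simp add: field_simps)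
  then have A: "\<alpha> powr (real (m + l) / l) = \<alpha> powr (m / l) * \<alpha>"
    using \<alpha>_pos by (simp add: powr_add)
  obtain g where g: "Gamma (real (m + 1) / l) = g" "g > 0"
    using pos Gamma_real_pos by blast
  define t where "t = real (m + 1)"
  have "t > 0" by (simp add: t_def)
  then show ?thesis
    unfolding kcoef_def G A g t_def[symmetric] using \<alpha>_pos l_pos g by (simp add: field_simps)
qed

text \<open>Grouping the indices by their residue \<open>r\<close> modulo \<open>l\<close> compares each group with the exponential series in
  \<open>s = \<alpha> x\<^sup>l\<close>. The residue \<open>l - 1\<close> is exactly such a series; for smaller \<open>r\<close>, Gautschi's inequality costs a
  power of \<open>(j + 1) / s\<close> with exponent below \<open>1\<close>, whose mean under the exponential weights is bounded.\<close>

lemma kcoef_term_le: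
  fixes x :: real
  assumes x: "\<alpha> * x ^ l \<ge> 1" "x \<ge> 0" and r: "r < l"
  defines "u \<equiv> \<alpha> powr (1 / l) * x" and "s \<equiv> \<alpha> * x ^ l"
  shows "kcoef \<alpha> l (j * l + r) * x ^ (j * l + r)
    \<le> (l * \<alpha> powr (1 / l) / pi) * u ^ (l - 1) * (s ^ j / fact j * (1 + (real j + 1) / s))"
proof -
  have xp: "x > 0" using x l_pos by (cases "x = 0") (auto simp: power_0_left)
  then have up: "u > 0" using \<alpha>_pos by (simp add: u_def)
  have pw: "(\<alpha> powr (1 / l)) ^ m = \<alpha> powr (real m / l)" for m
    using \<alpha>_pos by (simp add: powr_realpow[symmetric] powr_powr)
  have us: "u ^ l = s"
    using \<alpha>_pos l_pos by (simp add: u_def s_def power_mult_distrib pw)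
  have s1: "s \<ge> 1" using x by (simp add: s_def)
  have um: "\<alpha> powr (real m / l) * x ^ m = u ^ m" for m
    by (simp add: u_def power_mult_distrib pw)
  define a where "a = real (r + 1) / l"
  have a: "0 < a" "a \<le> 1" using r by (auto simp: a_def)
  have idx: "real (j * l + r + 1) / l = real j + a"
    using l_pos by (simp add: a_def field_simps)
  have ur: "u ^ r = u ^ (l - 1) * s powr (a - 1)"
  proof -
    have "u ^ (l - 1) * s powr (a - 1) = u powr real (l - 1) * (u powr real l) powr (a - 1)"
      using up by (simp add: us[symmetric] powr_realpow)
    also have "\<dots> = u powr (real (l - 1) + real l * (a - 1))"
      by (simp add: powr_powr powr_add)
    also have "real (l - 1) + real l * (a - 1) = real r"
      using l_pos by (simp add: a_def field_simps)
    finally show ?thesis using up by (simp add: powr_realpow)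
  qed
  have eq: "kcoef \<alpha> l (j * l + r) * x ^ (j * l + r)
      = (l * \<alpha> powr (1 / l) / pi) * (u ^ (j * l + r) * inverse (Gamma (real j + a)))"
    unfolding kcoef_def idx um[symmetric] by (simp add: divide_inverse)
  have "u ^ (j * l + r) = s ^ j * u ^ r"
    by (simp add: power_add us[symmetric] power_mult[symmetric] mult.commute)
  then have "u ^ (j * l + r) * inverse (Gamma (real j + a)) = s ^ j * u ^ r * inverse (Gamma (real j + a))"
    by simp
  also have "\<dots> \<le> s ^ j * u ^ r * ((real j + 1) powr (1 - a) / fact j)"
    using inverse_Gamma_le[OF a, of j] s1 up by (intro mult_left_mono) auto
  also have "\<dots> = u ^ (l - 1) * (s ^ j / fact j) * (((real j + 1) / s) powr (1 - a))"
  proof -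
    have "s powr (a - 1) * (real j + 1) powr (1 - a) = ((real j + 1) / s) powr (1 - a)"
      using s1 by (simp add: powr_divide powr_diff)
    then show ?thesis unfolding ur by (simp add: field_simps)
  qed
  also have "\<dots> \<le> u ^ (l - 1) * (s ^ j / fact j) * (1 + (real j + 1) / s)"
    using powr_le_one_plus[of "(real j + 1) / s" "1 - a"] s1 up a by (intro mult_left_mono) auto
  finally have "u ^ (j * l + r) * inverse (Gamma (real j + a))
      \<le> u ^ (l - 1) * (s ^ j / fact j * (1 + (real j + 1) / s))"
    by (simp only: mult.assoc)
  from mult_left_mono[OF this, of "l * \<alpha> powr (1 / l) / pi"]
  show ?thesis
    unfolding eq using \<alpha>_pos by (simp only: mult.assoc) simp
qed

lemma kser_large:
  fixes x :: real
  assumes x: "\<alpha> * x ^ l \<ge> 1" "x \<ge> 0"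
  shows "summable (\<lambda>m. kcoef \<alpha> l m * x ^ m)"
    and "kser \<alpha> l x \<le> 3 * l * (l * \<alpha> powr (1 / l) / pi) * (\<alpha> powr (1 / l) * x) ^ (l - 1) * exp (\<alpha> * x ^ l)"
proof -
  define \<kappa> where "\<kappa> = l * \<alpha> powr (1 / l) / pi"
  define u where "u = \<alpha> powr (1 / l) * x"
  define s where "s = \<alpha> * x ^ l"
  define B where "B = 3 * l * \<kappa> * u ^ (l - 1) * exp s"
  have nn: "0 \<le> kcoef \<alpha> l m * x ^ m" for m
    using x kcoef_pos[of m] by simp
  have bound: "(\<Sum>m<N. kcoef \<alpha> l m * x ^ m) \<le> B" for N
  proof -
    have "(\<Sum>m<N. kcoef \<alpha> l m * x ^ m) \<le> (\<Sum>m<N * l. kcoef \<alpha> l m * x ^ m)"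
      using l_pos nn by (intro sum_mono2) auto
    also have "\<dots> = (\<Sum>j<N. \<Sum>m\<in>{j * l..<j * l + l}. kcoef \<alpha> l m * x ^ m)"
      by (simp add: sum.nat_group)
    also have "\<dots> = (\<Sum>j<N. \<Sum>r<l. kcoef \<alpha> l (j * l + r) * x ^ (j * l + r))"
    proof (rule sum.cong[OF refl])
      fix j show "(\<Sum>m\<in>{j * l..<j * l + l}. kcoef \<alpha> l m * x ^ m) = (\<Sum>r<l. kcoef \<alpha> l (j * l + r) * x ^ (j * l + r))"
        using sum.shift_bounds_nat_ivl[of "\<lambda>m. kcoef \<alpha> l m * x ^ m" 0 "j * l" l]
        by (simp add: atLeast0LessThan add.commute)
    qed
    also have "\<dots> \<le> (\<Sum>j<N. \<Sum>r<l. \<kappa> * u ^ (l - 1) * (s ^ j / fact j * (1 + (real j + 1) / s)))"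
      unfolding \<kappa>_def u_def s_def by (intro sum_mono kcoef_term_le x) auto
    also have "\<dots> = l * \<kappa> * u ^ (l - 1) * (\<Sum>j<N. s ^ j / fact j * (1 + (real j + 1) / s))"
      by (simp add: sum_distrib_left mult.assoc)
    also have "\<dots> \<le> l * \<kappa> * u ^ (l - 1) * (3 * exp s)"
      using x \<alpha>_pos by (intro mult_left_mono exp_partial_sum_le) (auto simp: s_def \<kappa>_def u_def)
    finally show ?thesis by (simp add: B_def)
  qed
  show S: "summable (\<lambda>m. kcoef \<alpha> l m * x ^ m)"
    by (rule summableI_nonneg_bounded[OF nn bound])
  show "kser \<alpha> l x \<le> 3 * l * (l * \<alpha> powr (1 / l) / pi) * (\<alpha> powr (1 / l) * x) ^ (l - 1) * exp (\<alpha> * x ^ l)"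
    using suminf_le_const[OF S bound] by (simp add: kser_def B_def \<kappa>_def u_def s_def)
qed

lemma kser_summable:
  assumes "x \<ge> 0"
  shows "summable (\<lambda>m. kcoef \<alpha> l m * x ^ m)"
proof -
  define y where "y = x + 1 + 1 / \<alpha>"
  have y: "y \<ge> 1" "y \<ge> x" "y \<ge> 1 / \<alpha>" using assms \<alpha>_pos by (auto simp: y_def)
  have "1 \<le> \<alpha> * y" using y(3) \<alpha>_pos by (simp add: field_simps)
  also have "\<dots> \<le> \<alpha> * y ^ l" using self_le_power[OF y(1), of l] l_pos \<alpha>_pos by simp
  finally have "summable (\<lambda>m. kcoef \<alpha> l m * y ^ m)"
    using y by (intro kser_large) auto
  then show ?thesis
  proof (rule summable_comparison_test'[where N=0])
    show "norm (kcoef \<alpha> l m * x ^ m) \<le> kcoef \<alpha> l m * y ^ m" for m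
      using assms y kcoef_pos[of m] by (auto simp: norm_mult intro!: mult_left_mono power_mono)
  qed
qed

lemma kser_mono: "0 \<le> x \<Longrightarrow> x \<le> y \<Longrightarrow> kser \<alpha> l x \<le> kser \<alpha> l y"
  unfolding kser_def using kcoef_pos
  by (intro suminf_le kser_summable mult_left_mono power_mono) (auto intro: less_imp_le)

lemma kser_nonneg: "0 \<le> x \<Longrightarrow> 0 \<le> kser \<alpha> l x"
  unfolding kser_def using kcoef_pos
  by (intro suminf_nonneg kser_summable mult_nonneg_nonneg) (auto intro: less_imp_le)

lemma kser_bound:
  obtains C where "C > 0" "\<And>x. x \<ge> 0 \<Longrightarrow> kser \<alpha> l x \<le> C * (1 + x) ^ (l - 1) * exp (\<alpha> * x ^ l)"
proof -
  define A where "A = 3 * l * (l * \<alpha> powr (1 / l) / pi)"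
  have A: "A > 0" using \<alpha>_pos l_pos by (simp add: A_def)
  define q where "q = (\<alpha> powr (1 / l)) ^ (l - 1)"
  have q: "q > 0" using \<alpha>_pos by (simp add: q_def)
  define x0 where "x0 = \<alpha> powr (- 1 / l)"
  have "x0 ^ l = \<alpha> powr (- 1)"
    using \<alpha>_pos l_pos by (simp add: x0_def powr_realpow[symmetric] powr_powr)
  then have x0: "\<alpha> * x0 ^ l = 1"
    using \<alpha>_pos by (simp add: powr_minus)
  have x0n: "x0 > 0" using \<alpha>_pos by (simp add: x0_def)
  define C where "C = A * q + kser \<alpha> l x0"
  have k0: "kser \<alpha> l x0 \<ge> 0" using x0n by (intro kser_nonneg) auto
  show thesis
  proof (rule that[of C])
    show "C > 0" using A q k0 by (simp add: C_def add_pos_nonneg)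
    fix x :: real assume x: "x \<ge> 0"
    have "1 \<le> (1 + x) ^ (l - 1) * exp (\<alpha> * x ^ l)"
      using mult_mono[of 1 "(1 + x) ^ (l - 1)" 1 "exp (\<alpha> * x ^ l)"] x \<alpha>_pos by simp
    show "kser \<alpha> l x \<le> C * (1 + x) ^ (l - 1) * exp (\<alpha> * x ^ l)"
    proof (cases "\<alpha> * x ^ l \<ge> 1")
      case True
      have "kser \<alpha> l x \<le> A * (\<alpha> powr (1 / l) * x) ^ (l - 1) * exp (\<alpha> * x ^ l)"
        unfolding A_def using True x by (rule kser_large)
      also have "\<dots> \<le> A * (q * (1 + x) ^ (l - 1)) * exp (\<alpha> * x ^ l)"
        unfolding q_def power_mult_distrib using A x \<alpha>_pos
        by (intro mult_right_mono mult_left_mono power_mono) auto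
      also have "\<dots> \<le> C * (1 + x) ^ (l - 1) * exp (\<alpha> * x ^ l)"
        using x k0 by (simp add: C_def distrib_right)
      finally show ?thesis .
    next
      case False
      have "x \<le> x0"
      proof (rule ccontr)
        assume "\<not> x \<le> x0"
        then have "x0 ^ l \<le> x ^ l" using x0n by (intro power_mono) auto
        then have "\<alpha> * x0 ^ l \<le> \<alpha> * x ^ l" using \<alpha>_pos by simp
        with x0 False show False by simp
      qed
      then have "kser \<alpha> l x \<le> kser \<alpha> l x0 * 1" using x by (simp add: kser_mono)
      also have "\<dots> \<le> C * ((1 + x) ^ (l - 1) * exp (\<alpha> * x ^ l))"
        using \<open>1 \<le> _\<close> A q k0 by (intro mult_mono) (auto simp: C_def)
      finally show ?thesis by (simp add: mult.assoc)
    qed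
  qed
qed

lemma bergman_kernel_sums:
  "(\<lambda>m. of_real (kcoef \<alpha> l m) * (z * cnj w) ^ m) sums bergman_kernel \<alpha> l z w"
proof -
  have S: "summable (\<lambda>m. of_real (kcoef \<alpha> l m) * (z * cnj w) ^ m)"
    by (rule summable_norm_cancel)
      (use kser_summable[of "cmod (z * cnj w)"] kcoef_pos in \<open>simp add: norm_mult norm_power abs_of_pos\<close>)
  define \<kappa> where "\<kappa> = l * \<alpha> powr (1 / l) / pi"
  have k: "\<kappa> \<noteq> 0" using \<alpha>_pos l_pos by (simp add: \<kappa>_def)
  define t where "t m = complex_of_real (\<alpha> powr (real m / real l)) * z ^ m * cnj w ^ m
           / complex_of_real (Gamma (real (m + 1) / real l))" for m
  have eq: "of_real (kcoef \<alpha> l m) * (z * cnj w) ^ m = of_real \<kappa> * t m" for m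
    by (simp add: kcoef_def \<kappa>_def t_def power_mult_distrib)
  have "summable t"
    using S k unfolding eq by (simp add: summable_cmult_iff)
  then have "(\<lambda>m. of_real \<kappa> * t m) sums (of_real \<kappa> * suminf t)"
    by (intro sums_mult summable_sums)
  then show ?thesis
    unfolding eq bergman_kernel_def \<kappa>_def t_def by simp
qed

lemma bergman_kernel_cnj: "cnj (bergman_kernel \<alpha> l z w) = bergman_kernel \<alpha> l w z"
proof -
  have "(\<lambda>m. cnj (of_real (kcoef \<alpha> l m) * (z * cnj w) ^ m)) sums cnj (bergman_kernel \<alpha> l z w)"
    using bergman_kernel_sums by (subst sums_cnj)
  then have "(\<lambda>m. of_real (kcoef \<alpha> l m) * (w * cnj z) ^ m) sums cnj (bergman_kernel \<alpha> l z w)"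
    by (simp add: mult.commute)
  with bergman_kernel_sums[of w z] show ?thesis by (simp add: sums_iff)
qed

lemma norm_bergman_kernel_le: "cmod (bergman_kernel \<alpha> l z w) \<le> kser \<alpha> l (cmod z * cmod w)"
proof -
  have "cmod (bergman_kernel \<alpha> l z w) = cmod (\<Sum>m. of_real (kcoef \<alpha> l m) * (z * cnj w) ^ m)"
    using bergman_kernel_sums[of z w] by (simp add: sums_iff)
  also have "\<dots> \<le> (\<Sum>m. cmod (of_real (kcoef \<alpha> l m) * (z * cnj w) ^ m))"
    by (rule summable_norm)
      (use kser_summable[of "cmod (z * cnj w)"] kcoef_pos in \<open>simp add: norm_mult norm_power abs_of_pos\<close>)
  also have "\<dots> = kser \<alpha> l (cmod z * cmod w)"
    unfolding kser_def using kcoef_pos by (simp add: norm_mult norm_power abs_of_pos)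
  finally show ?thesis .
qed

section \<open>Gaussian moments and pairings\<close>

lemma poly_exp_bound:
  fixes \<beta> \<delta> :: real
  assumes "\<delta> > 0"
  obtains C where "C > 0" "\<And>x. x \<ge> 0 \<Longrightarrow> (1 + x) ^ k * exp (\<beta> * x ^ l) \<le> C * exp (\<delta> * x ^ (2 * l))"
proof
  define C where "C = 2 ^ k * exp ((real k + \<beta>)\<^sup>2 / (4 * \<delta>))"
  show "C > 0" by (simp add: C_def)
  fix x :: real assume x: "x \<ge> 0"
  define y where "y = x ^ l"
  have y0: "y \<ge> 0" using x by (simp add: y_def)
  have "x \<le> 1 + y"
  proof (cases "x \<le> 1")
    case False
    then have "x \<le> x ^ l" using l_pos by (intro self_le_power) auto
    then show ?thesis by (simp add: y_def)
  qed (use y0 in auto)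
  then have "1 + x \<le> 2 * (1 + y)" using y0 by simp
  also have "\<dots> \<le> 2 * exp y" by (rule mult_left_mono[OF exp_ge_add_one_self]) simp
  finally have "(1 + x) ^ k \<le> (2 * exp y) ^ k" using x by (intro power_mono) auto
  also have "\<dots> = 2 ^ k * exp (real k * y)" by (simp add: power_mult_distrib exp_of_nat_mult)
  finally have "(1 + x) ^ k * exp (\<beta> * y) \<le> 2 ^ k * exp (real k * y) * exp (\<beta> * y)"
    by (intro mult_right_mono) auto
  also have "\<dots> = 2 ^ k * exp ((real k + \<beta>) * y)" by (simp add: exp_add[symmetric] distrib_right)
  also have "(real k + \<beta>) * y \<le> (real k + \<beta>)\<^sup>2 / (4 * \<delta>) + \<delta> * y\<^sup>2"
  proof -
    have "0 \<le> (2 * \<delta> * y - (real k + \<beta>))\<^sup>2 / (4 * \<delta>)" using assms by simp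
    also have "\<dots> = (real k + \<beta>)\<^sup>2 / (4 * \<delta>) + \<delta> * y\<^sup>2 - (real k + \<beta>) * y"
      using assms by (simp add: field_simps power2_eq_square)
    finally show ?thesis by simp
  qed
  also have "2 ^ k * exp ((real k + \<beta>)\<^sup>2 / (4 * \<delta>) + \<delta> * y\<^sup>2) = C * exp (\<delta> * x ^ (2 * l))"
    by (simp add: C_def exp_add y_def power_mult[symmetric] mult.commute)
  finally show "(1 + x) ^ k * exp (\<beta> * x ^ l) \<le> C * exp (\<delta> * x ^ (2 * l))"
    by (simp add: y_def)
qed

lemma integral_monomial_norm:
  "has_bochner_integral lborel (\<lambda>w. cmod w ^ (2 * m) * gauss \<alpha> l w) (1 / kcoef \<alpha> l m)"
proof -
  have "pi / l * \<alpha> powr (- real (m + 1) / l) * Gamma (real (m + 1) / l) = 1 / kcoef \<alpha> l m"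
    using kcoef_eq_moment[of m] kcoef_pos[of m] by (simp add: field_simps)
  with nn_integral_gaussian_moment[OF \<alpha>_pos l_pos, of m]
  have "(\<integral>\<^sup>+w. ennreal (cmod w ^ (2 * m) * gauss \<alpha> l w) \<partial>lborel) = ennreal (1 / kcoef \<alpha> l m)"
    by (simp add: gauss_def)
  then show ?thesis
    using kcoef_pos[of m] by (intro has_bochner_integral_nn_integral) auto
qed

lemma integrable_gauss: "integrable lborel (gauss \<alpha> l)"
  using integral_monomial_norm[of 0] by (simp add: has_bochner_integral_iff)

end

text \<open>A suitable rotation multiplies the integral by \<open>\<i>\<close> without changing it.\<close>

lemma integral_monomial_radial:
  fixes h :: "real \<Rightarrow> real"
  assumes "n \<noteq> m" and [measurable]: "h \<in> borel_measurable borel"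
  shows "(LINT w|lborel. w ^ n * cnj w ^ m * of_real (h (cmod w))) = 0"
proof -
  define d where "d = real n - real m"
  have d: "\<bar>d\<bar> \<ge> 1" using assms(1) by (auto simp: d_def)
  (* The angle makes u^n * cnj u^m a quarter turn and keeps u in the right half plane, away from -1. *)
  define u where "u = cis (pi / (2 * d))"
  have cu: "cos (pi / (2 * d)) \<ge> 0"
  proof (rule cos_ge_zero)
    have "\<bar>pi / (2 * d)\<bar> = pi / (2 * \<bar>d\<bar>)" by (simp add: abs_mult)
    also have "\<dots> \<le> pi / 2"
      using d by (intro divide_left_mono) auto
    finally show "- (pi / 2) \<le> pi / (2 * d)" "pi / (2 * d) \<le> pi / 2" by linarith+
  qed
  have u: "cmod u = 1" "u \<noteq> -1"
    using cu by (auto simp: u_def complex_eq_iff)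
  have "u ^ n * cnj u ^ m = cis (real n * (pi / (2 * d))) * cis (real m * - (pi / (2 * d)))"
    by (simp only: u_def cis_cnj Complex.DeMoivre)
  also have "\<dots> = cis (d * (pi / (2 * d)))"
    by (simp add: cis_mult d_def left_diff_distrib diff_divide_distrib)
  also have "\<dots> = \<i>" using d by (simp add: field_simps) 
  finally have ui: "u ^ n * cnj u ^ m = \<i>" .
  define F where "F w = w ^ n * cnj w ^ m * of_real (h (cmod w))" for w :: complex
  have cnj_meas: "cnj \<in> borel_measurable borel"
    by (intro borel_measurable_continuous_onI continuous_intros)
  have [measurable]: "F \<in> borel_measurable borel"
    unfolding F_def using cnj_meas by measurable
  have "integral\<^sup>L lborel F = integral\<^sup>L (distr lborel lborel (\<lambda>z. u * z)) F"
    by (simp add: lborel_distr_rotate[OF u])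
  also have "\<dots> = (LINT w|lborel. F (u * w))"
    by (subst integral_distr) auto
  also have "(\<lambda>w. F (u * w)) = (\<lambda>w. \<i> * F w)"
  proof
    fix w
    have "F (u * w) = (u ^ n * cnj u ^ m) * F w"
      using u by (simp add: F_def power_mult_distrib norm_mult)
    then show "F (u * w) = \<i> * F w" by (simp only: ui)
  qed
  also have "(LINT w|lborel. \<i> * F w) = \<i> * integral\<^sup>L lborel F"
    by simp
  finally have "(1 - \<i>) * integral\<^sup>L lborel F = 0" by (simp add: algebra_simps)
  then show ?thesis unfolding F_def by (auto simp: complex_eq_iff)
qed

lemma pairing_power_series:
  fixes a :: "nat \<Rightarrow> complex" and \<phi> :: "complex \<Rightarrow> complex"
  assumes [measurable]: "\<phi> \<in> borel_measurable borel"
    and summ: "\<And>x. x \<ge> 0 \<Longrightarrow> summable (\<lambda>n. cmod (a n) * x ^ n)"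
    and int: "integrable lborel (\<lambda>w. (\<Sum>n. cmod (a n) * cmod w ^ n) * cmod (\<phi> w))"
  shows "integrable lborel (\<lambda>w. (\<Sum>n. a n * w ^ n) * \<phi> w)"
    and "(\<lambda>n. a n * (LINT w|lborel. w ^ n * \<phi> w)) sums (LINT w|lborel. (\<Sum>n. a n * w ^ n) * \<phi> w)"
proof -
  define M where "M w = (\<Sum>n. cmod (a n) * cmod w ^ n) * cmod (\<phi> w)" for w
  define f where "f n w = a n * w ^ n * \<phi> w" for n w
  have sm: "summable (\<lambda>n. cmod (a n) * cmod w ^ n)" for w :: complex by (rule summ) simp
  have part: "(\<Sum>n\<in>A. cmod (f n w)) \<le> M w" if "finite A" for A w
  proof -
    have "(\<Sum>n\<in>A. cmod (f n w)) = (\<Sum>n\<in>A. cmod (a n) * cmod w ^ n) * cmod (\<phi> w)"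
      by (simp add: f_def norm_mult norm_power sum_distrib_right)
    also have "\<dots> \<le> M w"
      unfolding M_def by (intro mult_right_mono sum_le_suminf sm that) auto
    finally show ?thesis .
  qed
  have fint: "integrable lborel (f n)" for n
  proof (rule Bochner_Integration.integrable_bound[OF int])
    show "f n \<in> borel_measurable lborel" unfolding f_def by measurable
    show "AE w in lborel. norm (f n w) \<le> norm ((\<Sum>n. cmod (a n) * cmod w ^ n) * cmod (\<phi> w))"
      using part[of "{n}"] by (auto simp: M_def intro!: order_trans[OF _ abs_ge_self])
  qed
  have ae: "AE w in lborel. summable (\<lambda>n. norm (f n w))"
    unfolding f_def using sm by (auto simp: norm_mult norm_power intro!: summable_mult2)
  have ni: "summable (\<lambda>n. LINT w|lborel. norm (f n w))"
  proof (rule summableI_nonneg_bounded[where x="integral\<^sup>L lborel M"])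
    fix N
    have "(\<Sum>n<N. LINT w|lborel. norm (f n w)) = (LINT w|lborel. (\<Sum>n<N. norm (f n w)))"
      using fint by (subst Bochner_Integration.integral_sum) auto
    also have "\<dots> \<le> integral\<^sup>L lborel M"
      using int[folded M_def] part fint by (intro integral_mono Bochner_Integration.integrable_sum) auto
    finally show "(\<Sum>n<N. LINT w|lborel. norm (f n w)) \<le> integral\<^sup>L lborel M" .
  qed simp
  have eq: "(\<Sum>n. f n w) = (\<Sum>n. a n * w ^ n) * \<phi> w" for w
    unfolding f_def
    by (rule suminf_mult2[symmetric], rule summable_norm_cancel)
      (use sm in \<open>simp add: norm_mult norm_power\<close>)
  show "integrable lborel (\<lambda>w. (\<Sum>n. a n * w ^ n) * \<phi> w)"
    using integrable_suminf[OF fint ae ni] by (simp add: eq)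
  have "(\<lambda>n. integral\<^sup>L lborel (f n)) sums (LINT w|lborel. (\<Sum>n. f n w))"
    by (rule sums_integral[OF fint ae ni])
  moreover have "integral\<^sup>L lborel (f n) = a n * (LINT w|lborel. w ^ n * \<phi> w)" for n
    by (simp add: f_def[abs_def] mult.assoc)
  ultimately show "(\<lambda>n. a n * (LINT w|lborel. w ^ n * \<phi> w)) sums (LINT w|lborel. (\<Sum>n. a n * w ^ n) * \<phi> w)"
    by (simp add: eq)
qed

section \<open>Entire functions of exponential type and tame functions\<close>

lemma bigo_at_infinity_bound:
  fixes f g :: "complex \<Rightarrow> real"
  assumes "f \<in> O[at_infinity](g)" and cont: "continuous_on UNIV f" and g: "\<And>z. g z \<ge> 1"
  obtains C where "C > 0" "\<And>z. f z \<le> C * g z"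
proof -
  from assms(1) obtain c where c: "c > 0" "eventually (\<lambda>z. norm (f z) \<le> c * norm (g z)) at_infinity"
    by (elim landau_o.bigE)
  then obtain R where R: "\<And>z. R \<le> norm z \<Longrightarrow> norm (f z) \<le> c * norm (g z)"
    by (auto simp: eventually_at_infinity)
  have "bounded (f ` cball 0 R)"
    by (intro compact_imp_bounded compact_continuous_image continuous_on_subset[OF cont]) auto
  then obtain B where "\<forall>z\<in>cball 0 R. \<bar>f z\<bar> \<le> B"
    by (auto simp: bounded_iff)
  then have B: "\<And>z. cmod z \<le> R \<Longrightarrow> \<bar>f z\<bar> \<le> B" by simp
  show thesis
  proof (rule that[of "c + \<bar>B\<bar>"])
    show "c + \<bar>B\<bar> > 0" using c by simp
    fix z
    show "f z \<le> (c + \<bar>B\<bar>) * g z"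
    proof (cases "R \<le> cmod z")
      case True
      have "f z \<le> c * g z" using R[OF True] g[of z] by simp
      also have "\<dots> \<le> (c + \<bar>B\<bar>) * g z" using g[of z] by (intro mult_right_mono) auto
      finally show ?thesis .
    next
      case False
      have "f z \<le> \<bar>B\<bar> * 1" using B[of z] False by simp
      also have "\<dots> \<le> (c + \<bar>B\<bar>) * g z" using g[of z] c by (intro mult_mono) auto
      finally show ?thesis .
    qed
  qed
qed

lemma entire_power_series:
  assumes "f \<in> entire"
  obtains a where "\<And>w. (\<lambda>n. a n * w ^ n) sums f w"
proof
  fix w
  have "f holomorphic_on ball 0 (cmod w + 1)"
    using assms by (auto simp: entire_def intro: holomorphic_on_subset)
  from holomorphic_power_series[OF this, of w]
  show "(\<lambda>n. (deriv ^^ n) f 0 / fact n * w ^ n) sums f w" by simp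
qed

lemma power_series_entire:
  assumes "\<And>w. (\<lambda>n. a n * w ^ n) sums f w"
  shows "f \<in> entire"
proof -
  have "f holomorphic_on ball 0 r" for r
    by (rule power_series_holomorphic[where a=a]) (use assms in simp)
  then have "f field_differentiable (at w)" for w
    using holomorphic_on_imp_differentiable_at[of f "ball 0 (cmod w + 1)" w] by simp
  then show ?thesis
    by (simp add: entire_def holomorphic_on_def field_differentiable_at_within)
qed

lemma entire_continuous: "f \<in> entire \<Longrightarrow> continuous_on S f"
  by (auto simp: entire_def intro: holomorphic_on_imp_continuous_on holomorphic_on_subset)

lemma entire_measurable: "f \<in> entire \<Longrightarrow> f \<in> borel_measurable borel"
  by (intro borel_measurable_continuous_onI entire_continuous)

lemma measurable_cnj [measurable]: "cnj \<in> borel_measurable borel"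
  by (intro borel_measurable_continuous_onI continuous_intros)

lemma power_series_summable_norm:
  fixes a :: "nat \<Rightarrow> complex"
  assumes "\<And>w. (\<lambda>n. a n * w ^ n) sums f w" and "x \<ge> 0"
  shows "summable (\<lambda>n. cmod (a n) * x ^ n)"
proof -
  have "summable (\<lambda>n. norm (a n * of_real x ^ n))"
    by (rule powser_insidea[of a "of_real (x + 1)"])
      (use assms in \<open>auto intro: sums_summable simp del: of_real_add\<close>)
  then show ?thesis using assms(2) by (simp add: norm_mult norm_power)
qed

lemma integrable_dominated:
  fixes f :: "'a \<Rightarrow> 'b::{banach, second_countable_topology}" and g :: "'a \<Rightarrow> real"
  assumes "integrable M g" "f \<in> borel_measurable M" "\<And>x. norm (f x) \<le> g x"
  shows "integrable M f"
  by (rule Bochner_Integration.integrable_bound[OF assms(1,2)])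
    (auto intro!: order_trans[OF assms(3)])

context fock_params begin

text \<open>A tame function stays integrable against the Gaussian after multiplication by any function of
  exponential type, in particular by the kernel; all functions projected below are tame.\<close>

definition tame :: "(complex \<Rightarrow> complex) \<Rightarrow> bool" where
  "tame g \<longleftrightarrow> g \<in> borel_measurable borel \<and>
     (\<forall>\<beta>. integrable lborel (\<lambda>w. cmod (g w) * exp (\<beta> * cmod w ^ l) * gauss \<alpha> l w))"

text \<open>The bound is on the majorant series, not only on its sum, so that such a series may be integrated term
  by term against any tame function.\<close>

definition exp_type :: "(nat \<Rightarrow> complex) \<Rightarrow> bool" where
  "exp_type a \<longleftrightarrow> (\<exists>C \<beta>. \<forall>x\<ge>0. summable (\<lambda>n. cmod (a n) * x ^ n) \<and>
     (\<Sum>n. cmod (a n) * x ^ n) \<le> C * exp (\<beta> * x ^ l))"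

lemma tame_measurable: "tame g \<Longrightarrow> g \<in> borel_measurable borel"
  by (simp add: tame_def)

lemma tame_integrable:
  assumes "tame g" and [measurable]: "F \<in> borel_measurable borel"
    and F: "\<And>w. cmod (F w) \<le> C * exp (\<beta> * cmod w ^ l)"
  shows "integrable lborel (\<lambda>w. F w * (g w * of_real (gauss \<alpha> l w)))"
proof (rule integrable_dominated)
  have [measurable]: "g \<in> borel_measurable borel" using assms(1) by (rule tame_measurable)
  show "integrable lborel (\<lambda>w. C * (cmod (g w) * exp (\<beta> * cmod w ^ l) * gauss \<alpha> l w))"
    using assms(1) by (intro integrable_mult_right) (simp add: tame_def)
  show "(\<lambda>w. F w * (g w * of_real (gauss \<alpha> l w))) \<in> borel_measurable lborel"
    by measurable
  show "norm (F w * (g w * of_real (gauss \<alpha> l w))) \<le> C * (cmod (g w) * exp (\<beta> * cmod w ^ l) * gauss \<alpha> l w)" for w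
    using mult_right_mono[OF F[of w], of "cmod (g w) * gauss \<alpha> l w"] by (simp add: norm_mult mult_ac)
qed

lemma tame_mult:
  assumes "tame g" and [measurable]: "F \<in> borel_measurable borel"
    and F: "\<And>w. cmod (F w) \<le> C * exp (\<beta> * cmod w ^ l) * cmod (g w)"
  shows "tame F"
  unfolding tame_def
proof safe
  fix \<beta>'
  have [measurable]: "g \<in> borel_measurable borel" using assms(1) by (rule tame_measurable)
  show "integrable lborel (\<lambda>w. cmod (F w) * exp (\<beta>' * cmod w ^ l) * gauss \<alpha> l w)"
  proof (rule integrable_dominated)
    show "integrable lborel (\<lambda>w. C * (cmod (g w) * exp ((\<beta> + \<beta>') * cmod w ^ l) * gauss \<alpha> l w))"
      using assms(1) by (intro integrable_mult_right) (simp add: tame_def)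
    show "norm (cmod (F w) * exp (\<beta>' * cmod w ^ l) * gauss \<alpha> l w)
       \<le> C * (cmod (g w) * exp ((\<beta> + \<beta>') * cmod w ^ l) * gauss \<alpha> l w)" for w
      using mult_right_mono[OF F[of w], of "exp (\<beta>' * cmod w ^ l) * gauss \<alpha> l w"]
      by (simp add: distrib_right exp_add mult_ac)
  qed measurable
qed fact

lemma tame_bounded:
  assumes "tame f" "g \<in> borel_measurable borel" "\<And>w. cmod (g w) \<le> M * cmod (f w)"
  shows "tame g"
  by (rule tame_mult[OF assms(1,2), where C=M and \<beta>=0]) (use assms(3) in simp)

lemma tame_cnj: "tame f \<Longrightarrow> tame (\<lambda>w. cnj (f w))"
  by (rule tame_bounded[where M=1]) (auto dest: tame_measurable intro: measurable_compose[OF _ measurable_cnj])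

lemma tame_growth:
  assumes [measurable]: "g \<in> borel_measurable borel" and \<delta>: "\<delta> < \<alpha>"
    and g: "\<And>w. cmod (g w) \<le> C * (1 + cmod w) ^ k * exp (\<delta> * cmod w ^ (2 * l))"
  shows "tame g"
  unfolding tame_def
proof safe
  fix \<beta> :: real
  define \<eta> where "\<eta> = (\<alpha> - \<delta>) / 2"
  have \<eta>: "\<eta> > 0" using \<delta> by (simp add: \<eta>_def)
  interpret eta: fock_params \<eta> l using \<eta> l_pos by unfold_locales
  obtain D where D: "D > 0" "\<And>x. x \<ge> 0 \<Longrightarrow> (1 + x) ^ k * exp (\<beta> * x ^ l) \<le> D * exp (\<eta> * x ^ (2 * l))"
    using poly_exp_bound[OF \<eta>] by metis
  have C: "C \<ge> 0"
    using order_trans[OF norm_ge_zero g[of 0]] by (simp add: zero_le_mult_iff)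
  have le: "cmod (g w) * exp (\<beta> * cmod w ^ l) * gauss \<alpha> l w \<le> C * D * gauss \<eta> l w" for w
  proof -
    define X where "X = cmod w ^ (2 * l)"
    have "cmod (g w) * exp (\<beta> * cmod w ^ l) * gauss \<alpha> l w
       \<le> (C * (1 + cmod w) ^ k * exp (\<delta> * X)) * exp (\<beta> * cmod w ^ l) * gauss \<alpha> l w"
      unfolding X_def by (intro mult_right_mono g) auto
    also have "\<dots> = C * ((1 + cmod w) ^ k * exp (\<beta> * cmod w ^ l)) * (exp (\<delta> * X) * exp (- (\<alpha> * X)))"
      by (simp add: gauss_def X_def)
    also have "\<dots> \<le> C * (D * exp (\<eta> * X)) * (exp (\<delta> * X) * exp (- (\<alpha> * X)))"
      unfolding X_def using C by (intro mult_right_mono mult_left_mono D) auto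
    also have "\<dots> = C * D * exp (\<eta> * X + \<delta> * X - \<alpha> * X)"
      by (simp only: diff_conv_add_uminus exp_add mult.assoc)
    also have "\<eta> * X + \<delta> * X - \<alpha> * X = - (\<eta> * X)"
      by (simp add: \<eta>_def field_simps)
    finally show ?thesis by (simp add: gauss_def X_def)
  qed
  show "integrable lborel (\<lambda>w. cmod (g w) * exp (\<beta> * cmod w ^ l) * gauss \<alpha> l w)"
  proof (rule integrable_dominated)
    show "integrable lborel (\<lambda>w. C * D * gauss \<eta> l w)"
      using eta.integrable_gauss by simp
    show "norm (cmod (g w) * exp (\<beta> * cmod w ^ l) * gauss \<alpha> l w) \<le> C * D * gauss \<eta> l w" for w
      using le[of w] by (simp add: abs_mult)
  qed measurable
qed fact

lemma exp_type_bound: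
  assumes "exp_type a" "\<And>w. (\<lambda>n. a n * w ^ n) sums F w"
  obtains C \<beta> where "C > 0" "\<beta> > 0" "\<And>w. cmod (F w) \<le> C * exp (\<beta> * cmod w ^ l)"
    "\<And>x. x \<ge> 0 \<Longrightarrow> summable (\<lambda>n. cmod (a n) * x ^ n)"
    "\<And>x. x \<ge> 0 \<Longrightarrow> (\<Sum>n. cmod (a n) * x ^ n) \<le> C * exp (\<beta> * x ^ l)"
proof -
  from assms(1) obtain C \<beta> where C: "\<And>x. x \<ge> 0 \<Longrightarrow> summable (\<lambda>n. cmod (a n) * x ^ n)"
    "\<And>x. x \<ge> 0 \<Longrightarrow> (\<Sum>n. cmod (a n) * x ^ n) \<le> C * exp (\<beta> * x ^ l)"
    unfolding exp_type_def by blast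
  have M: "(\<Sum>n. cmod (a n) * x ^ n) \<le> (\<bar>C\<bar> + 1) * exp ((\<bar>\<beta>\<bar> + 1) * x ^ l)" if "x \<ge> 0" for x
  proof -
    have "C * exp (\<beta> * x ^ l) \<le> (\<bar>C\<bar> + 1) * exp ((\<bar>\<beta>\<bar> + 1) * x ^ l)"
      using that by (intro mult_mono) (auto intro!: mult_right_mono)
    with C(2)[OF that] show ?thesis by linarith
  qed
  have F: "cmod (F w) \<le> (\<Sum>n. cmod (a n) * cmod w ^ n)" for w
  proof -
    have "cmod (F w) = cmod (\<Sum>n. a n * w ^ n)" using assms(2)[of w] by (simp add: sums_iff)
    also have "\<dots> \<le> (\<Sum>n. cmod (a n * w ^ n))"
      by (rule summable_norm) (use C(1)[of "cmod w"] in \<open>simp add: norm_mult norm_power\<close>)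
    finally show ?thesis by (simp add: norm_mult norm_power)
  qed
  show thesis
    by (rule that[of "\<bar>C\<bar> + 1" "\<bar>\<beta>\<bar> + 1"])
      (use C(1) M order_trans[OF F M] in auto)
qed

lemma exp_type_E_space:
  assumes "exp_type a" "\<And>w. (\<lambda>n. a n * w ^ n) sums F w"
  shows "F \<in> E_space l"
proof -
  obtain C \<beta> where "C > 0" "\<beta> > 0" "\<And>w. cmod (F w) \<le> C * exp (\<beta> * cmod w ^ l)"
    using exp_type_bound[OF assms] by metis
  then show ?thesis
    using power_series_entire[OF assms(2)] unfolding E_space_def
    by (auto intro!: exI[of _ \<beta>] landau_o.bigI[of C])
qed

lemma E_space_bound:
  assumes "F \<in> E_space l"
  obtains C \<beta> where "C > 0" "\<beta> > 0" "\<And>w. cmod (F w) \<le> C * exp (\<beta> * cmod w ^ l)"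
proof -
  from assms obtain \<beta> where b: "\<beta> > 0" "(\<lambda>z. cmod (F z)) \<in> O[at_infinity](\<lambda>z. exp (\<beta> * cmod z ^ l))"
    and F: "F \<in> entire" unfolding E_space_def by auto
  have "continuous_on UNIV (\<lambda>z. cmod (F z))"
    using F by (intro continuous_intros entire_continuous)
  from bigo_at_infinity_bound[OF b(2) this] obtain C where "C > 0" "\<And>z. cmod (F z) \<le> C * exp (\<beta> * cmod z ^ l)"
    using b(1) by auto
  with b(1) show thesis by (rule_tac that)
qed

lemma E_space_I:
  assumes "F \<in> entire" "\<And>w. cmod (F w) \<le> C * exp (\<beta> * cmod w ^ l)"
  shows "F \<in> E_space l"
proof -
  have "cmod (F w) \<le> (\<bar>C\<bar> + 1) * exp ((\<bar>\<beta>\<bar> + 1) * cmod w ^ l)" for w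
  proof -
    have "C * exp (\<beta> * cmod w ^ l) \<le> (\<bar>C\<bar> + 1) * exp ((\<bar>\<beta>\<bar> + 1) * cmod w ^ l)"
      by (intro mult_mono) (auto intro!: mult_right_mono)
    with assms(2)[of w] show ?thesis by linarith
  qed
  then show ?thesis using assms(1) unfolding E_space_def
    by (auto intro!: exI[of _ "\<bar>\<beta>\<bar> + 1"] landau_o.bigI[of "\<bar>C\<bar> + 1"])
qed

lemma E_space_entire: "F \<in> E_space l \<Longrightarrow> F \<in> entire"
  by (simp add: E_space_def)

text \<open>Cauchy's estimates on the circle of radius \<open>2x + 1\<close> bound the majorant series.\<close>

lemma E_space_exp_type:
  assumes "F \<in> E_space l"
  obtains a where "exp_type a" "\<And>w. (\<lambda>n. a n * w ^ n) sums F w"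
proof -
  obtain C \<beta> where C: "C > 0" "\<beta> > 0" "\<And>w. cmod (F w) \<le> C * exp (\<beta> * cmod w ^ l)"
    using E_space_bound[OF assms] by metis
  have hol: "F holomorphic_on S" for S
    using E_space_entire[OF assms] by (auto simp: entire_def intro: holomorphic_on_subset)
  define a where "a n = (deriv ^^ n) F 0 / fact n" for n
  have sums: "(\<lambda>n. a n * w ^ n) sums F w" for w
    using holomorphic_power_series[OF hol, of w 0 "cmod w + 1"] by (simp add: a_def)
  have "(\<Sum>n. cmod (a n) * x ^ n) \<le> (2 * C * exp (\<beta> * 3 ^ l)) * exp (\<beta> * 3 ^ l * x ^ l)" if x: "x \<ge> 0" for x
  proof -
    define r where "r = 2 * x + 1"
    have r: "r > 0" using x by (simp add: r_def)
    have rl: "r ^ l \<le> 3 ^ l * (1 + x ^ l)"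
    proof -
      have "r \<le> 3 * max 1 x" by (simp add: r_def max_def)
      then have "r ^ l \<le> 3 ^ l * (max 1 x) ^ l"
        using power_mono[of r "3 * max 1 x" l] r by (simp add: power_mult_distrib)
      moreover have "(max 1 x) ^ l \<le> 1 + x ^ l"
        using x by (cases "x \<le> 1") (auto simp: max_def)
      ultimately show ?thesis by (smt (verit) mult_left_mono zero_le_power)
    qed
    define B where "B = C * exp (\<beta> * r ^ l)"
    have tm: "cmod (a n) * x ^ n \<le> B * (1 / 2) ^ n" for n
    proof -
      have "norm ((deriv ^^ n) F 0) \<le> fact n * B / r ^ n"
        using r C(3) by (intro Cauchy_inequality hol holomorphic_on_imp_continuous_on) (auto simp: B_def)
      then have "cmod (a n) \<le> B / r ^ n"
        by (simp add: a_def norm_divide field_simps)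
      then have "cmod (a n) * x ^ n \<le> B / r ^ n * x ^ n"
        using x by (intro mult_right_mono) auto
      also have "\<dots> = B * (x / r) ^ n" by (simp add: power_divide)
      also have "\<dots> \<le> B * (1 / 2) ^ n"
        using x r C(1) by (intro mult_left_mono power_mono) (auto simp: B_def r_def field_simps)
      finally show ?thesis .
    qed
    have "(\<Sum>n. cmod (a n) * x ^ n) \<le> (\<Sum>n. B * (1 / 2) ^ n)"
      by (intro suminf_le tm power_series_summable_norm[OF sums x] summable_mult summable_geometric) auto
    also have "\<dots> = 2 * B"
      by (subst suminf_mult) (auto intro: summable_geometric simp: suminf_geometric)
    also have "\<dots> \<le> 2 * (C * exp (\<beta> * (3 ^ l * (1 + x ^ l))))"
      unfolding B_def using C rl by (intro mult_left_mono) auto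
    also have "\<beta> * (3 ^ l * (1 + x ^ l)) = \<beta> * 3 ^ l + \<beta> * 3 ^ l * x ^ l"
      by (simp add: algebra_simps)
    finally show ?thesis by (simp only: exp_add mult.assoc)
  qed
  then have "exp_type a"
    unfolding exp_type_def using power_series_summable_norm[OF sums]
    by (intro exI[of _ "2 * C * exp (\<beta> * 3 ^ l)"] exI[of _ "\<beta> * 3 ^ l"]) auto
  then show thesis using sums by (rule that)
qed

lemma E_space_mult: "F \<in> E_space l \<Longrightarrow> G \<in> E_space l \<Longrightarrow> (\<lambda>w. F w * G w) \<in> E_space l"
proof -
  assume F: "F \<in> E_space l" and G: "G \<in> E_space l"
  obtain C \<beta> where C: "C > 0" "\<beta> > 0" "\<And>w. cmod (F w) \<le> C * exp (\<beta> * cmod w ^ l)"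
    using E_space_bound[OF F] by metis
  obtain D \<gamma> where D: "D > 0" "\<gamma> > 0" "\<And>w. cmod (G w) \<le> D * exp (\<gamma> * cmod w ^ l)"
    using E_space_bound[OF G] by metis
  have "cmod (F w * G w) \<le> C * D * exp ((\<beta> + \<gamma>) * cmod w ^ l)" for w
    using mult_mono[OF C(3) D(3), of w w] C(1) by (simp add: norm_mult distrib_right exp_add mult_ac)
  moreover have "(\<lambda>w. F w * G w) \<in> entire"
    using F G by (auto simp: E_space_def entire_def intro: holomorphic_on_mult)
  ultimately show ?thesis by (intro E_space_I)
qed

lemma le_one_plus_power: "x \<ge> 0 \<Longrightarrow> x \<le> 1 + x ^ l" for x :: real
  using self_le_power[of x l] l_pos by (cases "x \<le> 1") (auto intro: add_increasing2)

lemma power_le_exp: "x \<ge> 0 \<Longrightarrow> x ^ n \<le> exp (real n * x ^ l)" for x :: real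
proof -
  assume x: "x \<ge> 0"
  have "x \<le> exp (x ^ l)"
    using le_one_plus_power[OF x] exp_ge_add_one_self[of "x ^ l"] by linarith
  then have "x ^ n \<le> exp (x ^ l) ^ n" using x by (intro power_mono)
  then show ?thesis by (simp add: exp_of_nat_mult)
qed

lemma E_space_monomial: "(\<lambda>w. w ^ n) \<in> E_space l"
  using power_le_exp[of "cmod _" n]
  by (intro E_space_I[of _ 1 "real n"]) (auto simp: entire_def norm_power intro!: holomorphic_intros)

lemma E_space_power_diff: "(\<lambda>w. w ^ l - z ^ l) \<in> E_space l"
proof (rule E_space_I[of _ "1 + cmod (z ^ l)" "real l"])
  fix w
  have "cmod (w ^ l - z ^ l) \<le> cmod w ^ l + cmod (z ^ l)"
    using norm_triangle_ineq4[of "w ^ l" "z ^ l"] by (simp add: norm_power)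
  also have "\<dots> \<le> exp (real l * cmod w ^ l) + cmod (z ^ l) * exp (real l * cmod w ^ l)"
    using power_le_exp[of "cmod w" l] by (intro add_mono mult_le_cancel_left1[THEN iffD2]) auto
  finally show "cmod (w ^ l - z ^ l) \<le> (1 + cmod (z ^ l)) * exp (real l * cmod w ^ l)"
    by (simp add: distrib_right)
qed (auto simp: entire_def intro!: holomorphic_intros)

lemma E_space_exp: "(\<lambda>w. exp (c * w ^ l)) \<in> E_space l"
proof (rule E_space_I[of _ 1 "cmod c"])
  show "cmod (exp (c * w ^ l)) \<le> 1 * exp (cmod c * cmod w ^ l)" for w
    using norm_exp[of "c * w ^ l"] by (simp add: norm_mult norm_power)
qed (auto simp: entire_def intro!: holomorphic_intros)

lemma kernel_sums: "(\<lambda>n. of_real (kcoef \<alpha> l n) * cnj z ^ n * w ^ n) sums bergman_kernel \<alpha> l w z"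
  using bergman_kernel_sums[of w z] by (simp add: power_mult_distrib mult_ac)

lemma kernel_majorant: "(\<Sum>n. cmod (of_real (kcoef \<alpha> l n) * cnj z ^ n) * x ^ n) = kser \<alpha> l (cmod z * x)"
  unfolding kser_def using kcoef_pos by (simp add: norm_mult norm_power abs_of_pos power_mult_distrib mult_ac)

text \<open>For fixed \<open>z\<close> the growth \<open>exp (\<alpha> |z|\<^sup>l x\<^sup>l)\<close> of the majorant is exponential in \<open>x\<^sup>l\<close>.\<close>

lemma kernel_exp_type: "exp_type (\<lambda>n. of_real (kcoef \<alpha> l n) * cnj z ^ n)"
proof -
  obtain C where C: "C > 0" "\<And>x. x \<ge> 0 \<Longrightarrow> kser \<alpha> l x \<le> C * (1 + x) ^ (l - 1) * exp (\<alpha> * x ^ l)"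
    using kser_bound by metis
  define r where "r = cmod z"
  have r: "r \<ge> 0" by (simp add: r_def)
  have B: "kser \<alpha> l (r * x) \<le> C * (2 + r) ^ (l - 1) * exp ((real (l - 1) + \<alpha> * r ^ l) * x ^ l)" if x: "x \<ge> 0" for x
  proof -
    have "1 + r * x \<le> (2 + r) * exp (x ^ l)"
    proof -
      have "x \<le> exp (x ^ l)"
        using le_one_plus_power[OF x] exp_ge_add_one_self[of "x ^ l"] by linarith
      moreover have "1 \<le> exp (x ^ l)" using x by simp
      ultimately      have "1 + r * x \<le> exp (x ^ l) + r * exp (x ^ l)"
        using r by (intro add_mono mult_left_mono) auto
      also have "\<dots> \<le> (2 + r) * exp (x ^ l)" by (simp add: distrib_right)
      finally show ?thesis .
    qed
    then have "(1 + r * x) ^ (l - 1) \<le> ((2 + r) * exp (x ^ l)) ^ (l - 1)"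
      using r x by (intro power_mono) auto
    also have "\<dots> = (2 + r) ^ (l - 1) * exp (real (l - 1) * x ^ l)"
      by (simp only: power_mult_distrib exp_of_nat_mult)
    finally have "C * (1 + r * x) ^ (l - 1) * exp (\<alpha> * (r * x) ^ l)
       \<le> C * ((2 + r) ^ (l - 1) * exp (real (l - 1) * x ^ l)) * exp (\<alpha> * (r * x) ^ l)"
      using C(1) by (intro mult_right_mono mult_left_mono) auto
    also have "\<dots> = C * (2 + r) ^ (l - 1) * (exp (real (l - 1) * x ^ l) * exp (\<alpha> * r ^ l * x ^ l))"
      by (simp only: mult.assoc power_mult_distrib)
    also have "\<dots> = C * (2 + r) ^ (l - 1) * exp ((real (l - 1) + \<alpha> * r ^ l) * x ^ l)"
      by (simp only: exp_add[symmetric] distrib_right)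
    finally show ?thesis using C(2)[of "r * x"] r x by simp
  qed
  show ?thesis
    unfolding exp_type_def kernel_majorant
    using power_series_summable_norm[OF kernel_sums] B[unfolded r_def] by blast
qed

lemma E_space_kernel: "(\<lambda>w. bergman_kernel \<alpha> l w z) \<in> E_space l"
  using exp_type_E_space[OF kernel_exp_type kernel_sums] .

lemma measurable_kernel1 [measurable]: "(\<lambda>w. bergman_kernel \<alpha> l w z) \<in> borel_measurable borel"
  by (intro entire_measurable E_space_entire E_space_kernel)

lemma measurable_kernel2 [measurable]: "(\<lambda>w. bergman_kernel \<alpha> l z w) \<in> borel_measurable borel"
  using measurable_compose[OF measurable_kernel1[of z] measurable_cnj] by (simp add: bergman_kernel_cnj)

lemma tame_E_space:
  assumes "F \<in> E_space l" shows "tame F"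
proof -
  obtain C \<beta> where C: "C > 0" "\<beta> > 0" "\<And>w. cmod (F w) \<le> C * exp (\<beta> * cmod w ^ l)"
    using E_space_bound[OF assms] by metis
  have "tame (\<lambda>_. 1)" by (rule tame_growth[where \<delta>=0 and C=1 and k=0]) (use \<alpha>_pos in auto)
  then show ?thesis
    by (rule tame_mult[OF _ entire_measurable[OF E_space_entire[OF assms]], where C=C and \<beta>=\<beta>])
      (simp only: norm_one mult_1_right C)
qed

lemma tame_mult_E_space:
  assumes "F \<in> E_space l" "tame g" shows "tame (\<lambda>w. F w * g w)"
proof -
  obtain C \<beta> where C: "C > 0" "\<beta> > 0" "\<And>w. cmod (F w) \<le> C * exp (\<beta> * cmod w ^ l)"
    using E_space_bound[OF assms(1)] by metis
  have [measurable]: "F \<in> borel_measurable borel" "g \<in> borel_measurable borel"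
    using assms by (auto intro: entire_measurable E_space_entire tame_measurable)
  show ?thesis
    by (rule tame_mult[OF assms(2)]) (auto simp: norm_mult intro!: mult_right_mono C)
qed

lemma E_space_pairing_integrable:
  assumes "F \<in> E_space l" "tame g"
  shows "integrable lborel (\<lambda>w. F w * (g w * of_real (gauss \<alpha> l w)))"
proof -
  obtain C \<beta> where C: "C > 0" "\<beta> > 0" "\<And>w. cmod (F w) \<le> C * exp (\<beta> * cmod w ^ l)"
    using E_space_bound[OF assms(1)] by metis
  show ?thesis
    by (rule tame_integrable[OF assms(2)]) (use C assms entire_measurable E_space_entire in auto)
qed

text \<open>Pairings of functions in \<open>E\<close> with tame functions are thus determined by the moments of the latter.\<close>

lemma exp_type_pairing:
  assumes "exp_type a" "\<And>w. (\<lambda>n. a n * w ^ n) sums F w" "tame g"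
  shows "(\<lambda>n. a n * (LINT w|lborel. w ^ n * (g w * of_real (gauss \<alpha> l w))))
     sums (LINT w|lborel. F w * (g w * of_real (gauss \<alpha> l w)))"
proof -
  have [measurable]: "g \<in> borel_measurable borel" using assms(3) by (rule tame_measurable)
  obtain C \<beta> where C: "C > 0" "\<beta> > 0"
    "\<And>x. x \<ge> 0 \<Longrightarrow> summable (\<lambda>n. cmod (a n) * x ^ n)"
    "\<And>x. x \<ge> 0 \<Longrightarrow> (\<Sum>n. cmod (a n) * x ^ n) \<le> C * exp (\<beta> * x ^ l)"
    by (rule exp_type_bound[OF assms(1,2)]) blast
  define \<phi> where "\<phi> w = g w * of_real (gauss \<alpha> l w)" for w
  have [measurable]: "\<phi> \<in> borel_measurable borel" unfolding \<phi>_def by measurable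
  have nn: "0 \<le> (\<Sum>n. cmod (a n) * cmod w ^ n)" for w
    using C(3)[of "cmod w"] by (intro suminf_nonneg) auto
  have "integrable lborel (\<lambda>w. (\<Sum>n. cmod (a n) * cmod w ^ n) * cmod (\<phi> w))"
  proof (rule integrable_dominated)
    show "integrable lborel (\<lambda>w. C * (cmod (g w) * exp (\<beta> * cmod w ^ l) * gauss \<alpha> l w))"
      using assms(3) by (intro integrable_mult_right) (simp add: tame_def)
    show "norm ((\<Sum>n. cmod (a n) * cmod w ^ n) * cmod (\<phi> w))
        \<le> C * (cmod (g w) * exp (\<beta> * cmod w ^ l) * gauss \<alpha> l w)" for w
      using mult_right_mono[OF C(4)[of "cmod w"], of "cmod (\<phi> w)"] nn[of w]
      by (simp add: abs_mult \<phi>_def norm_mult mult_ac)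
  qed measurable
  from pairing_power_series(2)[OF _ C(3) this]
  have "(\<lambda>n. a n * (LINT w|lborel. w ^ n * \<phi> w)) sums (LINT w|lborel. (\<Sum>n. a n * w ^ n) * \<phi> w)"
    by simp
  moreover have "(\<Sum>n. a n * w ^ n) = F w" for w
    using assms(2)[of w] by (simp add: sums_iff)
  ultimately show ?thesis by (simp add: \<phi>_def)
qed

lemma integral_monomials:
  "(LINT w|lborel. w ^ n * (cnj w ^ m * of_real (gauss \<alpha> l w))) = (if n = m then of_real (1 / kcoef \<alpha> l m) else 0)"
proof (cases "n = m")
  case True
  have "w ^ n * (cnj w ^ m * of_real (gauss \<alpha> l w)) = of_real (cmod w ^ (2 * m) * gauss \<alpha> l w)" for w
  proof -
    have "w ^ n * cnj w ^ m = (w * cnj w) ^ m" using True by (simp add: power_mult_distrib)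
    also have "\<dots> = of_real (cmod w ^ (2 * m))"
      by (subst complex_norm_square[symmetric]) (simp add: power_mult)
    finally have "w ^ n * cnj w ^ m = complex_of_real (cmod w ^ (2 * m))" .
    then show ?thesis by (simp only: mult.assoc[symmetric] of_real_mult)
  qed
  then have "(LINT w|lborel. w ^ n * (cnj w ^ m * of_real (gauss \<alpha> l w)))
     = (LINT w|lborel. complex_of_real (cmod w ^ (2 * m) * gauss \<alpha> l w))"
    by (simp only:)
  also have "(LINT w|lborel. complex_of_real (cmod w ^ (2 * m) * gauss \<alpha> l w)) = of_real (1 / kcoef \<alpha> l m)"
    using integral_monomial_norm[of m] by (simp only: integral_complex_of_real has_bochner_integral_iff)
  finally show ?thesis using True by simp
next
  case False
  then show ?thesis
    using integral_monomial_radial[OF False, of "\<lambda>r. exp (- (\<alpha> * r ^ (2 * l)))"]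
    by (simp add: gauss_def mult.assoc)
qed

lemma monomial_integrable: "integrable lborel (\<lambda>w. w ^ n * (cnj w ^ m * of_real (gauss \<alpha> l w)))"
  using E_space_pairing_integrable[OF E_space_monomial tame_cnj[OF tame_E_space[OF E_space_monomial]]] by simp

text \<open>On a disc the Taylor series may be integrated term by term, and rotation invariance leaves a
  single term; dominated convergence then removes the disc.\<close>

lemma integral_coefficient:
  assumes sums: "\<And>w. (\<lambda>n. a n * w ^ n) sums f w"
    and int: "integrable lborel (\<lambda>w. f w * (cnj w ^ m * of_real (gauss \<alpha> l w)))"
  shows "(LINT w|lborel. f w * (cnj w ^ m * of_real (gauss \<alpha> l w))) = a m / of_real (kcoef \<alpha> l m)"
proof -
  have [measurable]: "f \<in> borel_measurable borel"
    using power_series_entire[OF sums] by (rule entire_measurable)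
  note sn = power_series_summable_norm[OF sums]
  define I where "I R w = complex_of_real (if cmod w \<le> real R then 1 else 0)" for R :: nat and w :: complex
  have [measurable]: "I R \<in> borel_measurable borel" for R unfolding I_def by measurable
  have lim: "(\<lambda>R. I R w) \<longlonglongrightarrow> 1" for w
  proof -
    obtain N where N: "cmod w \<le> real N" using real_arch_simple by blast
    have "eventually (\<lambda>R. I R w = 1) sequentially"
      using eventually_ge_at_top[of N] by eventually_elim (use N in \<open>auto simp: I_def\<close>)
    then show ?thesis by (rule tendsto_eventually)
  qed
  have trunc: "(\<lambda>R. LINT w|lborel. g w * I R w) \<longlonglongrightarrow> (LINT w|lborel. g w)"
    if g: "integrable lborel g" for g :: "complex \<Rightarrow> complex"
  proof (rule integral_dominated_convergence[where w="\<lambda>w. norm (g w)"])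
    have [measurable]: "g \<in> borel_measurable borel" using g by auto
    show "g \<in> borel_measurable lborel" "\<And>R. (\<lambda>w. g w * I R w) \<in> borel_measurable lborel"
      by measurable
    show "AE w in lborel. (\<lambda>R. g w * I R w) \<longlonglongrightarrow> g w"
      using tendsto_mult[OF tendsto_const lim] by (intro AE_I2) (metis mult.right_neutral)
    show "\<And>R. AE w in lborel. norm (g w * I R w) \<le> norm (g w)"
      by (intro AE_I2) (auto simp: I_def norm_mult)
  qed (use g in auto)
  have disc: "(LINT w|lborel. f w * (cnj w ^ m * of_real (gauss \<alpha> l w)) * I R w)
     = a m * (LINT w|lborel. w ^ m * (cnj w ^ m * of_real (gauss \<alpha> l w)) * I R w)" for R
  proof -
    define \<phi> where "\<phi> w = cnj w ^ m * of_real (gauss \<alpha> l w) * I R w" for w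
    have [measurable]: "\<phi> \<in> borel_measurable borel" unfolding \<phi>_def by measurable
    define M where "M w = (\<Sum>n. cmod (a n) * cmod w ^ n)" for w
    have [measurable]: "M \<in> borel_measurable borel" unfolding M_def by measurable
    have M0: "0 \<le> M w" for w unfolding M_def by (intro suminf_nonneg sn) auto
    have MR: "M w \<le> (\<Sum>n. cmod (a n) * real R ^ n)" if "cmod w \<le> real R" for w
      unfolding M_def using that by (intro suminf_le sn mult_left_mono power_mono) auto
    define B where "B = (\<Sum>n. cmod (a n) * real R ^ n) * real R ^ m"
    have "integrable lborel (\<lambda>w. M w * cmod (\<phi> w))"
    proof (rule integrableI_bounded_set[where A="cball 0 (real R)" and B=B])
      show "emeasure lborel (cball (0::complex) (real R)) < \<infinity>" by (rule emeasure_lborel_cball_finite)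
      show "AE w in lborel. w \<notin> cball 0 (real R) \<longrightarrow> M w * cmod (\<phi> w) = 0"
        by (auto simp: \<phi>_def I_def)
      have "norm (M w * cmod (\<phi> w)) \<le> B" if w: "cmod w \<le> real R" for w
      proof -
        have "gauss \<alpha> l w \<le> 1" using \<alpha>_pos by (simp add: gauss_def)
        then have "cmod w ^ m * gauss \<alpha> l w \<le> real R ^ m * 1"
          using w by (intro mult_mono power_mono) auto
        then have "cmod (\<phi> w) \<le> real R ^ m"
          by (auto simp: \<phi>_def I_def norm_mult norm_power)
        then show ?thesis unfolding B_def using MR[OF w] M0[of w]
          by (auto simp: abs_mult intro!: mult_mono)
      qed
      then show "AE w in lborel. w \<in> cball 0 (real R) \<longrightarrow> norm (M w * cmod (\<phi> w)) \<le> B"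
        by auto
    qed auto
    from pairing_power_series(2)[OF _ sn this[unfolded M_def]]
    have S: "(\<lambda>n. a n * (LINT w|lborel. w ^ n * \<phi> w)) sums (LINT w|lborel. (\<Sum>n. a n * w ^ n) * \<phi> w)"
      by simp
    have z: "(LINT w|lborel. w ^ n * \<phi> w) = 0" if "n \<noteq> m" for n
      using integral_monomial_radial[OF that, of "\<lambda>r. exp (- (\<alpha> * r ^ (2 * l))) * (if r \<le> real R then 1 else 0)"]
      by (simp add: \<phi>_def gauss_def I_def mult.assoc)
    have "(\<lambda>n. a n * (LINT w|lborel. w ^ n * \<phi> w)) = (\<lambda>n. if n = m then a n * (LINT w|lborel. w ^ n * \<phi> w) else 0)"
      using z by auto
    then have "(\<lambda>n. a n * (LINT w|lborel. w ^ n * \<phi> w)) sums (a m * (LINT w|lborel. w ^ m * \<phi> w))"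
      using sums_single[of m "\<lambda>n. a n * (LINT w|lborel. w ^ n * \<phi> w)"] by simp
    with S have "(LINT w|lborel. (\<Sum>n. a n * w ^ n) * \<phi> w) = a m * (LINT w|lborel. w ^ m * \<phi> w)"
      by (rule sums_unique2)
    moreover have "(\<Sum>n. a n * w ^ n) = f w" for w
      using sums[of w] by (simp add: sums_iff)
    ultimately show ?thesis by (simp add: \<phi>_def mult.assoc)
  qed
  have "(\<lambda>R. a m * (LINT w|lborel. w ^ m * (cnj w ^ m * of_real (gauss \<alpha> l w)) * I R w))
      \<longlonglongrightarrow> a m * (LINT w|lborel. w ^ m * (cnj w ^ m * of_real (gauss \<alpha> l w)))"
    by (intro tendsto_mult tendsto_const trunc monomial_integrable)
  moreover have "(\<lambda>R. a m * (LINT w|lborel. w ^ m * (cnj w ^ m * of_real (gauss \<alpha> l w)) * I R w))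
      \<longlonglongrightarrow> (LINT w|lborel. f w * (cnj w ^ m * of_real (gauss \<alpha> l w)))"
    unfolding disc[symmetric] by (rule trunc[OF int])
  ultimately show ?thesis
    using LIMSEQ_unique integral_monomials[of m m] by (fastforce simp: divide_inverse)
qed

section \<open>The Bergman projection\<close>

definition proj :: "(complex \<Rightarrow> complex) \<Rightarrow> complex \<Rightarrow> complex" where
  "proj g z = (LINT w|lborel. bergman_kernel \<alpha> l z w * (g w * of_real (gauss \<alpha> l w)))"

lemma proj_integrable:
  assumes "tame g"
  shows "integrable lborel (\<lambda>w. bergman_kernel \<alpha> l z w * (g w * of_real (gauss \<alpha> l w)))"
proof -
  have "integrable lborel (\<lambda>w. cnj (bergman_kernel \<alpha> l w z * (cnj (g w) * of_real (gauss \<alpha> l w))))"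
    by (intro integrable_cnj E_space_pairing_integrable E_space_kernel tame_cnj assms)
  then show ?thesis by (simp add: bergman_kernel_cnj)
qed

lemma proj_eq_cnj: "proj g z = cnj (LINT w|lborel. bergman_kernel \<alpha> l w z * (cnj (g w) * of_real (gauss \<alpha> l w)))"
  unfolding proj_def by (subst Bochner_Integration.integral_cnj[symmetric]) (simp add: bergman_kernel_cnj)

lemma proj_sums:
  assumes "tame g"
  shows "(\<lambda>n. of_real (kcoef \<alpha> l n) * (LINT w|lborel. g w * (cnj w ^ n * of_real (gauss \<alpha> l w))) * z ^ n) sums proj g z"
proof -
  have "(\<lambda>n. cnj (of_real (kcoef \<alpha> l n) * cnj z ^ n * (LINT w|lborel. w ^ n * (cnj (g w) * of_real (gauss \<alpha> l w)))))
     sums proj g z"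
    unfolding proj_eq_cnj sums_cnj
    by (intro exp_type_pairing kernel_exp_type kernel_sums tame_cnj assms)
  moreover have "cnj (LINT w|lborel. w ^ n * (cnj (g w) * of_real (gauss \<alpha> l w)))
      = (LINT w|lborel. g w * (cnj w ^ n * of_real (gauss \<alpha> l w)))" for n
    by (subst Bochner_Integration.integral_cnj[symmetric]) (simp add: mult_ac)
  ultimately show ?thesis by (simp add: mult_ac)
qed

lemma proj_entire: "tame g \<Longrightarrow> proj g \<in> entire"
  by (rule power_series_entire[OF proj_sums])

lemma proj_add: "tame f \<Longrightarrow> tame g \<Longrightarrow> proj (\<lambda>w. f w + g w) z = proj f z + proj g z"
  using Bochner_Integration.integral_add[OF proj_integrable[of f z] proj_integrable[of g z]]
  by (simp add: proj_def algebra_simps)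

lemma proj_scale: "proj (\<lambda>w. c * f w) z = c * proj f z"
proof -
  have "proj (\<lambda>w. c * f w) z = (LINT w|lborel. c * (bergman_kernel \<alpha> l z w * (f w * of_real (gauss \<alpha> l w))))"
    by (simp add: proj_def mult_ac)
  then show ?thesis by (simp add: proj_def)
qed

text \<open>The coefficients of \<open>P f\<close> are computed by integrating \<open>f\<close> against monomials, which recovers the Taylor
  coefficients of \<open>f\<close>.\<close>

lemma proj_reproducing:
  assumes "f \<in> entire" "tame f"
  shows "proj f = f"
proof
  fix z
  obtain a where a: "\<And>w. (\<lambda>n. a n * w ^ n) sums f w"
    using entire_power_series[OF assms(1)] by metis
  have "integrable lborel (\<lambda>w. f w * (cnj w ^ n * of_real (gauss \<alpha> l w)))" for n
  proof -
    have "integrable lborel (\<lambda>w. cnj (w ^ n * (cnj (f w) * of_real (gauss \<alpha> l w))))"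
      by (intro integrable_cnj E_space_pairing_integrable E_space_monomial tame_cnj assms)
    then show ?thesis by (simp add: mult_ac)
  qed
  then have "(LINT w|lborel. f w * (cnj w ^ n * of_real (gauss \<alpha> l w))) = a n / of_real (kcoef \<alpha> l n)" for n
    using integral_coefficient[OF a] by blast
  then have "(\<lambda>n. a n * z ^ n) sums proj f z"
    using proj_sums[OF assms(2), of z] kcoef_pos by (simp add: less_imp_neq[symmetric])
  then show "proj f z = f z" using a sums_unique2 by blast
qed

lemma small_hankel_eq:
  assumes [measurable]: "b \<in> borel_measurable borel" "f \<in> borel_measurable borel"
  shows "small_hankel \<alpha> l b f z
    = (LINT w|lborel. (bergman_kernel \<alpha> l w z * f w) * (cnj (b w) * of_real (gauss \<alpha> l w)))"
proof -
  have "small_hankel \<alpha> l b f z = (LINT w|completion lborel. (bergman_kernel \<alpha> l w z * f w) * (cnj (b w) * of_real (gauss \<alpha> l w)))"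
    by (simp add: small_hankel_def gauss_def mult.assoc)
  also have "\<dots> = (LINT w|lborel. (bergman_kernel \<alpha> l w z * f w) * (cnj (b w) * of_real (gauss \<alpha> l w)))"
    by (rule integral_completion) measurable
  finally show ?thesis .
qed

end

section \<open>Distance to the roots\<close>

lemma integrable_of_real_D: "integrable M (\<lambda>x. complex_of_real (f x)) \<Longrightarrow> integrable M f"
  using integrable_Re[of M "\<lambda>x. complex_of_real (f x)"] by simp

lemma ennreal_sum_mult:
  "0 \<le> a \<Longrightarrow> 0 \<le> b \<Longrightarrow> 0 \<le> c \<Longrightarrow> 0 \<le> d \<Longrightarrow>
    ennreal (a * b + c * d) = ennreal a * ennreal b + ennreal c * ennreal d"
  by (simp add: ennreal_mult)

lemma one_plus_norm_power_pos: "0 < (1 + norm z) ^ n"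
  by (intro zero_less_power add_pos_nonneg) auto

lemma norm_square_cnj: "(complex_of_real (cmod z))\<^sup>2 = z * cnj z"
  using complex_norm_square[of z] by simp

lemma roots_of_unity_product:
  fixes u :: complex
  assumes l: "l \<ge> 1"
  shows "u ^ l - 1 = (\<Prod>\<omega>\<in>{\<omega>. \<omega> ^ l = 1}. (u - \<omega>))"
proof -
  define A where "A = {\<omega>::complex. \<omega> ^ l = 1}"
  have A: "finite A" "card A = l"
    using l card_roots_unity_eq[of l] finite_roots_unity[of l] by (auto simp: A_def)
  define p :: "complex poly" where "p = monom 1 l - 1"
  define q :: "complex poly" where "q = (\<Prod>\<omega>\<in>A. [:-\<omega>, 1:])"
  have dq: "degree q = l"
    unfolding q_def using A by (subst degree_prod_eq_sum_degree) auto
  have lq: "lead_coeff q = 1"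
    unfolding q_def by (simp add: lead_coeff_prod)
  have "p = q"
  proof (rule poly_eqI_degree_lead_coeff[where n=l and A=A])
    show "poly.coeff p l = poly.coeff q l"
      using l lq dq by (simp add: p_def)
    show "degree p \<le> l" unfolding p_def
      by (intro degree_diff_le degree_monom_le) auto
    show "poly p z = poly q z" if "z \<in> A" for z
    proof -
      have "poly q z = 0" unfolding q_def poly_prod
        using that A by (intro prod_zero) (auto intro!: bexI[of _ z])
      then show ?thesis using that by (simp add: p_def A_def poly_monom)
    qed
  qed (use A dq in auto)
  then have "poly p u = poly q u" by simp
  then show ?thesis
    by (simp add: p_def q_def poly_monom poly_prod A_def)
qed

text \<open>All factors of \<open>u\<^sup>l - 1\<close> but the one of the nearest root are bounded below.\<close>

lemma nearest_root_bound:
  assumes l: "l \<ge> 1"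
  obtains c where "c > 0" "\<And>u::complex. \<exists>\<omega>. \<omega> ^ l = 1 \<and> c * cmod (u - \<omega>) \<le> cmod (u ^ l - 1)"
proof -
  define A where "A = {\<omega>::complex. \<omega> ^ l = 1}"
  have "1 \<in> A" by (simp add: A_def)
  then have "A \<noteq> {}" by blast
  moreover have "finite A" "card A = l"
    using l card_roots_unity_eq[of l] finite_roots_unity[of l] by (auto simp: A_def)
  ultimately have A: "finite A" "card A = l" "A \<noteq> {}" by auto
  define D where "D = insert 1 ((\<lambda>(x, y). cmod (x - y)) ` {(x, y) \<in> A \<times> A. x \<noteq> y})"
  have "finite {(x, y) \<in> A \<times> A. x \<noteq> y}"
    by (rule finite_subset[of _ "A \<times> A"]) (use A(1) in auto)
  then have D: "finite D" "D \<noteq> {}" "\<And>d. d \<in> D \<Longrightarrow> d > 0"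
    unfolding D_def by auto
  define d where "d = Min D"
  have d: "d > 0" unfolding d_def by (intro D(3) Min_in D(1,2))
  have dA: "d \<le> cmod (x - y)" if "x \<in> A" "y \<in> A" "x \<noteq> y" for x y
    unfolding d_def using that D by (intro Min_le) (auto simp: D_def)
  show thesis
  proof (rule that[of "(d / 2) ^ (l - 1)"])
    show "(d / 2) ^ (l - 1) > 0" using d by simp
    fix u :: complex
    define \<omega> where "\<omega> = arg_min_on (\<lambda>x. cmod (u - x)) A"
    have \<omega>: "\<omega> \<in> A" "\<And>x. x \<in> A \<Longrightarrow> cmod (u - \<omega>) \<le> cmod (u - x)"
      using arg_min_if_finite[OF A(1,3), of "\<lambda>x. cmod (u - x)"] by (auto simp: \<omega>_def not_less)
    have far: "d / 2 \<le> cmod (u - x)" if "x \<in> A - {\<omega>}" for x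
    proof -
      have "d \<le> cmod (x - \<omega>)" using that \<omega>(1) by (intro dA) auto
      also have "\<dots> \<le> cmod (u - \<omega>) + cmod (u - x)"
        using norm_triangle_ineq4[of "u - \<omega>" "u - x"] by (simp add: algebra_simps)
      also have "\<dots> \<le> 2 * cmod (u - x)" using \<omega>(2)[of x] that by simp
      finally show ?thesis by simp
    qed
    have "(d / 2) ^ (l - 1) = (\<Prod>x\<in>A - {\<omega>}. d / 2)"
      using A \<omega>(1) by simp
    also have "\<dots> \<le> (\<Prod>x\<in>A - {\<omega>}. cmod (u - x))"
      using far d by (intro prod_mono) auto
    finally have "(d / 2) ^ (l - 1) * cmod (u - \<omega>) \<le> cmod (u - \<omega>) * (\<Prod>x\<in>A - {\<omega>}. cmod (u - x))"
      by (simp add: mult.commute mult_left_mono)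
    also have "\<dots> = cmod (u ^ l - 1)"
      unfolding roots_of_unity_product[OF l] prod_norm[symmetric] A_def[symmetric]
      using A \<omega>(1) by (subst prod.remove[of A \<omega>]) auto
    finally show "\<exists>\<omega>. \<omega> ^ l = 1 \<and> (d / 2) ^ (l - 1) * cmod (u - \<omega>) \<le> cmod (u ^ l - 1)"
      using \<omega>(1) by (auto simp: A_def)
  qed
qed

text \<open>For \<open>|z| \<ge> 1\<close> the function is dominated by the sum over the roots of unity \<open>\<omega>\<close> of bumps centred at \<open>\<omega> z\<close>
  of width comparable to \<open>|z|\<^sup>1\<^sup>-\<^sup>l\<close>; for smaller \<open>|z|\<close> it is dominated by one fixed integrable function.\<close>

lemma nn_integral_power_distance:
  assumes l: "l \<ge> 1"
  obtains C where "C > 0"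
    "\<And>z. (\<integral>\<^sup>+w. ennreal (1 / (1 + (cmod (w ^ l - z ^ l))\<^sup>2)\<^sup>2) \<partial>lborel) \<le> ennreal (C / (1 + cmod z) ^ (2 * l - 2))"
proof -
  obtain J where J: "(\<integral>\<^sup>+w. ennreal (1 / (1 + (cmod w)\<^sup>2)\<^sup>2) \<partial>lborel) = ennreal J" "J \<ge> 0"
    using nn_integral_inverse_square_finite
    by (cases "\<integral>\<^sup>+w. ennreal (1 / (1 + (cmod w)\<^sup>2)\<^sup>2) \<partial>lborel") auto
  obtain c where c: "c > 0" "\<And>u::complex. \<exists>\<omega>. \<omega> ^ l = 1 \<and> c * cmod (u - \<omega>) \<le> cmod (u ^ l - 1)"
    using nearest_root_bound[OF l] by metis
  have scaled: "(\<integral>\<^sup>+w. ennreal (1 / (1 + (s * cmod (w - a))\<^sup>2)\<^sup>2) \<partial>lborel) = ennreal (J / s\<^sup>2)"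
    if "s > 0" for s :: real and a :: complex
  proof -
    have "(\<integral>\<^sup>+w. ennreal (1 / (1 + (s * cmod (w - a))\<^sup>2)\<^sup>2) \<partial>lborel)
       = (\<integral>\<^sup>+w. ennreal (1 / (1 + (cmod (of_real s * (w - a)))\<^sup>2)\<^sup>2) \<partial>lborel)"
      using that by (simp add: norm_mult)
    also have "\<dots> = ennreal (1 / s\<^sup>2) * ennreal J"
      unfolding J(1)[symmetric]
      by (rule nn_integral_complex_translate_scale[where f="\<lambda>w. ennreal (1 / (1 + (cmod w)\<^sup>2)\<^sup>2)"])
        (use that in auto)
    finally show ?thesis using J(2) by (simp add: ennreal_mult[symmetric])
  qed
  define A where "A = {\<omega>::complex. \<omega> ^ l = 1}"
  have A: "finite A" "card A = l"
    using l card_roots_unity_eq[of l] finite_roots_unity[of l] by (auto simp: A_def)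
  define C where "C = 2 ^ (2 * l - 2) * (16 * J + l * J / c\<^sup>2 + 1)"
  have sum_pos: "16 * J + l * J / c\<^sup>2 + 1 > 0"
    using J(2) c(1) by (intro add_nonneg_pos add_nonneg_nonneg) auto
  show thesis
  proof (rule that[of C])
    show "C > 0" using sum_pos by (simp add: C_def)
    fix z :: complex
    show "(\<integral>\<^sup>+w. ennreal (1 / (1 + (cmod (w ^ l - z ^ l))\<^sup>2)\<^sup>2) \<partial>lborel) \<le> ennreal (C / (1 + cmod z) ^ (2 * l - 2))"
    proof (cases "cmod z \<ge> 1")
      case True
      define s where "s = c * cmod z ^ (l - 1)"
      have z: "z \<noteq> 0" using True by auto
      have s: "s > 0" using c(1) z by (simp add: s_def)
      have pt: "1 / (1 + (cmod (w ^ l - z ^ l))\<^sup>2)\<^sup>2 \<le> (\<Sum>\<omega>\<in>A. 1 / (1 + (s * cmod (w - \<omega> * z))\<^sup>2)\<^sup>2)" for w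
      proof -
        obtain \<omega> where \<omega>: "\<omega> ^ l = 1" "c * cmod (w / z - \<omega>) \<le> cmod ((w / z) ^ l - 1)"
          using c(2) by blast
        have "s * cmod (w - \<omega> * z) = cmod z ^ l * (c * cmod (w / z - \<omega>))"
        proof -
          have "cmod (w - \<omega> * z) = cmod z * cmod (w / z - \<omega>)"
            using z by (subst norm_mult[symmetric]) (simp add: right_diff_distrib mult.commute)
          moreover have "cmod z ^ l = cmod z ^ (l - 1) * cmod z"
            using l by (cases l) auto
          ultimately show ?thesis by (simp add: s_def)
        qed
        also have "\<dots> \<le> cmod z ^ l * cmod ((w / z) ^ l - 1)"
          using \<omega>(2) by (intro mult_left_mono) auto
        also have "\<dots> = cmod (w ^ l - z ^ l)"
          using z by (subst norm_power[symmetric], subst norm_mult[symmetric]) (simp add: right_diff_distrib power_divide)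
        finally have le: "s * cmod (w - \<omega> * z) \<le> cmod (w ^ l - z ^ l)" .
        have "1 / (1 + (cmod (w ^ l - z ^ l))\<^sup>2)\<^sup>2 \<le> 1 / (1 + (s * cmod (w - \<omega> * z))\<^sup>2)\<^sup>2"
          using s le by (intro divide_left_mono power_mono add_left_mono mult_pos_pos zero_less_power add_pos_nonneg) auto
        also have "\<dots> \<le> (\<Sum>\<omega>\<in>A. 1 / (1 + (s * cmod (w - \<omega> * z))\<^sup>2)\<^sup>2)"
          using A \<omega>(1) by (intro member_le_sum[where f="\<lambda>\<omega>. 1 / (1 + (s * cmod (w - \<omega> * z))\<^sup>2)\<^sup>2"]) (auto simp: A_def)
        finally show ?thesis .
      qed
      have "(\<integral>\<^sup>+w. ennreal (1 / (1 + (cmod (w ^ l - z ^ l))\<^sup>2)\<^sup>2) \<partial>lborel)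
         \<le> (\<integral>\<^sup>+w. (\<Sum>\<omega>\<in>A. ennreal (1 / (1 + (s * cmod (w - \<omega> * z))\<^sup>2)\<^sup>2)) \<partial>lborel)"
        by (intro nn_integral_mono, subst sum_ennreal, simp, rule ennreal_leI, rule pt)
      also have "\<dots> = (\<Sum>\<omega>\<in>A. ennreal (J / s\<^sup>2))"
        by (subst nn_integral_sum) (auto simp: scaled[OF s])
      also have "\<dots> = ennreal (l * (J / s\<^sup>2))"
        using A J(2) ennreal_mult[of "real l" "J / s\<^sup>2"] by (simp add: ennreal_of_nat_eq_real_of_nat)
      also have "\<dots> \<le> ennreal (C / (1 + cmod z) ^ (2 * l - 2))"
      proof (rule ennreal_leI)
        have e: "2 * (l - 1) = 2 * l - 2" by simp
        have "(1 + cmod z) ^ (2 * l - 2) \<le> (2 * cmod z) ^ (2 * l - 2)"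
          using True by (intro power_mono) auto
        also have "\<dots> = 2 ^ (2 * l - 2) * (cmod z ^ (l - 1))\<^sup>2"
          by (simp only: power_mult_distrib power_mult[symmetric] mult.commute[of _ 2] e)
        finally have p: "(1 + cmod z) ^ (2 * l - 2) \<le> 2 ^ (2 * l - 2) * (cmod z ^ (l - 1))\<^sup>2" .
        have zp: "cmod z ^ (l - 1) > 0" "(1 + cmod z) ^ (2 * l - 2) > 0"
          using z by (auto simp: one_plus_norm_power_pos)
        have "l * (J / s\<^sup>2) = (l * J / c\<^sup>2) / (cmod z ^ (l - 1))\<^sup>2"
          by (simp add: s_def power_mult_distrib)
        also have "\<dots> \<le> (l * J / c\<^sup>2) * (2 ^ (2 * l - 2) / (1 + cmod z) ^ (2 * l - 2))"
        proof -
          have "1 / (cmod z ^ (l - 1))\<^sup>2 \<le> 2 ^ (2 * l - 2) / (1 + cmod z) ^ (2 * l - 2)"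
          proof -
            have "1 / t \<le> N / D" if "D \<le> N * t" "t > 0" "D > 0" for t N D :: real
              using that by (simp add: field_simps)
            from this[OF p zero_less_power[OF zp(1)] zp(2)] show ?thesis .
          qed
          from mult_left_mono[OF this, of "l * J / c\<^sup>2"] J(2) show ?thesis by simp
        qed
        also have "\<dots> \<le> (16 * J + l * J / c\<^sup>2 + 1) * (2 ^ (2 * l - 2) / (1 + cmod z) ^ (2 * l - 2))"
          using J(2) zp by (intro mult_right_mono) auto
        finally show "l * (J / s\<^sup>2) \<le> C / (1 + cmod z) ^ (2 * l - 2)"
          by (simp add: C_def mult.commute)
      qed
      finally show ?thesis .
    next
      case False
      have pt: "1 / (1 + (cmod (w ^ l - z ^ l))\<^sup>2)\<^sup>2 \<le> 4 * (1 / (1 + ((1/2) * cmod (w - 0))\<^sup>2)\<^sup>2)" for w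
      proof (cases "cmod w \<le> 2")
        case True
        then have "(cmod w)\<^sup>2 \<le> 2\<^sup>2" by (intro power_mono) auto
        then have "1 + ((1/2) * cmod (w - 0))\<^sup>2 \<le> 2" by (simp add: power_divide)
        then have "(1 + ((1/2) * cmod (w - 0))\<^sup>2)\<^sup>2 \<le> 2\<^sup>2" by (intro power_mono) auto
        moreover have "1 \<le> 4 * (1 / s)" if "s \<le> 2\<^sup>2" "s > 0" for s :: real
          using that by (simp add: field_simps)
        moreover have "(1 + ((1/2) * cmod (w - 0))\<^sup>2)\<^sup>2 > 0"
          by (intro zero_less_power add_pos_nonneg) auto
        ultimately have "1 \<le> 4 * (1 / (1 + ((1/2) * cmod (w - 0))\<^sup>2)\<^sup>2)"
          by blast
        moreover have "1 / (1 + (cmod (w ^ l - z ^ l))\<^sup>2)\<^sup>2 \<le> 1"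
        proof -
          have "1 / s \<le> 1" if "1 \<le> s" for s :: real using that by simp
          moreover have "1 \<le> (1 + (cmod (w ^ l - z ^ l))\<^sup>2)\<^sup>2" by (intro one_le_power) simp
          ultimately show ?thesis by blast
        qed
        ultimately show ?thesis by linarith
      next
        case w: False
        have "cmod z ^ l \<le> 1" using False by (intro power_le_one) auto
        moreover have "cmod w \<le> cmod w ^ l" using w l by (intro self_le_power) auto
        moreover have "cmod w ^ l - cmod z ^ l \<le> cmod (w ^ l - z ^ l)"
          using norm_triangle_ineq2[of "w ^ l" "z ^ l"] by (simp add: norm_power)
        ultimately have "(1/2) * cmod (w - 0) \<le> cmod (w ^ l - z ^ l)" using w by simp
        then have "1 / (1 + (cmod (w ^ l - z ^ l))\<^sup>2)\<^sup>2 \<le> 1 / (1 + ((1/2) * cmod (w - 0))\<^sup>2)\<^sup>2"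
          by (intro divide_left_mono power_mono add_left_mono mult_pos_pos zero_less_power add_pos_nonneg) auto
        also have "\<dots> \<le> 4 * (1 / (1 + ((1/2) * cmod (w - 0))\<^sup>2)\<^sup>2)"
        proof -
          have "x \<le> 4 * x" if "x \<ge> 0" for x :: real using that by simp
          moreover have "0 \<le> 1 / (1 + ((1/2) * cmod (w - 0))\<^sup>2)\<^sup>2" by simp
          ultimately show ?thesis by blast
        qed
        finally show ?thesis .
      qed
      have "(\<integral>\<^sup>+w. ennreal (1 / (1 + (cmod (w ^ l - z ^ l))\<^sup>2)\<^sup>2) \<partial>lborel)
         \<le> (\<integral>\<^sup>+w. ennreal 4 * ennreal (1 / (1 + ((1/2) * cmod (w - 0))\<^sup>2)\<^sup>2) \<partial>lborel)"
        unfolding ennreal_mult'[symmetric, OF zero_le_numeral] by (intro nn_integral_mono ennreal_leI pt)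
      also have "\<dots> = ennreal 4 * ennreal (J / (1/2)\<^sup>2)"
        using scaled[of "1/2" 0] by (subst nn_integral_cmult) simp_all
      also have "\<dots> = ennreal (16 * J)"
        using J(2) by (subst ennreal_mult[symmetric]) (auto simp: power2_eq_square)
      also have "\<dots> \<le> ennreal (C / (1 + cmod z) ^ (2 * l - 2))"
      proof (rule ennreal_leI)
        have "(1 + cmod z) ^ (2 * l - 2) \<le> 2 ^ (2 * l - 2)"
          using False by (intro power_mono) auto
        moreover have zp: "(1 + cmod z) ^ (2 * l - 2) > 0"
          by (rule one_plus_norm_power_pos)
        ultimately have "1 \<le> 2 ^ (2 * l - 2) / (1 + cmod z) ^ (2 * l - 2)" by simp
        then have "16 * J * 1 \<le> (16 * J + l * J / c\<^sup>2 + 1) * (2 ^ (2 * l - 2) / (1 + cmod z) ^ (2 * l - 2))"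
          using J(2) c(1) by (intro mult_mono) auto
        then show "16 * J \<le> C / (1 + cmod z) ^ (2 * l - 2)"
          by (simp add: C_def mult.commute)
      qed
      finally show ?thesis .
    qed
  qed
qed

section \<open>The kernel is concentrated near the roots\<close>

lemma weight_pos [simp]: "weight \<alpha> l z > 0" "weight \<alpha> l z \<ge> 0"
  by (auto simp: weight_def)

lemma weight_measurable [measurable]: "weight \<alpha> l \<in> borel_measurable borel"
  unfolding weight_def by measurable

lemma weight_square: "weight \<alpha> l z * weight \<alpha> l z = gauss \<alpha> l z"
  by (simp add: weight_def gauss_def exp_add[symmetric])

lemma inverse_weight: "exp (\<alpha> * cmod z ^ (2 * l) / 2) * weight \<alpha> l z = 1"
  by (simp add: weight_def exp_minus)

context fock_params begin

text \<open>The adjoint of multiplication by \<open>w\<^sup>l\<close> sends \<open>w\<^sup>k\<close> to \<open>qstep k w\<^sup>k\<^sup>-\<^sup>l\<close>. The truncated subtraction makes the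
  factor vanish for \<open>k < l\<close>, where there is no monomial left.\<close>

definition qstep :: "nat \<Rightarrow> real" where
  "qstep k = real (k + 1 - l) / (l * \<alpha>)"

lemma kcoef_qstep: "l \<le> k \<Longrightarrow> kcoef \<alpha> l (k - l) = kcoef \<alpha> l k * qstep k"
  using kcoef_shift[of "k - l"] by (simp add: qstep_def Suc_diff_le)

lemma qstep_eq_0: "k < l \<Longrightarrow> qstep k = 0"
  by (simp add: qstep_def)

text \<open>Where \<open>qstep\<close> is linear the terms in \<open>T\<close> cancel and the products have second difference \<open>2 / \<alpha>\<^sup>2\<close>. Near the
  truncation \<open>qstep\<close> is still convex, so the terms in \<open>T\<close> have the right sign, and the products stay bounded.\<close>

lemma qstep_second_difference:
  fixes T :: real
  assumes "T \<ge> 0"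
  shows "(qstep (m + 2 * l) * qstep (m + l) - 2 * T * qstep (m + 2 * l) + T\<^sup>2)
     - 2 * (qstep (m + l) * qstep m - 2 * T * qstep (m + l) + T\<^sup>2)
     + (qstep m * qstep (m - l) - 2 * T * qstep m + T\<^sup>2) \<le> 3 / \<alpha>\<^sup>2"
proof -
  define n where "n = real (m + 1)"
  define L where "L = real l"
  have L: "L > 0" using l_pos by (simp add: L_def)
  define x where "x = real (m + 1 - l)"
  define y where "y = real (m - l + 1 - l)"
  have q: "qstep (m + 2 * l) = (n + L) / (L * \<alpha>)" "qstep (m + l) = n / (L * \<alpha>)"
    "qstep m = x / (L * \<alpha>)" "qstep (m - l) = y / (L * \<alpha>)"
    by (simp_all add: qstep_def n_def L_def x_def y_def algebra_simps)
  have n: "n \<ge> 0" by (simp add: n_def)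
  have x: "x \<ge> n - L" "x \<ge> 0" by (auto simp: x_def n_def L_def)
  have main: "(n + L) * n - 2 * n * x + x * y \<le> 3 * L\<^sup>2"
  proof -
    consider "m + 1 \<le> l" | "l < m + 1" "m + 1 < 2 * l" | "2 * l \<le> m + 1" by linarith
    then show ?thesis
    proof cases
      case 1
      then have "x = 0" "n \<le> L" by (auto simp: x_def n_def L_def)
      then have "(n + L) * n - 2 * n * x + x * y = n * n + L * n" by (simp add: algebra_simps)
      also have "\<dots> \<le> L * L + L * L" using \<open>n \<le> L\<close> n L by (intro add_mono mult_mono) auto
      also have "\<dots> \<le> 3 * L\<^sup>2" using L by (simp add: power2_eq_square)
      finally show ?thesis .
    next
      case 2
      then have y: "y = 0" and x': "x = n - L" by (auto simp: x_def y_def n_def L_def)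
      have "(n + L) * n - 2 * n * x + x * y = 3 * L * n - n\<^sup>2"
        unfolding y x' by (simp add: algebra_simps power2_eq_square)
      also have "\<dots> = (9/4) * L\<^sup>2 - (n - (3/2) * L)\<^sup>2" by (simp add: algebra_simps power2_eq_square)
      also have "\<dots> \<le> (9/4) * L\<^sup>2" by simp
      also have "\<dots> \<le> 3 * L\<^sup>2" by simp
      finally show ?thesis .
    next
      case 3
      then have y: "y = n - 2 * L" and x': "x = n - L"
        using l_pos by (auto simp: x_def y_def n_def L_def of_nat_diff)
      have "(n + L) * n - 2 * n * x + x * y = 2 * L\<^sup>2"
        unfolding y x' by (simp add: algebra_simps power2_eq_square)
      then show ?thesis by simp
    qed
  qed
  have "(qstep (m + 2 * l) * qstep (m + l) - 2 * T * qstep (m + 2 * l) + T\<^sup>2)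
     - 2 * (qstep (m + l) * qstep m - 2 * T * qstep (m + l) + T\<^sup>2)
     + (qstep m * qstep (m - l) - 2 * T * qstep m + T\<^sup>2)
    = (qstep (m + 2 * l) * qstep (m + l) - 2 * qstep (m + l) * qstep m + qstep m * qstep (m - l))
      - 2 * T * (qstep (m + 2 * l) - 2 * qstep (m + l) + qstep m)"
    by (simp add: algebra_simps)
  also have "\<dots> = ((n + L) * n - 2 * n * x + x * y) / (L * \<alpha>)\<^sup>2 - 2 * T * ((x - (n - L)) / (L * \<alpha>))"
    unfolding q by (simp add: diff_divide_distrib add_divide_distrib power2_eq_square algebra_simps)
  also have "\<dots> \<le> ((n + L) * n - 2 * n * x + x * y) / (L * \<alpha>)\<^sup>2"
    using assms x L \<alpha>_pos by simp
  also have "\<dots> \<le> 3 * L\<^sup>2 / (L * \<alpha>)\<^sup>2"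
    by (intro divide_right_mono main) simp
  also have "\<dots> = 3 / \<alpha>\<^sup>2" using L by (simp add: power_mult_distrib)
  finally show ?thesis .
qed

text \<open>By orthogonality only the terms of the kernel series with index \<open>k\<close>, \<open>k - l\<close> and \<open>k - 2l\<close> contribute.\<close>

lemma kernel_bracket:
  "(LINT w|lborel. bergman_kernel \<alpha> l w z * ((w ^ l - z ^ l)\<^sup>2 * (cnj w ^ k * of_real (gauss \<alpha> l w))))
    = of_real (qstep k * qstep (k - l)) * cnj z ^ (k - 2 * l)
      - 2 * z ^ l * of_real (qstep k) * cnj z ^ (k - l) + z ^ (2 * l) * cnj z ^ k"
proof -
  define c where "c = kcoef \<alpha> l"
  have c: "c m > 0" for m using kcoef_pos by (simp add: c_def)
  define M where "M n = (LINT w|lborel. w ^ n * (cnj w ^ k * of_real (gauss \<alpha> l w)))" for n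
  have M: "M n = (if n = k then of_real (1 / c k) else 0)" for n
    using integral_monomials[of n k] by (simp add: M_def c_def)
  define t where "t n = of_real (c n) * cnj z ^ n * (M (n + 2 * l) - 2 * z ^ l * M (n + l) + z ^ (2 * l) * M n)" for n
  have mono_int: "integrable lborel (\<lambda>w. w ^ n * (cnj w ^ k * of_real (gauss \<alpha> l w)))" for n
    by (rule monomial_integrable)
  have inner: "(LINT w|lborel. w ^ n * (((w ^ l - z ^ l)\<^sup>2 * cnj w ^ k) * of_real (gauss \<alpha> l w)))
      = M (n + 2 * l) - 2 * z ^ l * M (n + l) + z ^ (2 * l) * M n" for n
  proof -
    have "w ^ n * (((w ^ l - z ^ l)\<^sup>2 * cnj w ^ k) * of_real (gauss \<alpha> l w))
       = w ^ (n + 2 * l) * (cnj w ^ k * of_real (gauss \<alpha> l w))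
         - 2 * z ^ l * (w ^ (n + l) * (cnj w ^ k * of_real (gauss \<alpha> l w)))
         + z ^ (2 * l) * (w ^ n * (cnj w ^ k * of_real (gauss \<alpha> l w)))" for w
    proof -
      have "w ^ (n + 2 * l) = w ^ n * (w ^ l)\<^sup>2" "w ^ (n + l) = w ^ n * w ^ l" "z ^ (2 * l) = (z ^ l)\<^sup>2"
        by (simp_all add: power_add power_mult[symmetric] mult.commute)
      then show ?thesis by (simp only:) (simp add: power2_eq_square algebra_simps)
    qed
    then show ?thesis
      unfolding M_def using mono_int by (simp only:) simp
  qed
  have "tame (\<lambda>w. (w ^ l - z ^ l)\<^sup>2 * cnj w ^ k)"
  proof -
    from E_space_mult[OF E_space_power_diff E_space_power_diff, of z z] show ?thesis
      using tame_mult_E_space[of "\<lambda>w. (w ^ l - z ^ l)\<^sup>2" "\<lambda>w. cnj w ^ k"]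
        tame_cnj[OF tame_E_space[OF E_space_monomial[of k]]] by (simp add: power2_eq_square)
  qed
  from exp_type_pairing[OF kernel_exp_type kernel_sums this]
  have S: "t sums (LINT w|lborel. bergman_kernel \<alpha> l w z * ((w ^ l - z ^ l)\<^sup>2 * (cnj w ^ k * of_real (gauss \<alpha> l w))))"
    unfolding inner t_def c_def by (simp add: mult.assoc)
  have part: "(\<lambda>n. of_real (c n) * cnj z ^ n * M (n + j)) sums
      (if j \<le> k then of_real (c (k - j) / c k) * cnj z ^ (k - j) else 0)" for j
  proof (cases "j \<le> k")
    case True
    have "(\<lambda>n. of_real (c n) * cnj z ^ n * M (n + j)) =
        (\<lambda>n. if n = k - j then of_real (c n / c k) * cnj z ^ n else 0)"
      using True c[of k] by (auto simp: M fun_eq_iff)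
    then show ?thesis
      using True sums_single[of "k - j" "\<lambda>n. of_real (c n / c k) * cnj z ^ n"] by simp
  next
    case False
    then have "(\<lambda>n. of_real (c n) * cnj z ^ n * M (n + j)) = (\<lambda>n. 0)" by (auto simp: M)
    then show ?thesis using False by simp
  qed
  have q1: "(if l \<le> k then of_real (c (k - l) / c k) * cnj z ^ (k - l) else 0) = of_real (qstep k) * cnj z ^ (k - l)"
    using kcoef_qstep[of k] c[of k] qstep_eq_0[of k] by (auto simp: c_def)
  have q2: "(if 2 * l \<le> k then of_real (c (k - 2 * l) / c k) * cnj z ^ (k - 2 * l) else 0)
      = of_real (qstep k * qstep (k - l)) * cnj z ^ (k - 2 * l)"
  proof (cases "2 * l \<le> k")
    case True
    have "c (k - 2 * l) = c k * qstep k * qstep (k - l)"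
      using kcoef_qstep[of k] kcoef_qstep[of "k - l"] True by (simp add: c_def mult_2)
    then show ?thesis using True c[of k] by simp
  next
    case False
    then have "qstep k * qstep (k - l) = 0"
      using qstep_eq_0[of k] qstep_eq_0[of "k - l"] by (cases "k < l") auto
    then show ?thesis using False by (simp only:) simp
  qed
  have "(\<lambda>n. of_real (c n) * cnj z ^ n * M (n + 2 * l) - 2 * z ^ l * (of_real (c n) * cnj z ^ n * M (n + l))
      + z ^ (2 * l) * (of_real (c n) * cnj z ^ n * M (n + 0))) sums
    (of_real (qstep k * qstep (k - l)) * cnj z ^ (k - 2 * l)
      - 2 * z ^ l * (of_real (qstep k) * cnj z ^ (k - l)) + z ^ (2 * l) * cnj z ^ k)"
    using part[of 0] c[of k]
    by (intro sums_add sums_diff sums_mult part[of "2 * l", unfolded q2] part[of l, unfolded q1]) simp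
  moreover have "(\<lambda>n. of_real (c n) * cnj z ^ n * M (n + 2 * l) - 2 * z ^ l * (of_real (c n) * cnj z ^ n * M (n + l))
      + z ^ (2 * l) * (of_real (c n) * cnj z ^ n * M (n + 0))) = t"
    by (simp add: t_def fun_eq_iff algebra_simps)
  ultimately have "t sums (of_real (qstep k * qstep (k - l)) * cnj z ^ (k - 2 * l)
      - 2 * z ^ l * (of_real (qstep k) * cnj z ^ (k - l)) + z ^ (2 * l) * cnj z ^ k)" by simp
  from sums_unique2[OF S this] show ?thesis by (simp add: mult.assoc)
qed

lemma kernel_diagonal: "bergman_kernel \<alpha> l z z = of_real (kser \<alpha> l ((cmod z)\<^sup>2))"
proof -
  have "(\<lambda>m. complex_of_real (kcoef \<alpha> l m * ((cmod z)\<^sup>2) ^ m)) sums of_real (kser \<alpha> l ((cmod z)\<^sup>2))"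
    unfolding kser_def by (intro sums_of_real summable_sums kser_summable) simp
  moreover have "complex_of_real (kcoef \<alpha> l m * ((cmod z)\<^sup>2) ^ m) = of_real (kcoef \<alpha> l m) * (z * cnj z) ^ m" for m
    by (simp only: of_real_mult of_real_power norm_square_cnj)
  ultimately have "(\<lambda>m. of_real (kcoef \<alpha> l m) * (z * cnj z) ^ m) sums of_real (kser \<alpha> l ((cmod z)\<^sup>2))"
    by (simp only:)
  with bergman_kernel_sums show ?thesis by (rule sums_unique2)
qed

lemma kernel_square_norm:
  "has_bochner_integral lborel (\<lambda>w. (cmod (bergman_kernel \<alpha> l w z))\<^sup>2 * gauss \<alpha> l w) (kser \<alpha> l ((cmod z)\<^sup>2))"
proof -
  define f where "f = (\<lambda>w. bergman_kernel \<alpha> l w z)"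
  have f: "f \<in> E_space l" unfolding f_def by (rule E_space_kernel)
  have eq: "bergman_kernel \<alpha> l z w * (f w * of_real (gauss \<alpha> l w))
      = complex_of_real ((cmod (f w))\<^sup>2 * gauss \<alpha> l w)" for w
  proof -
    have "bergman_kernel \<alpha> l z w * f w = of_real ((cmod (f w))\<^sup>2)"
      unfolding f_def of_real_power norm_square_cnj bergman_kernel_cnj by (rule mult.commute)
    then show ?thesis by (simp add: mult.assoc[symmetric])
  qed
  have int: "integrable lborel (\<lambda>w. complex_of_real ((cmod (f w))\<^sup>2 * gauss \<alpha> l w))"
    using proj_integrable[OF tame_E_space[OF f], of z] unfolding eq .
  have "proj f z = f z"
    using proj_reproducing[OF E_space_entire[OF f] tame_E_space[OF f]] by simp
  then have "(LINT w|lborel. complex_of_real ((cmod (f w))\<^sup>2 * gauss \<alpha> l w)) = of_real (kser \<alpha> l ((cmod z)\<^sup>2))"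
    unfolding proj_def eq by (simp add: f_def kernel_diagonal)
  then have "(LINT w|lborel. (cmod (f w))\<^sup>2 * gauss \<alpha> l w) = kser \<alpha> l ((cmod z)\<^sup>2)"
    unfolding integral_complex_of_real of_real_eq_iff .
  with integrable_of_real_D[OF int]
  have "has_bochner_integral lborel (\<lambda>w. (cmod (f w))\<^sup>2 * gauss \<alpha> l w) (kser \<alpha> l ((cmod z)\<^sup>2))"
    unfolding has_bochner_integral_iff by (rule conjI)
  then show ?thesis by (simp only: f_def)
qed

text \<open>Up to a constant, multiplication by \<open>(w\<^sup>l - z\<^sup>l)\<^sup>2\<close> does not enlarge the norm of the kernel function.
  Expanding one factor of the squared norm by the series of \<open>K(w,z)\<close> multiplies the \<open>m\<close>-th term of
  \<open>K(z,z)\<close> by a second difference with step \<open>l\<close> of the numbers \<open>Q k\<close> that describe the moments of the other factor.\<close>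

lemma kernel_bracket_norm:
  fixes z :: complex
  defines "F \<equiv> \<lambda>w. (w ^ l - z ^ l)\<^sup>2 * bergman_kernel \<alpha> l w z"
  shows "integrable lborel (\<lambda>w. (cmod (F w))\<^sup>2 * gauss \<alpha> l w)"
    and "(LINT w|lborel. (cmod (F w))\<^sup>2 * gauss \<alpha> l w) \<le> 3 / \<alpha>\<^sup>2 * kser \<alpha> l ((cmod z)\<^sup>2)"
proof -
  have D2: "(\<lambda>w. (w ^ l - z ^ l)\<^sup>2) \<in> E_space l"
    using E_space_mult[OF E_space_power_diff E_space_power_diff, of z z] by (simp add: power2_eq_square)
  have F: "F \<in> E_space l" unfolding F_def by (rule E_space_mult[OF D2 E_space_kernel])
  have tF: "tame (\<lambda>w. cnj (F w))" by (intro tame_cnj tame_E_space F)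
  define N where "N k = (LINT w|lborel. w ^ k * (cnj (F w) * of_real (gauss \<alpha> l w)))" for k
  have N: "N k = of_real (qstep k * qstep (k - l)) * z ^ (k - 2 * l)
      - 2 * cnj z ^ l * of_real (qstep k) * z ^ (k - l) + cnj z ^ (2 * l) * z ^ k" for k
  proof -
    have "N k = cnj (LINT w|lborel. bergman_kernel \<alpha> l w z * ((w ^ l - z ^ l)\<^sup>2 * (cnj w ^ k * of_real (gauss \<alpha> l w))))"
      unfolding N_def by (subst Bochner_Integration.integral_cnj[symmetric]) (simp add: F_def mult_ac)
    then show ?thesis unfolding kernel_bracket by simp
  qed
  define T where "T = (cmod z) ^ (2 * l)"
  have T: "complex_of_real T = z ^ l * cnj z ^ l"
    unfolding T_def by (simp only: power_mult of_real_power norm_square_cnj power_mult_distrib)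
  define Q where "Q k = qstep k * qstep (k - l) - 2 * T * qstep k + T\<^sup>2" for k
  have qz: "of_real (qstep k) * (z ^ l * z ^ (k - l)) = of_real (qstep k) * z ^ k" for k
    using qstep_eq_0[of k] by (cases "k < l") (auto simp: power_add[symmetric])
  (* The three moments of the second difference; each is brought to a common power of z. *)
  have N0: "z ^ (2 * l) * N k = z ^ k * of_real (Q k)" for k
  proof -
    have qq: "of_real (qstep k * qstep (k - l)) * (z ^ (2 * l) * z ^ (k - 2 * l)) = of_real (qstep k * qstep (k - l)) * z ^ k"
    proof (cases "2 * l \<le> k")
      case False
      then have "qstep k * qstep (k - l) = 0"
        using qstep_eq_0[of k] qstep_eq_0[of "k - l"] by (cases "k < l") auto
      then show ?thesis by (simp only:) simp
    qed (simp add: power_add[symmetric])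
    have alg: "(a * a) * (qq * p - 2 * b * q * r + (b * b) * s)
        = qq * ((a * a) * p) - 2 * (a * b) * (q * (a * r)) + (a * b)\<^sup>2 * s" for a b p q r s qq :: complex
      by (simp add: algebra_simps power2_eq_square)
    have "z ^ (2 * l) * N k = of_real (qstep k * qstep (k - l)) * (z ^ (2 * l) * z ^ (k - 2 * l))
      - 2 * (z ^ l * cnj z ^ l) * (of_real (qstep k) * (z ^ l * z ^ (k - l))) + (z ^ l * cnj z ^ l)\<^sup>2 * z ^ k"
      using alg[of "z ^ l"] unfolding N by (simp only: mult_2 power_add)
    also have "\<dots> = z ^ k * of_real (Q k)"
      unfolding qz qq T[symmetric] Q_def
      by (simp only: of_real_add of_real_diff of_real_mult of_real_power of_real_numeral algebra_simps)
    finally show ?thesis .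
  qed
  have N1: "z ^ l * N (m + l) = z ^ m * of_real (Q (m + l))" for m
  proof -
    have alg: "a * ((x * y) * p - 2 * b * x * s + (b * b) * (s * a))
        = x * (y * (a * p)) - 2 * (a * b) * (x * s) + (a * b)\<^sup>2 * s" for a b p s x y :: complex
      by (simp add: algebra_simps power2_eq_square)
    have ix: "m + l - 2 * l = m - l" "m + l - l = m" by auto
    have "z ^ l * N (m + l) = of_real (qstep (m + l)) * (of_real (qstep m) * (z ^ l * z ^ (m - l)))
      - 2 * (z ^ l * cnj z ^ l) * (of_real (qstep (m + l)) * z ^ m) + (z ^ l * cnj z ^ l)\<^sup>2 * z ^ m"
      using alg[of "z ^ l"] unfolding N ix by (simp only: mult_2 power_add of_real_mult)
    also have "\<dots> = z ^ m * of_real (Q (m + l))"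
      unfolding qz T[symmetric] Q_def ix
      by (simp only: of_real_add of_real_diff of_real_mult of_real_power of_real_numeral algebra_simps)
    finally show ?thesis .
  qed
  have N2: "N (m + 2 * l) = z ^ m * of_real (Q (m + 2 * l))" for m
  proof -
    have alg: "(x * y) * s - 2 * b * x * (s * a) + (b * b) * (s * (a * a))
        = (x * y) * s - 2 * (a * b) * (x * s) + (a * b)\<^sup>2 * s" for a b s x y :: complex
      by (simp add: algebra_simps power2_eq_square)
    have ix: "m + 2 * l - 2 * l = m" "m + 2 * l - l = m + l" by auto
    have "N (m + 2 * l) = of_real (qstep (m + 2 * l) * qstep (m + l)) * z ^ m
      - 2 * (z ^ l * cnj z ^ l) * (of_real (qstep (m + 2 * l)) * z ^ m) + (z ^ l * cnj z ^ l)\<^sup>2 * z ^ m"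
      using alg unfolding N ix by (simp only: mult_2 power_add of_real_mult)
    also have "\<dots> = z ^ m * of_real (Q (m + 2 * l))"
      unfolding T[symmetric] Q_def ix
      by (simp only: of_real_add of_real_diff of_real_mult of_real_power of_real_numeral algebra_simps)
    finally show ?thesis .
  qed
  define \<Delta> where "\<Delta> m = Q (m + 2 * l) - 2 * Q (m + l) + Q m" for m
  have \<Delta>: "\<Delta> m \<le> 3 / \<alpha>\<^sup>2" for m
  proof -
    have ix: "m + 2 * l - l = m + l" "m + l - l = m" by auto
    show ?thesis
      unfolding \<Delta>_def Q_def ix by (rule qstep_second_difference) (simp add: T_def)
  qed
  have inner: "(LINT w|lborel. w ^ m * (((w ^ l - z ^ l)\<^sup>2 * cnj (F w)) * of_real (gauss \<alpha> l w))) = z ^ m * of_real (\<Delta> m)" for m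
  proof -
    have "w ^ m * (((w ^ l - z ^ l)\<^sup>2 * cnj (F w)) * of_real (gauss \<alpha> l w))
       = w ^ (m + 2 * l) * (cnj (F w) * of_real (gauss \<alpha> l w))
         - 2 * z ^ l * (w ^ (m + l) * (cnj (F w) * of_real (gauss \<alpha> l w)))
         + z ^ (2 * l) * (w ^ m * (cnj (F w) * of_real (gauss \<alpha> l w)))" for w
    proof -
      have "w ^ (m + 2 * l) = w ^ m * (w ^ l)\<^sup>2" "w ^ (m + l) = w ^ m * w ^ l" "z ^ (2 * l) = (z ^ l)\<^sup>2"
        by (simp_all add: power_add power_mult[symmetric] mult.commute)
      then show ?thesis by (simp only:) (simp add: power2_eq_square algebra_simps)
    qed
    moreover have "integrable lborel (\<lambda>w. w ^ n * (cnj (F w) * of_real (gauss \<alpha> l w)))" for n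
      by (intro E_space_pairing_integrable E_space_monomial tF)
    ultimately have "(LINT w|lborel. w ^ m * (((w ^ l - z ^ l)\<^sup>2 * cnj (F w)) * of_real (gauss \<alpha> l w)))
       = N (m + 2 * l) - 2 * (z ^ l * N (m + l)) + z ^ (2 * l) * N m"
      unfolding N_def by (simp only:) simp
    then show ?thesis unfolding N0 N1 N2 \<Delta>_def by (simp add: algebra_simps)
  qed
  have tg: "tame (\<lambda>w. (w ^ l - z ^ l)\<^sup>2 * cnj (F w))"
    by (rule tame_mult_E_space[OF D2 tF])
  have FF: "bergman_kernel \<alpha> l w z * (((w ^ l - z ^ l)\<^sup>2 * cnj (F w)) * of_real (gauss \<alpha> l w))
      = complex_of_real ((cmod (F w))\<^sup>2 * gauss \<alpha> l w)" for w
  proof -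
    have "bergman_kernel \<alpha> l w z * ((w ^ l - z ^ l)\<^sup>2 * cnj (F w)) = F w * cnj (F w)"
      by (simp add: F_def mult_ac)
    also have "\<dots> = of_real ((cmod (F w))\<^sup>2)" unfolding of_real_power norm_square_cnj ..
    finally show ?thesis by (simp add: mult.assoc[symmetric])
  qed
  have "integrable lborel (\<lambda>w. complex_of_real ((cmod (F w))\<^sup>2 * gauss \<alpha> l w))"
    using E_space_pairing_integrable[OF E_space_kernel tg, of z] unfolding FF .
  then show "integrable lborel (\<lambda>w. (cmod (F w))\<^sup>2 * gauss \<alpha> l w)"
    by (rule integrable_of_real_D)
  have S: "(\<lambda>m. complex_of_real (kcoef \<alpha> l m * ((cmod z)\<^sup>2) ^ m * \<Delta> m))
     sums of_real (LINT w|lborel. (cmod (F w))\<^sup>2 * gauss \<alpha> l w)"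
  proof -
    have "of_real (kcoef \<alpha> l m) * cnj z ^ m * (z ^ m * of_real (\<Delta> m))
        = complex_of_real (kcoef \<alpha> l m * ((cmod z)\<^sup>2) ^ m * \<Delta> m)" for m
      by (simp only: of_real_mult of_real_power norm_square_cnj power_mult_distrib mult_ac)
    then show ?thesis
      using exp_type_pairing[OF kernel_exp_type kernel_sums tg, of z]
      unfolding inner FF integral_complex_of_real by (simp only:)
  qed
  then have S': "(\<lambda>m. kcoef \<alpha> l m * ((cmod z)\<^sup>2) ^ m * \<Delta> m) sums (LINT w|lborel. (cmod (F w))\<^sup>2 * gauss \<alpha> l w)"
    by (simp only: sums_of_real_iff)
  have "(LINT w|lborel. (cmod (F w))\<^sup>2 * gauss \<alpha> l w) \<le> 3 / \<alpha>\<^sup>2 * kser \<alpha> l ((cmod z)\<^sup>2)"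
  proof (rule sums_le[OF _ S'])
    show "(\<lambda>m. 3 / \<alpha>\<^sup>2 * (kcoef \<alpha> l m * ((cmod z)\<^sup>2) ^ m)) sums (3 / \<alpha>\<^sup>2 * kser \<alpha> l ((cmod z)\<^sup>2))"
      unfolding kser_def by (intro sums_mult summable_sums kser_summable) simp
    show "kcoef \<alpha> l m * ((cmod z)\<^sup>2) ^ m * \<Delta> m \<le> 3 / \<alpha>\<^sup>2 * (kcoef \<alpha> l m * ((cmod z)\<^sup>2) ^ m)" for m
      using mult_left_mono[OF \<Delta>, of "kcoef \<alpha> l m * ((cmod z)\<^sup>2) ^ m" m] kcoef_pos[of m]
      by (simp only: mult.commute) simp
  qed
  then show "(LINT w|lborel. (cmod (F w))\<^sup>2 * gauss \<alpha> l w) \<le> 3 / \<alpha>\<^sup>2 * kser \<alpha> l ((cmod z)\<^sup>2)" .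
qed

text \<open>The integrand is a product of \<open>|K| (1 + y) weight\<close> and \<open>1 / (1 + y)\<close> with \<open>y = |w\<^sup>l - z\<^sup>l|\<^sup>2\<close>; the squares of
  both factors have known integrals.\<close>

lemma kernel_row_integral:
  obtains A where "A > 0"
    "\<And>z. (\<integral>\<^sup>+w. ennreal (cmod (bergman_kernel \<alpha> l w z) * weight \<alpha> l w) \<partial>lborel) \<le> ennreal (A * exp (\<alpha> * cmod z ^ (2 * l) / 2))"
proof -
  obtain C where C: "C > 0" "\<And>x. x \<ge> 0 \<Longrightarrow> kser \<alpha> l x \<le> C * (1 + x) ^ (l - 1) * exp (\<alpha> * x ^ l)"
    using kser_bound by metis
  obtain J where J: "J > 0"
    "\<And>z. (\<integral>\<^sup>+w. ennreal (1 / (1 + (cmod (w ^ l - z ^ l))\<^sup>2)\<^sup>2) \<partial>lborel) \<le> ennreal (J / (1 + cmod z) ^ (2 * l - 2))"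
    using nn_integral_power_distance[OF l_pos] by metis
  define B where "B = 2 * (1 + 3 / \<alpha>\<^sup>2) * C"
  have B: "B > 0" using C \<alpha>_pos by (simp add: B_def add_pos_nonneg)
  show thesis
  proof (rule that[of "B + J"])
    show "B + J > 0" using B J by simp
    fix z :: complex
    define K where "K w = cmod (bergman_kernel \<alpha> l w z)" for w
    define y where "y w = (cmod (w ^ l - z ^ l))\<^sup>2" for w
    define e where "e = exp (\<alpha> * cmod z ^ (2 * l) / 2)"
    define p where "p = (1 + cmod z) ^ (2 * l - 2)"
    have pos: "e > 0" "p > 0" by (auto simp: e_def p_def one_plus_norm_power_pos)
    (* This balances the two square integrals, which are of order p * e^2 and 1 / p. *)
    define \<eta> where "\<eta> = 1 / (e * p)"
    have \<eta>: "\<eta> > 0" using pos by (simp add: \<eta>_def)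
    have [measurable]: "K \<in> borel_measurable borel" "y \<in> borel_measurable borel"
      unfolding K_def y_def by measurable
    have y0: "y w \<ge> 0" for w by (simp add: y_def)
    define G where "G w = (K w)\<^sup>2 * (1 + y w)\<^sup>2 * gauss \<alpha> l w" for w
    have G0: "G w \<ge> 0" for w by (simp add: G_def)
    have amgm: "K w * weight \<alpha> l w \<le> \<eta> * G w + (1 / \<eta>) * (1 / (1 + y w)\<^sup>2)" for w
    proof -
      define a where "a = K w * weight \<alpha> l w * (1 + y w)"
      define b where "b = 1 / (1 + y w)"
      have yp: "1 + y w > 0" using y0[of w] by simp
      have sq: "sqrt \<eta> * sqrt \<eta> = \<eta>" using \<eta> by simp
      have "0 \<le> (sqrt \<eta> * a - b / sqrt \<eta>)\<^sup>2" by simp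
      also have "\<dots> = \<eta> * a\<^sup>2 + b\<^sup>2 / \<eta> - 2 * (a * b)"
        using \<eta> sq by (simp add: power2_eq_square field_simps)
      finally have "2 * (a * b) \<le> \<eta> * a\<^sup>2 + b\<^sup>2 / \<eta>" by simp
      moreover have ab: "a * b = K w * weight \<alpha> l w" using yp by (simp add: a_def b_def)
      moreover have "a\<^sup>2 = G w"
        unfolding G_def weight_square[symmetric] by (simp add: a_def power2_eq_square)
      moreover have "b\<^sup>2 / \<eta> = (1 / \<eta>) * (1 / (1 + y w)\<^sup>2)" by (simp add: b_def power_divide)
      moreover have "a * b \<le> 2 * (a * b)" unfolding ab by (simp add: K_def)
      ultimately show ?thesis by (simp only:)
    qed
    have GI: "(\<integral>\<^sup>+w. ennreal (G w) \<partial>lborel) \<le> ennreal (B * p * e\<^sup>2)"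
    proof -
      define H where "H w = 2 * ((K w)\<^sup>2 * gauss \<alpha> l w) + 2 * ((cmod ((w ^ l - z ^ l)\<^sup>2 * bergman_kernel \<alpha> l w z))\<^sup>2 * gauss \<alpha> l w)" for w
      have H: "integrable lborel H" unfolding H_def K_def
        using kernel_square_norm[of z] kernel_bracket_norm(1)[of z]
        by (intro Bochner_Integration.integrable_add integrable_mult_right) (auto simp: has_bochner_integral_iff)
      have GH: "G w \<le> H w" for w
      proof -
        have "(1 + y w)\<^sup>2 \<le> 2 + 2 * (y w)\<^sup>2"
          using zero_le_power2[of "1 - y w"] by (simp add: power2_eq_square algebra_simps)
        then have "(K w)\<^sup>2 * (1 + y w)\<^sup>2 * gauss \<alpha> l w \<le> (K w)\<^sup>2 * (2 + 2 * (y w)\<^sup>2) * gauss \<alpha> l w"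
          by (intro mult_right_mono mult_left_mono) auto
        also have "\<dots> = H w"
          by (simp add: H_def K_def y_def norm_mult norm_power power_mult_distrib algebra_simps)
        finally show ?thesis by (simp add: G_def)
      qed
      have "(\<integral>\<^sup>+w. ennreal (G w) \<partial>lborel) \<le> (\<integral>\<^sup>+w. ennreal (H w) \<partial>lborel)"
        by (intro nn_integral_mono ennreal_leI GH)
      also have "\<dots> = ennreal (integral\<^sup>L lborel H)"
        using G0 GH by (intro nn_integral_eq_integral H AE_I2) (meson order_trans)
      also have "integral\<^sup>L lborel H \<le> B * p * e\<^sup>2"
      proof -
        have "integral\<^sup>L lborel H = 2 * kser \<alpha> l ((cmod z)\<^sup>2)
            + 2 * (LINT w|lborel. (cmod ((w ^ l - z ^ l)\<^sup>2 * bergman_kernel \<alpha> l w z))\<^sup>2 * gauss \<alpha> l w)"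
          unfolding H_def K_def
          using kernel_square_norm[of z] kernel_bracket_norm(1)[of z]
          by (subst Bochner_Integration.integral_add) (auto simp: has_bochner_integral_iff)
        also have "\<dots> \<le> 2 * kser \<alpha> l ((cmod z)\<^sup>2) + 2 * (3 / \<alpha>\<^sup>2 * kser \<alpha> l ((cmod z)\<^sup>2))"
          by (intro add_left_mono mult_left_mono kernel_bracket_norm(2)) simp
        also have "\<dots> = 2 * (1 + 3 / \<alpha>\<^sup>2) * kser \<alpha> l ((cmod z)\<^sup>2)" by (simp add: distrib_left distrib_right)
        also have "\<dots> \<le> 2 * (1 + 3 / \<alpha>\<^sup>2) * (C * p * e\<^sup>2)"
        proof (rule mult_left_mono)
          have "kser \<alpha> l ((cmod z)\<^sup>2) \<le> C * (1 + (cmod z)\<^sup>2) ^ (l - 1) * exp (\<alpha> * ((cmod z)\<^sup>2) ^ l)"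
            by (rule C(2)) simp
          also have "exp (\<alpha> * ((cmod z)\<^sup>2) ^ l) = e\<^sup>2"
            by (simp add: e_def power2_eq_square exp_add[symmetric] power_mult power_mult_distrib)
          also have "C * (1 + (cmod z)\<^sup>2) ^ (l - 1) * e\<^sup>2 \<le> C * p * e\<^sup>2"
          proof -
            have "1 + (cmod z)\<^sup>2 \<le> (1 + cmod z)\<^sup>2" by (simp add: power2_eq_square algebra_simps)
            then have "(1 + (cmod z)\<^sup>2) ^ (l - 1) \<le> ((1 + cmod z)\<^sup>2) ^ (l - 1)" by (intro power_mono) auto
            also have "\<dots> = p" by (simp add: p_def power_mult[symmetric] right_diff_distrib')
            finally show ?thesis using C(1) by (intro mult_right_mono mult_left_mono) auto
          qed
          finally show "kser \<alpha> l ((cmod z)\<^sup>2) \<le> C * p * e\<^sup>2" .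
        qed simp
        finally show ?thesis by (simp add: B_def mult.assoc)
      qed
      finally show ?thesis by (simp add: ennreal_leI)
    qed
    have "(\<integral>\<^sup>+w. ennreal (K w * weight \<alpha> l w) \<partial>lborel)
       \<le> (\<integral>\<^sup>+w. ennreal \<eta> * ennreal (G w) + ennreal (1 / \<eta>) * ennreal (1 / (1 + y w)\<^sup>2) \<partial>lborel)"
    proof (intro nn_integral_mono)
      fix w
      have "ennreal (K w * weight \<alpha> l w) \<le> ennreal (\<eta> * G w + (1 / \<eta>) * (1 / (1 + y w)\<^sup>2))"
        by (intro ennreal_leI amgm)
      also have "\<dots> = ennreal \<eta> * ennreal (G w) + ennreal (1 / \<eta>) * ennreal (1 / (1 + y w)\<^sup>2)"
        by (rule ennreal_sum_mult) (use \<eta> G0[of w] in auto)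
      finally show "ennreal (K w * weight \<alpha> l w) \<le> \<dots>" .
    qed
    also have "\<dots> = ennreal \<eta> * (\<integral>\<^sup>+w. ennreal (G w) \<partial>lborel) + ennreal (1 / \<eta>) * (\<integral>\<^sup>+w. ennreal (1 / (1 + y w)\<^sup>2) \<partial>lborel)"
      unfolding G_def by (subst nn_integral_add) (auto simp: nn_integral_cmult)
    also have "\<dots> \<le> ennreal \<eta> * ennreal (B * p * e\<^sup>2) + ennreal (1 / \<eta>) * ennreal (J / p)"
      unfolding y_def p_def using GI[unfolded p_def] J(2)[of z] by (intro add_mono mult_left_mono) auto
    also have "\<dots> = ennreal (\<eta> * (B * p * e\<^sup>2) + (1 / \<eta>) * (J / p))"
      by (rule ennreal_sum_mult[symmetric]) (use \<eta> B J(1) pos in auto)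
    also have "\<eta> * (B * p * e\<^sup>2) + (1 / \<eta>) * (J / p) = (B + J) * e"
      using pos by (simp add: \<eta>_def field_simps power2_eq_square)
    finally show "(\<integral>\<^sup>+w. ennreal (cmod (bergman_kernel \<alpha> l w z) * weight \<alpha> l w) \<partial>lborel)
        \<le> ennreal ((B + J) * exp (\<alpha> * cmod z ^ (2 * l) / 2))"
      by (simp add: K_def e_def)
  qed
qed

end

section \<open>Comparing the kernel at a dilated point with an exponential multiple\<close>

text \<open>One term of the exponential series of \<open>t y\<^sup>2\<close>, after taking square roots.\<close>

lemma sqrt_exp_bound:
  fixes y t :: real
  assumes "y \<ge> 0" "t > 0"
  shows "y ^ n \<le> sqrt (fact n) * (1 / sqrt t) ^ n * exp (t * y\<^sup>2 / 2)"
proof -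
  have "(t * y\<^sup>2) ^ n / fact n \<le> exp (t * y\<^sup>2)"
    using sum_le_suminf[OF summable_exp[of "t * y\<^sup>2"], of "{n}"] assms
    by (simp add: exp_def divide_inverse mult.commute scaleR_conv_of_real)
  then have "(t * y\<^sup>2) ^ n \<le> fact n * exp (t * y\<^sup>2)"
    by (simp add: divide_le_eq mult.commute)
  then have "sqrt ((t * y\<^sup>2) ^ n) \<le> sqrt (fact n * exp (t * y\<^sup>2))"
    by (rule real_sqrt_le_mono)
  moreover have "sqrt ((t * y\<^sup>2) ^ n) = (sqrt t * y) ^ n"
    using assms by (simp add: real_sqrt_power real_sqrt_mult)
  moreover have "sqrt (exp (t * y\<^sup>2)) = exp (t * y\<^sup>2 / 2)"
    by (rule real_sqrt_unique) (auto simp: power2_eq_square exp_add[symmetric])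
  ultimately have "sqrt t ^ n * y ^ n \<le> sqrt (fact n) * exp (t * y\<^sup>2 / 2)"
    by (simp add: real_sqrt_mult power_mult_distrib)
  then have le: "(1 / sqrt t) ^ n * (sqrt t ^ n * y ^ n) \<le> (1 / sqrt t) ^ n * (sqrt (fact n) * exp (t * y\<^sup>2 / 2))"
    using assms by (intro mult_left_mono) auto
  have eq: "(1 / sqrt t) ^ n * (sqrt t ^ n * y ^ n) = y ^ n"
    using assms by (simp add: power_divide)
  show ?thesis using le unfolding eq by (simp only: mult_ac)
qed

lemma Gamma_falling:
  fixes a :: real
  assumes "a > 0" "k \<le> n"
  shows "Gamma (real n + a) = (\<Prod>i<k. (real n + a - 1 - real i)) * Gamma (real n + a - real k)"
  using assms(2)
proof (induction k)
  case (Suc k)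
  have "Gamma (real n + a - real (Suc k) + 1) = (real n + a - real (Suc k)) * Gamma (real n + a - real (Suc k))"
    using assms(1) Suc.prems by (intro Gamma_real_plus1) auto
  then have "Gamma (real n + a - real k) = (real n + a - 1 - real k) * Gamma (real n + a - real (Suc k))"
    by (simp add: algebra_simps)
  then show ?case using Suc by simp
qed simp

text \<open>Taylor's formula for \<open>(1 + x)\<close> to the power \<open>n + a - 1\<close> at \<open>x = 1\<close>, divided by \<open>\<Gamma>(n + a)\<close>.\<close>

lemma binomial_Gamma_sum:
  fixes a :: real
  assumes a: "0 < a" "a \<le> 1"
  shows "\<bar>(\<Sum>j\<le>n. 1 / (fact j * Gamma (real n + a - real j))) - 2 powr (real n + a - 1) / Gamma (real n + a)\<bar>
    \<le> 1 / fact n"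
proof -
  define \<nu> where "\<nu> = real n + a - 1"
  define P where "P k = (\<Prod>i<k. (\<nu> - real i))" for k
  define diff where "diff k x = P k * (1 + x) powr (\<nu> - real k)" for k and x :: real
  have "\<exists>t. 0 < t \<and> t < 1 \<and>
      (1 + 1) powr \<nu> = (\<Sum>k<Suc n. diff k 0 / fact k * 1 ^ k) + diff (Suc n) t / fact (Suc n) * 1 ^ Suc n"
  proof (rule Maclaurin[where f="\<lambda>x. (1 + x) powr \<nu>" and diff=diff])
    show "diff 0 = (\<lambda>x. (1 + x) powr \<nu>)"
      by (rule ext) (simp add: diff_def P_def)
    show "\<forall>m t. m < Suc n \<and> 0 \<le> t \<and> t \<le> 1 \<longrightarrow> DERIV (diff m) t :> diff (Suc m) t"
    proof (intro allI impI)
      fix m and t :: real assume "m < Suc n \<and> 0 \<le> t \<and> t \<le> 1"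
      then have "((\<lambda>x. P m * (1 + x) powr (\<nu> - real m)) has_real_derivative
          P m * ((\<nu> - real m) * (1 + t) powr (\<nu> - real m - 1))) (at t)"
        by (auto intro!: derivative_eq_intros)
      then show "DERIV (diff m) t :> diff (Suc m) t"
        by (simp add: diff_def[abs_def] P_def mult.assoc algebra_simps)
    qed
  qed auto
  then obtain t where t: "0 < t" "t < 1" and
    T: "2 powr \<nu> = (\<Sum>k\<le>n. P k / fact k) + P (Suc n) * (1 + t) powr (\<nu> - real (Suc n)) / fact (Suc n)"
    by (auto simp: diff_def lessThan_Suc_atMost)
  define G where "G = Gamma (real n + a)"
  have Gp: "G > 0" unfolding G_def using a by (intro Gamma_real_pos) auto
  define g where "g = Gamma a"
  have gp: "g > 0" unfolding g_def using a by (intro Gamma_real_pos)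
  have fall: "1 / Gamma (real n + a - real k) = P k / G" if "k \<le> n" for k
  proof -
    have "G = P k * Gamma (real n + a - real k)"
      using Gamma_falling[OF a(1) that] by (simp add: G_def P_def \<nu>_def)
    then show ?thesis using Gp by auto
  qed
  have PS: "P (Suc n) / G = (a - 1) / g"
  proof -
    have "P n / G = 1 / g" using fall[of n] by (simp add: g_def)
    then have "P n / G * (a - 1) = 1 / g * (a - 1)" by simp
    moreover have "P (Suc n) = P n * (a - 1)" by (simp add: P_def \<nu>_def)
    ultimately show ?thesis by simp
  qed
  have "(\<Sum>j\<le>n. 1 / (fact j * Gamma (real n + a - real j))) = (\<Sum>j\<le>n. P j / fact j) / G"
    unfolding sum_divide_distrib
  proof (rule sum.cong[OF refl])
    fix j assume "j \<in> {..n}"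
    then have "1 / Gamma (real n + a - real j) * (1 / fact j) = P j / G * (1 / fact j)"
      using fall[of j] by simp
    then show "1 / (fact j * Gamma (real n + a - real j)) = P j / fact j / G" by (simp add: mult.commute)
  qed
  then have "(\<Sum>j\<le>n. 1 / (fact j * Gamma (real n + a - real j))) - 2 powr \<nu> / G
      = - (P (Suc n) / G * ((1 + t) powr (\<nu> - real (Suc n)) / fact (Suc n)))"
    unfolding T by (simp add: add_divide_distrib)
  also have "\<bar>\<dots>\<bar> = (1 - a) * inverse g * (1 + t) powr (a - 2) / fact (Suc n)"
  proof -
    have abs: "\<bar>a - 1\<bar> = 1 - a" using a by simp
    have ex: "\<nu> - real (Suc n) = a - 2" by (simp add: \<nu>_def)
    have "\<bar>- ((a - 1) / g * (X / Y))\<bar> = \<bar>a - 1\<bar> * inverse g * X / Y" if "X \<ge> 0" "Y > 0" for X Y :: real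
      using that gp by (simp add: abs_mult divide_inverse)
    from this[of "(1 + t) powr (a - 2)" "fact (Suc n)"] show ?thesis
      unfolding PS ex abs by simp
  qed
  also have "\<dots> \<le> 1 * 1 * 1 / fact n"
  proof (intro frac_le mult_mono)
    show "inverse g \<le> 1" using inverse_Gamma_le[OF a, of 0] by (simp add: g_def)
    show "(1 + t) powr (a - 2) \<le> 1"
      using t a powr_mono[of "a - 2" 0 "1 + t"] by simp
    show "(fact n :: real) \<le> fact (Suc n)" by (rule fact_mono) simp
  qed (use a gp in auto)
  finally show ?thesis by (simp add: \<nu>_def G_def)
qed

lemma summable_power_div:
  fixes q :: real
  assumes "0 \<le> q" "q < 1" "l \<ge> 1"
  shows "summable (\<lambda>m. q ^ (m div l))"
proof (rule summableI_nonneg_bounded[where x="l * (1 / (1 - q))"])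
  fix N
  have "(\<Sum>m<N. q ^ (m div l)) \<le> (\<Sum>m<N * l. q ^ (m div l))"
    using assms by (intro sum_mono2) auto
  also have "\<dots> = (\<Sum>j<N. \<Sum>m\<in>{j * l..<j * l + l}. q ^ (m div l))"
    by (simp add: sum.nat_group)
  also have "\<dots> = (\<Sum>j<N. l * q ^ j)"
  proof (rule sum.cong[OF refl])
    fix j
    have "(\<Sum>m\<in>{j * l..<j * l + l}. q ^ (m div l)) = (\<Sum>m\<in>{j * l..<j * l + l}. q ^ j)"
    proof (rule sum.cong[OF refl])
      fix m assume "m \<in> {j * l..<j * l + l}"
      then have "m div l = j"
        using assms(3) by (intro div_nat_eqI) (auto simp: mult.commute)
      then show "q ^ (m div l) = q ^ j" by simp
    qed
    then show "(\<Sum>m\<in>{j * l..<j * l + l}. q ^ (m div l)) = l * q ^ j" by simp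
  qed
  also have "\<dots> = l * (\<Sum>j<N. q ^ j)" by (simp add: sum_distrib_left)
  also have "\<dots> \<le> l * (1 / (1 - q))"
    using sum_le_suminf[OF summable_geometric[of q], of "{..<N}"] assms
    by (intro mult_left_mono) (auto simp: suminf_geometric)
  finally show "(\<Sum>m<N. q ^ (m div l)) \<le> l * (1 / (1 - q))" .
qed (use assms in auto)

context fock_params begin

text \<open>Integration against monomials shows that the Taylor coefficients are unique, so any power series of a
  function in \<open>E\<close> has the majorant provided by Cauchy's estimates.\<close>

lemma E_space_series_exp_type:
  assumes "F \<in> E_space l" "\<And>w. (\<lambda>n. a n * w ^ n) sums F w"
  shows "exp_type a"
proof -
  obtain a' where a': "exp_type a'" "\<And>w. (\<lambda>n. a' n * w ^ n) sums F w"
    using E_space_exp_type[OF assms(1)] by metis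
  have int: "integrable lborel (\<lambda>w. F w * (cnj w ^ m * of_real (gauss \<alpha> l w)))" for m
    using E_space_pairing_integrable[OF assms(1) tame_cnj[OF tame_E_space[OF E_space_monomial]]] by simp
  have "a m / of_real (kcoef \<alpha> l m) = a' m / of_real (kcoef \<alpha> l m)" for m
    by (rule trans[OF integral_coefficient[OF assms(2) int, symmetric] integral_coefficient[OF a'(2) int]])
  then have "a = a'" using kcoef_pos by (auto simp: fun_eq_iff less_imp_neq[symmetric])
  then show ?thesis using a' by simp
qed

text \<open>In these terms the kernel \<open>K(w,z)\<close> is \<open>kap\<close> times the series of \<open>(mu z w)\<^sup>m / \<Gamma>((m+1)/l)\<close>, a Mittag-Leffler
  function of \<open>mu z w\<close>, and \<open>exp (\<alpha> (w cnj z)\<^sup>l)\<close> is the exponential of \<open>(mu z w)\<^sup>l\<close>.\<close>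

definition mu :: "complex \<Rightarrow> complex" where "mu z = of_real (\<alpha> powr (1 / l)) * cnj z"

definition kap :: real where "kap = l * \<alpha> powr (1 / l) / pi"

lemma root_power: "(\<alpha> powr (1 / l)) ^ m = \<alpha> powr (real m / l)"
  using \<alpha>_pos by (simp add: powr_realpow[symmetric] powr_powr)

lemma mu_power_l: "mu z ^ l = of_real \<alpha> * cnj z ^ l"
  using \<alpha>_pos l_pos by (simp add: mu_def power_mult_distrib of_real_power[symmetric] root_power del: of_real_power)

lemma kernel_coefficient_mu: "of_real (kcoef \<alpha> l m) * cnj z ^ m = of_real (kap / Gamma (real (m + 1) / l)) * mu z ^ m"
  by (simp add: kcoef_def kap_def mu_def power_mult_distrib of_real_power[symmetric] root_power del: of_real_power)

definition exp_coef :: "nat \<Rightarrow> real" where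
  "exp_coef i = (if l dvd i then 1 / fact (i div l) else 0)"

lemma exp_power_sums: "(\<lambda>i. of_real (exp_coef i) * mu z ^ i * w ^ i) sums exp (of_real \<alpha> * cnj z ^ l * w ^ l)"
proof -
  have "strict_mono (\<lambda>j. l * j)" using l_pos by (simp add: strict_mono_def)
  then have "(\<lambda>j. of_real (exp_coef (l * j)) * mu z ^ (l * j) * w ^ (l * j)) sums exp (of_real \<alpha> * cnj z ^ l * w ^ l)
     \<longleftrightarrow> (\<lambda>i. of_real (exp_coef i) * mu z ^ i * w ^ i) sums exp (of_real \<alpha> * cnj z ^ l * w ^ l)"
    by (rule sums_mono_reindex) (auto simp: exp_coef_def)
  moreover have "(\<lambda>j. of_real (exp_coef (l * j)) * mu z ^ (l * j) * w ^ (l * j))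
      = (\<lambda>j. (of_real \<alpha> * cnj z ^ l * w ^ l) ^ j /\<^sub>R fact j)"
  proof
    fix j
    have "mu z ^ (l * j) * w ^ (l * j) = (of_real \<alpha> * cnj z ^ l * w ^ l) ^ j"
      by (simp add: power_mult mu_power_l power_mult_distrib)
    then show "of_real (exp_coef (l * j)) * mu z ^ (l * j) * w ^ (l * j)
        = (of_real \<alpha> * cnj z ^ l * w ^ l) ^ j /\<^sub>R fact j"
      using l_pos by (simp add: exp_coef_def scaleR_conv_of_real mult.assoc divide_inverse)
  qed
  ultimately show ?thesis using exp_converges by metis
qed

text \<open>The Cauchy product of the coefficients \<open>exp_coef\<close> of \<open>exp (x\<^sup>l)\<close> and \<open>1 / \<Gamma>((m+1)/l)\<close>.\<close>

definition conv_coef :: "nat \<Rightarrow> real" where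
  "conv_coef m = (\<Sum>i\<le>m. exp_coef i / Gamma (real (m - i + 1) / l))"

lemma exp_times_kernel_sums:
  "(\<lambda>m. of_real (kap * conv_coef m) * mu z ^ m * w ^ m) sums
     (exp (of_real \<alpha> * cnj z ^ l * w ^ l) * bergman_kernel \<alpha> l w z)"
proof -
  define a where "a i = of_real (exp_coef i) * mu z ^ i * w ^ i" for i
  define b where "b i = of_real (kap / Gamma (real (i + 1) / l)) * mu z ^ i * w ^ i" for i
  have A: "a sums exp (of_real \<alpha> * cnj z ^ l * w ^ l)"
    unfolding a_def by (rule exp_power_sums)
  have B: "b sums bergman_kernel \<alpha> l w z"
    using kernel_sums[of z w] unfolding kernel_coefficient_mu b_def .
  have nA: "summable (\<lambda>i. norm (a i))"
    using power_series_summable_norm[OF exp_power_sums, of "cmod w" z] by (simp add: a_def norm_mult norm_power)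
  have nB: "summable (\<lambda>i. norm (b i))"
    using power_series_summable_norm[OF kernel_sums, of "cmod w" z]
    unfolding kernel_coefficient_mu by (simp add: b_def norm_mult norm_power norm_divide)
  have "(\<Sum>i\<le>m. a i * b (m - i)) = of_real (kap * conv_coef m) * mu z ^ m * w ^ m" for m
  proof -
    have "(\<Sum>i\<le>m. a i * b (m - i)) = (\<Sum>i\<le>m. of_real (kap * (exp_coef i / Gamma (real (m - i + 1) / l))) * (mu z ^ m * w ^ m))"
    proof (rule sum.cong[OF refl])
      fix i assume "i \<in> {..m}"
      then have "mu z ^ m = mu z ^ i * mu z ^ (m - i)" "w ^ m = w ^ i * w ^ (m - i)"
        by (simp_all add: power_add[symmetric])
      then show "a i * b (m - i) = of_real (kap * (exp_coef i / Gamma (real (m - i + 1) / l))) * (mu z ^ m * w ^ m)"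
        unfolding a_def b_def by (simp only:) (simp add: mult_ac)
    qed
    also have "\<dots> = of_real (kap * conv_coef m) * (mu z ^ m * w ^ m)"
      by (simp add: conv_coef_def sum_distrib_left sum_distrib_right)
    finally show ?thesis by (simp add: mult.assoc)
  qed
  then show ?thesis
    using Cauchy_product_sums[OF nA nB] sums_unique[OF A] sums_unique[OF B] by simp
qed

text \<open>The real number whose \<open>l\<close>-th power is \<open>2\<close>, as a complex number because it multiplies points of the plane.\<close>

definition dil :: complex where "dil = of_real (2 powr (1 / l))"

lemma dil_power_l: "cmod dil ^ l = 2"
  using l_pos by (simp add: dil_def powr_realpow[symmetric] powr_powr)

text \<open>The number subtracted is, up to a constant factor, the kernel coefficient at the dilated point. Only
  multiples of \<open>l\<close> contribute to the convolution, which becomes a truncated binomial sum.\<close>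

lemma conv_coef_close:
  "\<bar>conv_coef m - 2 powr (real (m + 1) / l - 1) / Gamma (real (m + 1) / l)\<bar> \<le> 1 / fact (m div l)"
proof -
  define n r where "n = m div l" and "r = m mod l"
  define a where "a = real (r + 1) / l"
  have r: "r < l" using l_pos by (simp add: r_def)
  then have a: "0 < a" "a \<le> 1" by (auto simp: a_def)
  have m: "m = l * n + r" by (simp add: n_def r_def)
  have idx: "real (m + 1) / l = real n + a"
    using l_pos by (simp add: m a_def field_simps)
  have "conv_coef m = (\<Sum>i\<in>(\<lambda>j. l * j) ` {..n}. exp_coef i / Gamma (real (m - i + 1) / l))"
    unfolding conv_coef_def
  proof (rule sum.mono_neutral_right)
    show "(\<lambda>j. l * j) ` {..n} \<subseteq> {..m}" by (auto simp: m intro!: trans_le_add1)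
    show "\<forall>i\<in>{..m} - (\<lambda>j. l * j) ` {..n}. exp_coef i / Gamma (real (m - i + 1) / real l) = 0"
    proof
      fix i assume i: "i \<in> {..m} - (\<lambda>j. l * j) ` {..n}"
      have "\<not> l dvd i"
      proof
        assume "l dvd i"
        then obtain j where j: "i = l * j" by (auto elim: dvdE)
        have "j \<le> n" using i l_pos div_le_mono[of i m l] by (simp add: j n_def)
        with i j show False by auto
      qed
      then show "exp_coef i / Gamma (real (m - i + 1) / real l) = 0" by (simp add: exp_coef_def)
    qed
  qed simp
  also have "\<dots> = (\<Sum>j\<le>n. exp_coef (l * j) / Gamma (real (m - l * j + 1) / l))"
    using l_pos by (subst sum.reindex) (auto simp: inj_on_def)
  also have "\<dots> = (\<Sum>j\<le>n. 1 / (fact j * Gamma (real n + a - real j)))"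
  proof (rule sum.cong[OF refl])
    fix j assume j: "j \<in> {..n}"
    then have "l * j \<le> m" by (auto simp: m intro!: trans_le_add1)
    then have "real (m - l * j + 1) / l = real (m + 1) / l - real j"
      using l_pos by (simp add: of_nat_diff field_simps)
    then have ix: "real (m - l * j + 1) / l = real n + a - real j"
      unfolding idx .
    show "exp_coef (l * j) / Gamma (real (m - l * j + 1) / l) = 1 / (fact j * Gamma (real n + a - real j))"
      unfolding ix using l_pos by (simp add: exp_coef_def)
  qed
  finally show ?thesis
    using binomial_Gamma_sum[OF a, of n] unfolding idx n_def[symmetric] by simp
qed

end

section \<open>Weighted supremum norms\<close>

lemma measurable_lebesgue_I: "f \<in> borel_measurable borel \<Longrightarrow> f \<in> borel_measurable lebesgue"
  by (rule measurable_completion) simp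

lemma esssup_lebesgue_nonneg:
  fixes f :: "complex \<Rightarrow> ereal"
  assumes "\<And>x. 0 \<le> f x"
  shows "0 \<le> esssup lebesgue f"
proof -
  have "\<exists>x. f x \<le> esssup lebesgue f"
  proof (rule ccontr)
    assume no: "\<not> (\<exists>x. f x \<le> esssup lebesgue f)"
    have "AE x in lebesgue. f x \<le> esssup lebesgue f" by (rule esssup_AE)
    then have "AE x in lebesgue. x \<notin> (UNIV :: complex set)"
      by eventually_elim (use no in auto)
    then have "(UNIV :: complex set) \<in> null_sets lebesgue"
      by (rule AE_iff_null_sets[THEN iffD2, rotated]) simp
    moreover have "\<not> negligible (UNIV :: complex set)"
      by (rule open_not_negligible) auto
    ultimately show False by (simp add: negligible_iff_null_sets)
  qed
  then show ?thesis using assms order_trans by blast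
qed

lemma Linf_esssup_nonneg: "0 \<le> Linf_esssup \<gamma> l f"
  unfolding Linf_esssup_def by (rule esssup_lebesgue_nonneg) simp

lemma Linf_norm_nonneg: "0 \<le> Linf_norm \<gamma> l f"
  unfolding Linf_norm_def by (intro real_of_ereal_pos Linf_esssup_nonneg)

lemma Linf_norm_le:
  assumes f: "f \<in> entire" and M: "\<And>z. cmod (f z) * weight \<gamma> l z \<le> M"
  shows "f \<in> Finf \<gamma> l" "Linf_norm \<gamma> l f \<le> M"
proof -
  have [measurable]: "f \<in> borel_measurable borel" using f by (rule entire_measurable)
  have m: "(\<lambda>z. ereal (cmod (f z) * weight \<gamma> l z)) \<in> borel_measurable lebesgue"
    by (rule measurable_lebesgue_I) measurable
  have le: "Linf_esssup \<gamma> l f \<le> ereal M"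
    unfolding Linf_esssup_def using m by (rule esssup_I) (use M in auto)
  then have fin: "Linf_esssup \<gamma> l f < \<infinity>" by (rule le_less_trans) simp
  show "f \<in> Finf \<gamma> l"
    unfolding Finf_def Linf_space_def using f fin measurable_lebesgue_I[of f] by auto
  have "real_of_ereal (Linf_esssup \<gamma> l f) \<le> real_of_ereal (ereal M)"
    by (rule real_of_ereal_positive_mono) (use Linf_esssup_nonneg le in auto)
  then show "Linf_norm \<gamma> l f \<le> M" by (simp add: Linf_norm_def)
qed

text \<open>For a continuous function the essential supremum bounds every value: where it is exceeded the function
  would exceed it on a nonempty open set, which is not negligible.\<close>

lemma Linf_norm_bound:
  assumes f: "f \<in> Finf \<gamma> l"
  shows "cmod (f z) * weight \<gamma> l z \<le> Linf_norm \<gamma> l f"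
proof (rule ccontr)
  assume neg: "\<not> cmod (f z) * weight \<gamma> l z \<le> Linf_norm \<gamma> l f"
  define g where "g z = cmod (f z) * weight \<gamma> l z" for z
  have fe: "f \<in> entire" and fin: "Linf_esssup \<gamma> l f < \<infinity>"
    using f by (auto simp: Finf_def Linf_space_def)
  have eq: "Linf_esssup \<gamma> l f = ereal (Linf_norm \<gamma> l f)"
    using fin Linf_esssup_nonneg[of \<gamma> l f] unfolding Linf_norm_def
    by (intro ereal_real'[symmetric]) auto
  have "AE x in lebesgue. ereal (g x) \<le> Linf_esssup \<gamma> l f"
    unfolding Linf_esssup_def g_def by (rule esssup_AE)
  then have ae: "AE x in lebesgue. g x \<le> Linf_norm \<gamma> l f" unfolding eq by simp
  have cg: "continuous_on UNIV g"
    unfolding g_def weight_def by (intro continuous_intros entire_continuous fe) auto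
  define U where "U = {x. Linf_norm \<gamma> l f < g x}"
  have "open U" unfolding U_def using cg by (intro open_Collect_less continuous_intros)
  moreover have "z \<in> U" using neg by (simp add: U_def g_def)
  ultimately have "\<not> negligible U" by (intro open_not_negligible) auto
  moreover have "U \<in> null_sets lebesgue"
  proof -
    have "U \<in> sets lebesgue" using \<open>open U\<close> by simp
    moreover have "AE x in lebesgue. x \<notin> U" using ae by eventually_elim (simp add: U_def)
    ultimately show ?thesis using AE_iff_null_sets by blast
  qed
  ultimately show False by (simp add: negligible_iff_null_sets)
qed

section \<open>Small Hankel operators on a space of entire functions\<close>

lemma H_space_entire: "b \<in> H_space \<gamma> l \<Longrightarrow> b \<in> entire"
  by (simp add: H_space_def)

lemma conj_space_iff: "g \<in> conj_space X \<longleftrightarrow> (\<lambda>z. cnj (g z)) \<in> X"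
proof
  assume "(\<lambda>z. cnj (g z)) \<in> X"
  then have "(\<lambda>z. cnj (cnj (g z))) \<in> conj_space X" unfolding conj_space_def by (rule imageI)
  then show "g \<in> conj_space X" by simp
qed (auto simp: conj_space_def)

context fock_params begin

text \<open>The growth allowed for symbols is that of the inverse weight, half of what the Gaussian can absorb.\<close>

lemma H_space_tame:
  assumes "b \<in> H_space \<alpha> l" shows "tame b"
proof -
  have ent: "b \<in> entire" and O: "(\<lambda>z. cmod (b z)) \<in> O[at_infinity](\<lambda>z. (1 + cmod z) ^ (2 * l - 2) * exp (\<alpha> * cmod z ^ (2 * l) / 2))"
    using assms by (auto simp: H_space_def)
  have cont: "continuous_on UNIV (\<lambda>z. cmod (b z))" by (intro continuous_intros entire_continuous ent)
  have ge1: "1 \<le> (1 + cmod z) ^ (2 * l - 2) * exp (\<alpha> * cmod z ^ (2 * l) / 2)" for z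
  proof -
    have "1 \<le> (1 + cmod z) ^ (2 * l - 2)" by (intro one_le_power) simp
    moreover have "1 \<le> exp (\<alpha> * cmod z ^ (2 * l) / 2)" using \<alpha>_pos by simp
    ultimately show ?thesis using mult_mono[of 1 "(1 + cmod z) ^ (2 * l - 2)" 1 "exp (\<alpha> * cmod z ^ (2 * l) / 2)"] by simp
  qed
  obtain C where "C > 0" "\<And>z. cmod (b z) \<le> C * ((1 + cmod z) ^ (2 * l - 2) * exp (\<alpha> * cmod z ^ (2 * l) / 2))"
    using bigo_at_infinity_bound[OF O cont ge1] by metis
  then show ?thesis
    using \<alpha>_pos by (intro tame_growth[of b "\<alpha> / 2" C "2 * l - 2"] entire_measurable ent) (auto simp: mult.assoc)
qed

text \<open>The bounded symbol \<open>\<psi>\<close> with \<open>P \<psi> = b\<close>. Its monomial moments agree with those of \<open>b\<close> because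
  passing from \<open>\<alpha>\<close> to \<open>2\<alpha>\<close> multiplies the \<open>m\<close>-th kernel coefficient by the \<open>(m+1)\<close>-st power of the
  dilation factor.\<close>

definition bdd_symbol :: "(complex \<Rightarrow> complex) \<Rightarrow> complex \<Rightarrow> complex" where
  "bdd_symbol b w = dil * b (dil * w) * of_real (gauss \<alpha> l w)"

lemma bdd_symbol_bound:
  assumes "b \<in> Finf (\<alpha> / 2) l"
  shows "cmod (bdd_symbol b w) \<le> cmod dil * Linf_norm (\<alpha> / 2) l b"
proof -
  have "cmod (dil * w) ^ (2 * l) = (cmod dil ^ l)\<^sup>2 * cmod w ^ (2 * l)"
    by (simp add: norm_mult power_mult_distrib power_mult[symmetric] mult.commute)
  then have "weight (\<alpha> / 2) l (dil * w) = gauss \<alpha> l w"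
    unfolding dil_power_l by (simp add: weight_def gauss_def)
  then show ?thesis
    using Linf_norm_bound[OF assms, of "dil * w"]
    by (simp add: bdd_symbol_def norm_mult mult.assoc mult_left_mono)
qed

lemma bdd_symbol_measurable:
  assumes "b \<in> entire" shows "bdd_symbol b \<in> borel_measurable borel"
proof -
  have [measurable]: "b \<in> borel_measurable borel" using assms by (rule entire_measurable)
  show ?thesis unfolding bdd_symbol_def by measurable
qed

lemma tame_bdd: "g \<in> borel_measurable borel \<Longrightarrow> (\<And>w. cmod (g w) \<le> M) \<Longrightarrow> tame g"
  by (rule tame_growth[where \<delta>=0 and C=M and k=0]) (use \<alpha>_pos in auto)

lemma bdd_symbol_moments:
  assumes b: "b \<in> entire" "tame b" "b \<in> Finf (\<alpha> / 2) l"
  shows "(LINT w|lborel. w ^ m * (cnj (bdd_symbol b w) * of_real (gauss \<alpha> l w)))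
    = (LINT w|lborel. w ^ m * (cnj (b w) * of_real (gauss \<alpha> l w)))"
proof -
  obtain a where a: "\<And>w. (\<lambda>n. a n * w ^ n) sums b w"
    using entire_power_series[OF b(1)] by metis
  have tpsi: "tame (bdd_symbol b)"
    by (rule tame_bdd[OF bdd_symbol_measurable[OF b(1)] bdd_symbol_bound[OF b(3)]])
  have conj: "(LINT w|lborel. w ^ m * (cnj (g w) * of_real (gauss \<alpha> l w)))
     = cnj (LINT w|lborel. g w * (cnj w ^ m * of_real (gauss \<alpha> l w)))" for g
    by (subst Bochner_Integration.integral_cnj[symmetric]) (simp add: mult_ac)
  have int: "integrable lborel (\<lambda>w. g w * (cnj w ^ m * of_real (gauss \<alpha> l w)))" if "tame g" for g
  proof -
    have "integrable lborel (\<lambda>w. cnj (w ^ m * (cnj (g w) * of_real (gauss \<alpha> l w))))"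
      by (intro integrable_cnj E_space_pairing_integrable E_space_monomial tame_cnj that)
    then show ?thesis by (simp add: mult_ac)
  qed
  interpret two: fock_params "2 * \<alpha>" l using \<alpha>_pos l_pos by unfold_locales auto
  have g2: "gauss \<alpha> l w * gauss \<alpha> l w = gauss (2 * \<alpha>) l w" for w
    by (simp add: gauss_def exp_add[symmetric])
  have eq: "bdd_symbol b w * (cnj w ^ m * of_real (gauss \<alpha> l w))
      = (dil * b (dil * w)) * (cnj w ^ m * of_real (gauss (2 * \<alpha>) l w))" for w
    unfolding bdd_symbol_def g2[symmetric] by simp
  have "(LINT w|lborel. bdd_symbol b w * (cnj w ^ m * of_real (gauss \<alpha> l w)))
      = dil * (a m * dil ^ m) / of_real (kcoef (2 * \<alpha>) l m)"
    unfolding eq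
  proof (rule two.integral_coefficient)
    show "(\<lambda>n. dil * (a n * dil ^ n) * w ^ n) sums (dil * b (dil * w))" for w
      using sums_mult[OF a[of "dil * w"], of dil] by (simp add: power_mult_distrib mult_ac)
    show "integrable lborel (\<lambda>w. (dil * b (dil * w)) * (cnj w ^ m * of_real (gauss (2 * \<alpha>) l w)))"
      using int[OF tpsi] unfolding eq .
  qed
  also have "\<dots> = a m / of_real (kcoef \<alpha> l m)"
  proof -
    have "kcoef (2 * \<alpha>) l m = kcoef \<alpha> l m * (2 powr (1 / l) * 2 powr (real m / l))"
      using \<alpha>_pos by (simp add: kcoef_def powr_mult)
    also have "2 powr (1 / l) * 2 powr (real m / l) = 2 powr (1 / l) * (2 powr (1 / l)) ^ m"
      by (simp add: powr_realpow[symmetric] powr_powr)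
    finally have "complex_of_real (kcoef (2 * \<alpha>) l m) = of_real (kcoef \<alpha> l m) * (dil * dil ^ m)"
      by (simp add: dil_def)
    moreover have "dil \<noteq> 0" by (simp add: dil_def)
    ultimately show ?thesis by simp
  qed
  also have "\<dots> = (LINT w|lborel. b w * (cnj w ^ m * of_real (gauss \<alpha> l w)))"
    by (rule integral_coefficient[OF a int[OF b(2)], symmetric])
  finally show ?thesis unfolding conj by simp
qed

lemma small_hankel_bdd_symbol:
  assumes b: "b \<in> entire" "tame b" "b \<in> Finf (\<alpha> / 2) l" and f: "f \<in> E_space l"
  shows "small_hankel \<alpha> l b f z = cnj (proj (\<lambda>w. bdd_symbol b w * cnj (f w)) z)"
proof -
  define F where "F = (\<lambda>w. bergman_kernel \<alpha> l w z * f w)"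
  have F: "F \<in> E_space l" unfolding F_def by (rule E_space_mult[OF E_space_kernel f])
  obtain a where a: "exp_type a" "\<And>w. (\<lambda>n. a n * w ^ n) sums F w"
    using E_space_exp_type[OF F] by metis
  have tpsi: "tame (bdd_symbol b)"
    by (rule tame_bdd[OF bdd_symbol_measurable[OF b(1)] bdd_symbol_bound[OF b(3)]])
  have "small_hankel \<alpha> l b f z = (LINT w|lborel. F w * (cnj (b w) * of_real (gauss \<alpha> l w)))"
    unfolding F_def
    by (rule small_hankel_eq[OF entire_measurable[OF b(1)] entire_measurable[OF E_space_entire[OF f]]])
  also have "\<dots> = (LINT w|lborel. F w * (cnj (bdd_symbol b w) * of_real (gauss \<alpha> l w)))"
    using exp_type_pairing[OF a tame_cnj[OF tpsi]] exp_type_pairing[OF a tame_cnj[OF b(2)]]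
    unfolding bdd_symbol_moments[OF b] by (rule sums_unique2[symmetric])
  also have "\<dots> = cnj (proj (\<lambda>w. bdd_symbol b w * cnj (f w)) z)"
    unfolding proj_eq_cnj by (simp add: F_def mult_ac)
  finally show ?thesis .
qed

text \<open>On the support the kernel is bounded by a fixed function of exponential type in \<open>z\<close>.\<close>

lemma proj_cutoff_E_space:
  assumes t: "tame g" and supp: "\<And>w. \<not> cmod w \<le> R \<Longrightarrow> g w = 0"
  shows "proj g \<in> E_space l"
proof -
  obtain C \<beta> where C: "\<And>z w. cmod w \<le> R \<Longrightarrow> cmod (bergman_kernel \<alpha> l z w) \<le> C * exp (\<beta> * cmod z ^ l)"
  proof -
    obtain C \<beta> where C: "C > 0" "\<beta> > 0"
      "\<And>x. x \<ge> 0 \<Longrightarrow> summable (\<lambda>n. cmod (of_real (kcoef \<alpha> l n) * cnj (of_real \<bar>R\<bar>) ^ n) * x ^ n)"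
      "\<And>x. x \<ge> 0 \<Longrightarrow> (\<Sum>n. cmod (of_real (kcoef \<alpha> l n) * cnj (of_real \<bar>R\<bar>) ^ n) * x ^ n) \<le> C * exp (\<beta> * x ^ l)"
      by (rule exp_type_bound[OF kernel_exp_type kernel_sums, of "of_real \<bar>R\<bar>"]) blast
    have "cmod (bergman_kernel \<alpha> l z w) \<le> C * exp (\<beta> * cmod z ^ l)" if "cmod w \<le> R" for z w
    proof -
      have "cmod (bergman_kernel \<alpha> l z w) \<le> kser \<alpha> l (cmod z * cmod w)" by (rule norm_bergman_kernel_le)
      also have "\<dots> \<le> kser \<alpha> l (\<bar>R\<bar> * cmod z)"
        using that by (intro kser_mono) (auto simp: mult.commute intro!: mult_right_mono)
      also have "\<dots> \<le> C * exp (\<beta> * cmod z ^ l)"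
        using C(4)[of "cmod z"] unfolding kernel_majorant by simp
      finally show ?thesis .
    qed
    then show thesis by (rule that)
  qed
  have i1: "integrable lborel (\<lambda>w. cmod (g w) * gauss \<alpha> l w)"
    using t unfolding tame_def by (auto dest!: spec[of _ 0])
  define D where "D = (LINT w|lborel. cmod (g w) * gauss \<alpha> l w)"
  have "cmod (proj g z) \<le> (C * D) * exp (\<beta> * cmod z ^ l)" for z
  proof -
    have "cmod (proj g z) \<le> (LINT w|lborel. C * exp (\<beta> * cmod z ^ l) * (cmod (g w) * gauss \<alpha> l w))"
      unfolding proj_def
    proof (rule order_trans[OF Bochner_Integration.integral_norm_bound integral_mono])
      show "integrable lborel (\<lambda>w. C * exp (\<beta> * cmod z ^ l) * (cmod (g w) * gauss \<alpha> l w))"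
        using i1 by (rule integrable_mult_right)
      show "norm (bergman_kernel \<alpha> l z w * (g w * of_real (gauss \<alpha> l w)))
          \<le> C * exp (\<beta> * cmod z ^ l) * (cmod (g w) * gauss \<alpha> l w)" for w
        using C[of w z] by (cases "cmod w \<le> R") (auto simp: norm_mult supp intro!: mult_right_mono)
    qed (rule integrable_norm[OF proj_integrable[OF t]])
    also have "\<dots> = C * exp (\<beta> * cmod z ^ l) * D"
      unfolding D_def by (rule integral_mult_right_zero)
    finally show ?thesis by (simp add: mult_ac)
  qed
  then show ?thesis by (intro E_space_I proj_entire t)
qed

end

text \<open>What the argument needs to know about a space \<open>X\<close> with norm \<open>N\<close>. The number \<open>\<Lambda> z\<close> is, up to constants,
  the weighted norm of evaluation at \<open>z\<close>; what matters is that \<open>point_eval\<close> and \<open>exp_norm\<close> involve the same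
  \<open>\<Lambda>\<close>, since it cancels between them. Boundedness of the projection is phrased by domination, so that no norm of
  functions outside \<open>X\<close> occurs, and \<open>N\<close> is only asked to be a quasi-norm.\<close>

locale fock_type_space = fock_params +
  fixes X :: "(complex \<Rightarrow> complex) set" and N :: "(complex \<Rightarrow> complex) \<Rightarrow> real"
    and \<Lambda> :: "complex \<Rightarrow> real"
  assumes X_entire: "f \<in> X \<Longrightarrow> f \<in> entire"
    and X_tame: "f \<in> X \<Longrightarrow> tame f"
    and X_add: "f \<in> X \<Longrightarrow> g \<in> X \<Longrightarrow> (\<lambda>z. f z + g z) \<in> X"
    and X_scale: "f \<in> X \<Longrightarrow> (\<lambda>z. c * f z) \<in> X"
    and E_sub: "E_space l \<subseteq> X"
    and N_nonneg: "0 \<le> N f"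
    and N_scale: "f \<in> X \<Longrightarrow> N (\<lambda>z. c * f z) = cmod c * N f"
    and N_add: "f \<in> X \<Longrightarrow> g \<in> X \<Longrightarrow> N (\<lambda>z. f z + g z) \<le> 2 * (N f + N g)"
    and proj_bound: "\<exists>A>0. \<forall>f\<in>X. \<forall>M\<ge>0. \<forall>g\<in>borel_measurable borel. (\<forall>w. cmod (g w) \<le> M * cmod (f w)) \<longrightarrow>
        proj g \<in> X \<and> N (proj g) \<le> A * M * N f"
    and proj_tail: "f \<in> X \<Longrightarrow> 0 < \<epsilon> \<Longrightarrow> \<exists>R. N (proj (\<lambda>w. if cmod w \<le> R then 0 else f w)) \<le> \<epsilon>"
    and \<Lambda>_pos: "0 < \<Lambda> z"
    and point_eval: "\<exists>C>0. \<forall>f\<in>X. \<forall>z. cmod (f z) * weight \<alpha> l z \<le> C * \<Lambda> z * N f"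
    and exp_norm: "\<exists>C>0. \<forall>z. N (\<lambda>w. exp (of_real \<alpha> * cnj z ^ l * w ^ l)) \<le> C * exp (\<alpha> * cmod z ^ (2 * l) / 2) / \<Lambda> z"
    and decay_norm: "\<exists>C>0. \<forall>M\<ge>0. \<forall>f\<in>E_space l. (\<forall>w. cmod (f w) * weight \<alpha> l w \<le> M * gauss (\<alpha> / 16) l w) \<longrightarrow> N f \<le> C * M"
begin

lemma hankel_extension_exists:
  assumes b: "b \<in> H_space \<alpha> l" "b \<in> Finf (\<alpha> / 2) l"
  shows "hankel_bounded \<alpha> l b X N"
proof -
  have be: "b \<in> entire" "tame b" using b(1) by (auto intro: H_space_entire H_space_tame)
  define \<psi> where "\<psi> = bdd_symbol b"
  define M where "M = cmod dil * Linf_norm (\<alpha> / 2) l b"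
  have M: "M \<ge> 0" by (simp add: M_def Linf_norm_nonneg)
  have [measurable]: "\<psi> \<in> borel_measurable borel"
    unfolding \<psi>_def by (rule bdd_symbol_measurable[OF be(1)])
  have \<psi>: "cmod (\<psi> w) \<le> M" for w unfolding \<psi>_def M_def by (rule bdd_symbol_bound[OF b(2)])
  obtain A where A: "A > 0" "\<And>f M g. f \<in> X \<Longrightarrow> M \<ge> 0 \<Longrightarrow> g \<in> borel_measurable borel \<Longrightarrow>
      (\<And>w. cmod (g w) \<le> M * cmod (f w)) \<Longrightarrow> proj g \<in> X \<and> N (proj g) \<le> A * M * N f"
    using proj_bound by blast
  define S where "S f = (\<lambda>w. \<psi> w * cnj (f w))" for f
  have Sm: "S f \<in> borel_measurable borel" if "f \<in> X" for f
  proof -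
    have [measurable]: "f \<in> borel_measurable borel" using X_tame[OF that] by (rule tame_measurable)
    show ?thesis unfolding S_def by measurable
  qed
  have Sb: "cmod (S f w) \<le> M * cmod (f w)" for f w
    using \<psi>[of w] by (simp add: S_def norm_mult mult_right_mono)
  have St: "tame (S f)" if "f \<in> X" for f
    by (rule tame_bounded[OF X_tame[OF that] Sm[OF that] Sb])
  define T where "T f z = cnj (proj (S f) z)" for f z
  have TX: "T f \<in> conj_space X" "conj_norm N (T f) \<le> A * M * N f" if "f \<in> X" for f
    using A(2)[OF that M Sm[OF that] Sb] by (auto simp: conj_space_iff conj_norm_def T_def)
  have Tadd: "T (\<lambda>z. f z + g z) = (\<lambda>z. T f z + T g z)" if "f \<in> X" "g \<in> X" for f g
  proof
    fix z
    have "S (\<lambda>z. f z + g z) = (\<lambda>w. S f w + S g w)" by (simp add: S_def distrib_left)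
    then show "T (\<lambda>z. f z + g z) z = T f z + T g z"
      using proj_add[OF St[OF that(1)] St[OF that(2)]] by (simp add: T_def)
  qed
  have Tscale: "T (\<lambda>z. c * f z) = (\<lambda>z. c * T f z)" for c f
  proof
    fix z
    have "S (\<lambda>z. c * f z) = (\<lambda>w. cnj c * S f w)" by (simp add: S_def mult_ac)
    then show "T (\<lambda>z. c * f z) z = c * T f z" by (simp add: T_def proj_scale)
  qed
  have TE: "T f = small_hankel \<alpha> l b f" if "f \<in> E_space l" for f
    using small_hankel_bdd_symbol[OF be b(2) that] by (auto simp: T_def S_def \<psi>_def fun_eq_iff)
  have "hankel_extension \<alpha> l b X N T"
    unfolding hankel_extension_def bounded_operator_def
    using TX Tadd Tscale TE by blast
  then show ?thesis unfolding hankel_bounded_def by blast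
qed

text \<open>An arbitrary extension obeys the same bound: cutting \<open>f\<close> off outside a disc and projecting back
  gives a function of \<open>E\<close> close to \<open>f\<close>, because \<open>f\<close> reproduces itself under the projection.\<close>

lemma hankel_upper:
  obtains C where "C > 0" "\<And>b T f. b \<in> H_space \<alpha> l \<Longrightarrow> b \<in> Finf (\<alpha> / 2) l \<Longrightarrow> hankel_extension \<alpha> l b X N T \<Longrightarrow>
     f \<in> X \<Longrightarrow> conj_norm N (T f) \<le> C * Linf_norm (\<alpha> / 2) l b * N f"
proof -
  obtain A where A: "A > 0" "\<And>f M g. f \<in> X \<Longrightarrow> M \<ge> 0 \<Longrightarrow> g \<in> borel_measurable borel \<Longrightarrow>
      (\<And>w. cmod (g w) \<le> M * cmod (f w)) \<Longrightarrow> proj g \<in> X \<and> N (proj g) \<le> A * M * N f"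
    using proj_bound by blast
  have dil: "cmod dil > 0" by (simp add: dil_def)
  show thesis
  proof (rule that[of "2 * A * cmod dil * A"])
    show "2 * A * cmod dil * A > 0" using A dil by simp
    fix b T f
    assume b: "b \<in> H_space \<alpha> l" "b \<in> Finf (\<alpha> / 2) l" and T: "hankel_extension \<alpha> l b X N T" and f: "f \<in> X"
    have be: "b \<in> entire" "tame b" using b(1) by (auto intro: H_space_entire H_space_tame)
    have [measurable]: "f \<in> borel_measurable borel" using X_tame[OF f] by (rule tame_measurable)
    from T obtain B0 where TX: "\<And>f. f \<in> X \<Longrightarrow> T f \<in> conj_space X"
      and Tadd: "\<And>f g. f \<in> X \<Longrightarrow> g \<in> X \<Longrightarrow> T (\<lambda>z. f z + g z) = (\<lambda>z. T f z + T g z)"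
      and TB0: "\<And>f. f \<in> X \<Longrightarrow> conj_norm N (T f) \<le> B0 * N f"
      and TE: "\<And>f. f \<in> E_space l \<Longrightarrow> T f = small_hankel \<alpha> l b f"
      unfolding hankel_extension_def bounded_operator_def by blast
    define B where "B = \<bar>B0\<bar> + 1"
    have TB: "conj_norm N (T f) \<le> B * N f" if "f \<in> X" for f
    proof -
      have "B0 * N f \<le> B * N f" by (rule mult_right_mono) (simp_all add: B_def N_nonneg)
      with TB0[OF that] show ?thesis by (rule order_trans)
    qed
    define M where "M = cmod dil * Linf_norm (\<alpha> / 2) l b"
    have M: "M \<ge> 0" by (simp add: M_def Linf_norm_nonneg)
    have onE: "conj_norm N (T g) \<le> A * M * N g" if g: "g \<in> E_space l" for g
    proof -
      have gX: "g \<in> X" using g E_sub by blast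
      have [measurable]: "g \<in> borel_measurable borel" "bdd_symbol b \<in> borel_measurable borel"
        using X_tame[OF gX] bdd_symbol_measurable[OF be(1)] by (auto dest: tame_measurable)
      have "N (proj (\<lambda>w. bdd_symbol b w * cnj (g w))) \<le> A * M * N g"
        using bdd_symbol_bound[OF b(2)]
        by (intro A(2)[THEN conjunct2] gX M) (auto simp: norm_mult M_def intro!: mult_right_mono)
      moreover have "(\<lambda>z. cnj (T g z)) = proj (\<lambda>w. bdd_symbol b w * cnj (g w))"
        unfolding TE[OF g] using small_hankel_bdd_symbol[OF be b(2) g] by auto
      ultimately show ?thesis by (simp add: conj_norm_def)
    qed
    have approx: "conj_norm N (T f) \<le> 2 * (A * M * (A * 1 * N f) + B * \<epsilon>)" if \<epsilon>: "\<epsilon> > 0" for \<epsilon>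
    proof -
      obtain R where R: "N (proj (\<lambda>w. if cmod w \<le> R then 0 else f w)) \<le> \<epsilon>"
        using proj_tail[OF f \<epsilon>] by blast
      define f1 f2 where "f1 = (\<lambda>w. if cmod w \<le> R then f w else 0)"
        and "f2 = (\<lambda>w. if cmod w \<le> R then 0 else f w)"
      have m: "f1 \<in> borel_measurable borel" "f2 \<in> borel_measurable borel"
        unfolding f1_def f2_def by measurable
      have t: "tame f1" "tame f2"
        by (rule tame_bounded[OF X_tame[OF f], of _ 1]; use m in \<open>auto simp: f1_def f2_def\<close>)+
      have P1: "proj f1 \<in> X \<and> N (proj f1) \<le> A * 1 * N f"
        by (rule A(2)[OF f _ m(1)]) (auto simp: f1_def)
      have P2: "proj f2 \<in> X" by (rule conjunct1[OF A(2)[OF f, of 1]]) (use m in \<open>auto simp: f2_def\<close>)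
      have split: "f = (\<lambda>z. proj f1 z + proj f2 z)"
      proof -
        have rep: "proj f = f" by (rule proj_reproducing[OF X_entire[OF f] X_tame[OF f]])
        have sum: "(\<lambda>w. f1 w + f2 w) = f" by (auto simp: f1_def f2_def)
        show ?thesis
          by (rule ext) (use proj_add[OF t] in \<open>simp only: sum rep\<close>)
      qed
      have E1: "proj f1 \<in> E_space l"
        by (rule proj_cutoff_E_space[OF t(1), of R]) (simp add: f1_def)
      have "(\<lambda>z. cnj (T f z)) = (\<lambda>z. cnj (T (proj f1) z) + cnj (T (proj f2) z))"
        using Tadd[of "proj f1" "proj f2"] P1 P2 split by auto
      moreover have "N (\<lambda>z. cnj (T (proj f1) z) + cnj (T (proj f2) z))
          \<le> 2 * (N (\<lambda>z. cnj (T (proj f1) z)) + N (\<lambda>z. cnj (T (proj f2) z)))"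
        by (rule N_add) (use TX P1 P2 in \<open>auto simp: conj_space_iff\<close>)
      ultimately have "conj_norm N (T f) \<le> 2 * (conj_norm N (T (proj f1)) + conj_norm N (T (proj f2)))"
        unfolding conj_norm_def by (simp only:)
      also have "conj_norm N (T (proj f1)) \<le> A * M * (A * 1 * N f)"
        using onE[OF E1] P1 A(1) M by (meson mult_left_mono mult_nonneg_nonneg less_imp_le order_trans)
      also have "conj_norm N (T (proj f2)) \<le> B * \<epsilon>"
        using TB[OF P2] R unfolding f2_def[symmetric]
        by (smt (verit) B_def mult_left_mono abs_ge_zero)
      finally show ?thesis by simp
    qed
    have "conj_norm N (T f) \<le> 2 * (A * M * (A * 1 * N f))"
    proof (rule field_le_epsilon)
      fix e :: real assume e: "e > 0"
      have "B > 0" by (simp add: B_def)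
      then have "B * (e / (2 * B)) = e / 2" "e / (2 * B) > 0" using e by auto
      with approx[of "e / (2 * B)"] show "conj_norm N (T f) \<le> 2 * (A * M * (A * 1 * N f)) + e"
        by (simp only: distrib_left) simp
    qed
    then show "conj_norm N (T f) \<le> 2 * A * cmod dil * A * Linf_norm (\<alpha> / 2) l b * N f"
      by (simp add: M_def mult_ac)
  qed
qed

text \<open>Testing the operator on \<open>exp (\<alpha> cnj z\<^sup>l w\<^sup>l)\<close> and evaluating at \<open>z\<close> pairs \<open>b\<close> with the exponential
  times the kernel at \<open>z\<close>, which up to a constant is the kernel at the dilated point. The difference
  is a series of monomials; there it suffices to evaluate the operator on monomials at \<open>0\<close>.\<close>

lemma hankel_lower:
  obtains C where "C > 0" "\<And>b H \<zeta>. b \<in> H_space \<alpha> l \<Longrightarrow> H \<ge> 0 \<Longrightarrow>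
     (\<And>f. f \<in> E_space l \<Longrightarrow> small_hankel \<alpha> l b f \<in> conj_space X \<and> conj_norm N (small_hankel \<alpha> l b f) \<le> H * N f) \<Longrightarrow>
     cmod (b \<zeta>) * weight (\<alpha> / 2) l \<zeta> \<le> C * H"
proof -
  obtain C1 where C1: "C1 > 0" "\<And>f z. f \<in> X \<Longrightarrow> cmod (f z) * weight \<alpha> l z \<le> C1 * \<Lambda> z * N f"
    using point_eval by blast
  obtain C2 where C2: "C2 > 0" "\<And>M f. M \<ge> 0 \<Longrightarrow> f \<in> E_space l \<Longrightarrow>
      (\<And>w. cmod (f w) * weight \<alpha> l w \<le> M * gauss (\<alpha> / 16) l w) \<Longrightarrow> N f \<le> C2 * M"
    using decay_norm by blast
  obtain C8 where C8: "C8 > 0" "\<And>z. N (\<lambda>w. exp (of_real \<alpha> * cnj z ^ l * w ^ l)) \<le> C8 * exp (\<alpha> * cmod z ^ (2 * l) / 2) / \<Lambda> z"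
    using exp_norm by blast
  obtain C3 where C3: "C3 > 0" "\<And>x. x \<ge> 0 \<Longrightarrow> (1 + x) ^ l * exp (0 * x ^ l) \<le> C3 * exp (\<alpha> / 16 * x ^ (2 * l))"
    using poly_exp_bound[of "\<alpha> / 16" l 0] \<alpha>_pos by (metis divide_pos_pos zero_less_numeral)
  define \<sigma> where "\<sigma> = \<alpha> powr (1 / l)"
  have \<sigma>: "\<sigma> > 0" using \<alpha>_pos by (simp add: \<sigma>_def)
  have \<sigma>l: "\<sigma> ^ l = \<alpha>" using \<alpha>_pos l_pos by (simp add: \<sigma>_def root_power)
  (* For monomials, theta / 2 = (3/8) alpha together with 1/16 alpha for the powers of low degree and 1/16 alpha
     for decay makes up the exponent alpha / 2 of the weight. In the remainder series, the factor q < 1 makes the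
     sum converge; it costs the exponent 5/4, and (5/4) / (2 * 3/4) = 5/6 leaves 1/6 for the powers of low degree. *)
  define \<theta> where "\<theta> = 3 / 4 * \<alpha>"
  have \<theta>: "\<theta> > 0" using \<alpha>_pos by (simp add: \<theta>_def)
  define q where "q = 1 / sqrt (5 / 4 :: real)"
  have q: "0 < q" "q < 1" by (auto simp: q_def)
  define k0 where "k0 = kcoef \<alpha> l 0"
  have k0: "k0 > 0" using kcoef_pos by (simp add: k0_def)
  have kap: "kap > 0" using \<alpha>_pos l_pos by (simp add: kap_def)
  define Q where "Q = (\<Sum>m. q ^ (m div l))"
  have Qs: "summable (\<lambda>m. q ^ (m div l))" using q l_pos by (intro summable_power_div) auto
  have Q: "Q \<ge> 0" unfolding Q_def using q by (intro suminf_nonneg Qs) auto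
  define C5 where "C5 = C1 * \<Lambda> 0 * C2 * C3 / k0"
  have C5: "C5 > 0" using C1 C2 C3 k0 \<Lambda>_pos[of 0] by (simp add: C5_def)
  obtain C6 where C6: "C6 > 0" "\<And>x. x \<ge> 0 \<Longrightarrow> (1 + x) ^ l * exp (0 * x ^ l) \<le> C6 * exp (\<alpha> / 6 * x ^ (2 * l))"
    using poly_exp_bound[of "\<alpha> / 6" l 0] \<alpha>_pos by (metis divide_pos_pos zero_less_numeral)
  define C7 where "C7 = kap * (C5 * ((1 + \<sigma>) ^ l * C6)) * Q"
  have C7: "C7 \<ge> 0" using kap C5 C6 Q \<sigma> by (simp add: C7_def)
  define d where "d = 2 powr (1 / real l - 1)"
  have d: "d > 0" by (simp add: d_def)
  show thesis
  proof (rule that[of "(C1 * C8 + C7) / d"])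
    show "(C1 * C8 + C7) / d > 0" using C1 C8 C7 d by (simp add: add_pos_nonneg)
    fix b H \<zeta>
    assume b: "b \<in> H_space \<alpha> l" and H: "H \<ge> 0"
      and op: "\<And>f. f \<in> E_space l \<Longrightarrow> small_hankel \<alpha> l b f \<in> conj_space X \<and> conj_norm N (small_hankel \<alpha> l b f) \<le> H * N f"
    have be: "b \<in> entire" "tame b" using b by (auto intro: H_space_entire H_space_tame)
    have tb: "tame (\<lambda>w. cnj (b w))" by (rule tame_cnj[OF be(2)])
    define B where "B m = (LINT w|lborel. w ^ m * (cnj (b w) * of_real (gauss \<alpha> l w)))" for m
    have sh: "small_hankel \<alpha> l b f z = (LINT w|lborel. (bergman_kernel \<alpha> l w z * f w) * (cnj (b w) * of_real (gauss \<alpha> l w)))"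
      if "f \<in> E_space l" for f z
      by (rule small_hankel_eq[OF entire_measurable[OF be(1)] entire_measurable[OF E_space_entire[OF that]]])
    have point: "cmod (small_hankel \<alpha> l b f z) * weight \<alpha> l z \<le> C1 * \<Lambda> z * (H * N f)" if f: "f \<in> E_space l" for f z
    proof -
      have "cmod (small_hankel \<alpha> l b f z) * weight \<alpha> l z \<le> C1 * \<Lambda> z * conj_norm N (small_hankel \<alpha> l b f)"
        using C1(2)[of "\<lambda>z. cnj (small_hankel \<alpha> l b f z)" z] op[OF f] by (simp add: conj_norm_def conj_space_iff)
      also have "\<dots> \<le> C1 * \<Lambda> z * (H * N f)"
        using op[OF f] C1(1) \<Lambda>_pos[of z] by (intro mult_left_mono) auto
      finally show ?thesis .
    qed
    have Bm: "cmod (B m) \<le> C5 * H * (sqrt (fact (m div l)) * (1 / sqrt \<theta>) ^ (m div l))" for m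
    proof -
      define n r where "n = m div l" and "r = m mod l"
      have r: "r < l" using l_pos by (simp add: r_def)
      have m: "m = l * n + r" by (simp add: n_def r_def)
      define s where "s = sqrt (fact n) * (1 / sqrt \<theta>) ^ n"
      have s: "s \<ge> 0" using \<theta> by (simp add: s_def)
      have "N (\<lambda>w. w ^ m) \<le> C2 * (C3 * s)"
      proof (rule C2(2))
        fix w
        define x where "x = cmod w"
        define y where "y = x ^ l"
        have x: "x \<ge> 0" by (simp add: x_def)
        have y2: "x ^ (2 * l) = y\<^sup>2" by (simp add: y_def power_mult[symmetric] mult.commute)
        have yn: "y ^ n \<le> s * exp (\<theta> * y\<^sup>2 / 2)"
          unfolding s_def using x \<theta> by (intro sqrt_exp_bound) (auto simp: y_def)
        have "x ^ r \<le> (1 + x) ^ r" using x by (intro power_mono) auto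
        also have "\<dots> \<le> (1 + x) ^ l" using x r by (intro power_increasing) auto
        also have "\<dots> \<le> C3 * exp (\<alpha> / 16 * y\<^sup>2)" using C3(2)[OF x] by (simp add: y2)
        finally have xr: "x ^ r \<le> C3 * exp (\<alpha> / 16 * y\<^sup>2)" .
        have "cmod (w ^ m) * weight \<alpha> l w = (y ^ n * x ^ r) * exp (- (\<alpha> * y\<^sup>2 / 2))"
          by (simp add: m norm_mult norm_power power_add power_mult y_def x_def weight_def mult.commute)
        also have "\<dots> \<le> ((s * exp (\<theta> * y\<^sup>2 / 2)) * (C3 * exp (\<alpha> / 16 * y\<^sup>2))) * exp (- (\<alpha> * y\<^sup>2 / 2))"
          using x s by (intro mult_right_mono mult_mono yn xr) (auto simp: y_def)
        also have "\<dots> = C3 * s * (exp (\<theta> * y\<^sup>2 / 2) * exp (\<alpha> / 16 * y\<^sup>2) * exp (- (\<alpha> * y\<^sup>2 / 2)))"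
          by (simp only: mult_ac)
        also have "exp (\<theta> * y\<^sup>2 / 2) * exp (\<alpha> / 16 * y\<^sup>2) * exp (- (\<alpha> * y\<^sup>2 / 2)) = gauss (\<alpha> / 16) l w"
          unfolding exp_add[symmetric] gauss_def x_def[symmetric] y2 by (simp add: \<theta>_def algebra_simps)
        finally show "cmod (w ^ m) * weight \<alpha> l w \<le> C3 * s * gauss (\<alpha> / 16) l w" .
      qed (use C3 s E_space_monomial in auto)
      then have Nm: "H * N (\<lambda>w. w ^ m) \<le> H * (C2 * (C3 * s))" using H by (rule mult_left_mono)
      have K0: "bergman_kernel \<alpha> l w 0 = of_real k0" for w
      proof -
        have "(\<lambda>m. of_real (kcoef \<alpha> l m) * (w * cnj 0) ^ m) = (\<lambda>m. if m = 0 then of_real k0 else (0::complex))"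
          by (auto simp: k0_def fun_eq_iff)
        then show ?thesis
          using bergman_kernel_sums[of w 0] sums_single[of 0 "\<lambda>_. complex_of_real k0"] sums_unique2 by auto
      qed
      have "small_hankel \<alpha> l b (\<lambda>w. w ^ m) 0 = of_real k0 * B m"
        unfolding sh[OF E_space_monomial] K0 B_def by (simp add: mult.assoc)
      then have "k0 * cmod (B m) \<le> C1 * \<Lambda> 0 * (H * N (\<lambda>w. w ^ m))"
        using point[OF E_space_monomial, of m 0] k0 l_pos by (simp add: weight_def norm_mult power_0_left)
      also have "\<dots> \<le> C1 * \<Lambda> 0 * (H * (C2 * (C3 * s)))"
        by (rule mult_left_mono[OF Nm]) (use C1(1) \<Lambda>_pos[of 0] in auto)
      finally have "cmod (B m) \<le> C1 * \<Lambda> 0 * (H * (C2 * (C3 * s))) / k0"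
        using k0 by (simp add: field_simps)
      also have "\<dots> = C5 * H * s" by (simp add: C5_def)
      finally show ?thesis by (simp add: s_def n_def)
    qed
    define z where "z = \<zeta> / dil"
    have dil: "dil \<noteq> 0" by (simp add: dil_def)
    have \<zeta>: "\<zeta> = dil * z" using dil by (simp add: z_def)
    define F where "F = (\<lambda>w. exp (of_real \<alpha> * cnj z ^ l * w ^ l))"
    have F: "F \<in> E_space l" unfolding F_def by (rule E_space_exp)
    define y where "y = cmod z ^ l"
    have y2: "cmod z ^ (2 * l) = y\<^sup>2" by (simp add: y_def power_mult[symmetric] mult.commute)
    define Z where "Z = exp (\<alpha> * y\<^sup>2)"
    have FK: "(\<lambda>w. F w * bergman_kernel \<alpha> l w z) \<in> E_space l"
      by (rule E_space_mult[OF F E_space_kernel])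
    have S1: "(\<lambda>m. of_real (kap * conv_coef m) * mu z ^ m * B m) sums small_hankel \<alpha> l b F z"
    proof -
      have "exp_type (\<lambda>m. of_real (kap * conv_coef m) * mu z ^ m)"
        using FK exp_times_kernel_sums[of z] unfolding F_def by (rule E_space_series_exp_type)
      from exp_type_pairing[OF this exp_times_kernel_sums tb]
      have "(\<lambda>m. of_real (kap * conv_coef m) * mu z ^ m * B m) sums
          (LINT w|lborel. (F w * bergman_kernel \<alpha> l w z) * (cnj (b w) * of_real (gauss \<alpha> l w)))"
        unfolding B_def F_def .
      moreover have "(\<lambda>w. F w * bergman_kernel \<alpha> l w z) = (\<lambda>w. bergman_kernel \<alpha> l w z * F w)"
        by (simp add: fun_eq_iff)
      ultimately show ?thesis unfolding sh[OF F] by metis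
    qed
    have S2: "(\<lambda>m. of_real (kap * (2 powr (real (m + 1) / l - 1) / Gamma (real (m + 1) / l))) * mu z ^ m * B m)
        sums (of_real d * cnj (b \<zeta>))"
    proof -
      have "b \<zeta> = proj b \<zeta>" using proj_reproducing[OF be] by simp
      then have "cnj (b \<zeta>) = (LINT w|lborel. bergman_kernel \<alpha> l w \<zeta> * (cnj (b w) * of_real (gauss \<alpha> l w)))"
        by (simp add: proj_eq_cnj)
      then have "(\<lambda>m. of_real (kcoef \<alpha> l m) * cnj \<zeta> ^ m * B m) sums cnj (b \<zeta>)"
        using exp_type_pairing[OF kernel_exp_type kernel_sums tb, of \<zeta>] by (simp add: B_def)
      then have "(\<lambda>m. of_real d * (of_real (kcoef \<alpha> l m) * cnj \<zeta> ^ m * B m)) sums (of_real d * cnj (b \<zeta>))"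
        by (rule sums_mult)
      moreover have "of_real d * (of_real (kcoef \<alpha> l m) * cnj \<zeta> ^ m * B m)
          = of_real (kap * (2 powr (real (m + 1) / l - 1) / Gamma (real (m + 1) / l))) * mu z ^ m * B m" for m
      proof -
        have "d * (2 powr (1 / l)) ^ m = 2 powr (real (m + 1) / l - 1)"
        proof -
          have "d * (2 powr (1 / l)) ^ m = 2 powr (1 / real l - 1) * 2 powr (real m / l)"
            by (simp add: d_def powr_realpow[symmetric] powr_powr)
          also have "\<dots> = 2 powr (1 / real l - 1 + real m / l)" by (rule powr_add[symmetric])
          also have "1 / real l - 1 + real m / l = real (m + 1) / l - 1" by (simp add: add_divide_distrib)
          finally show ?thesis .
        qed
        then have e: "of_real d * cnj dil ^ m = complex_of_real (2 powr (real (m + 1) / l - 1))"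
          unfolding dil_def by (metis complex_cnj_complex_of_real of_real_mult of_real_power)
        have "of_real d * (of_real (kcoef \<alpha> l m) * cnj \<zeta> ^ m * B m)
           = (of_real d * cnj dil ^ m) * (of_real (kcoef \<alpha> l m) * cnj z ^ m) * B m"
          by (simp add: \<zeta> power_mult_distrib mult_ac)
        then show ?thesis unfolding e kernel_coefficient_mu by (simp add: mult_ac)
      qed
      ultimately show ?thesis by simp
    qed
    define D where "D m = conv_coef m - 2 powr (real (m + 1) / l - 1) / Gamma (real (m + 1) / l)" for m
    have S3: "(\<lambda>m. of_real (kap * D m) * mu z ^ m * B m) sums (small_hankel \<alpha> l b F z - of_real d * cnj (b \<zeta>))"
      using sums_diff[OF S1 S2] by (simp add: D_def right_diff_distrib left_diff_distrib mult.assoc del: of_nat_add)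
    have tm: "cmod (of_real (kap * D m) * mu z ^ m * B m) \<le> kap * (C5 * ((1 + \<sigma>) ^ l * C6)) * H * Z * q ^ (m div l)" for m
    proof -
      define n r where "n = m div l" and "r = m mod l"
      have r: "r < l" using l_pos by (simp add: r_def)
      have m: "m = l * n + r" by (simp add: n_def r_def)
      define x where "x = cmod z"
      have x: "x \<ge> 0" by (simp add: x_def)
      define v where "v = \<alpha> * y / sqrt \<theta>"
      have v: "v \<ge> 0" using \<alpha>_pos \<theta> by (simp add: v_def y_def)
      have v2: "v\<^sup>2 = 4 / 3 * (\<alpha> * y\<^sup>2)"
        using \<theta> \<alpha>_pos by (simp add: v_def power_divide power_mult_distrib \<theta>_def power2_eq_square)
      have vn: "v ^ n \<le> sqrt (fact n) * q ^ n * exp (5 / 6 * (\<alpha> * y\<^sup>2))"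
        using sqrt_exp_bound[OF v, of "5/4" n] by (simp add: v2 q_def)
      have muz: "cmod (mu z) ^ m = (\<sigma> * x) ^ r * (\<alpha> * y) ^ n"
      proof -
        have "cmod (mu z) = \<sigma> * x" using \<sigma> by (simp add: mu_def norm_mult \<sigma>_def x_def)
        moreover have "(\<sigma> * x) ^ l = \<alpha> * y" by (simp add: power_mult_distrib \<sigma>l y_def x_def)
        ultimately show ?thesis by (simp add: m power_add power_mult)
      qed
      have xr: "(\<sigma> * x) ^ r \<le> (1 + \<sigma>) ^ l * (C6 * exp (1 / 6 * (\<alpha> * y\<^sup>2)))"
      proof -
        have "(\<sigma> * x) ^ r \<le> ((1 + \<sigma>) * (1 + x)) ^ r"
          using x \<sigma> by (intro power_mono mult_mono) auto
        also have "\<dots> \<le> ((1 + \<sigma>) * (1 + x)) ^ l"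
          using x \<sigma> r mult_mono[of 1 "1 + \<sigma>" 1 "1 + x"] by (intro power_increasing) auto
        also have "\<dots> = (1 + \<sigma>) ^ l * (1 + x) ^ l" by (rule power_mult_distrib)
        also have "\<dots> \<le> (1 + \<sigma>) ^ l * (C6 * exp (1 / 6 * (\<alpha> * y\<^sup>2)))"
          using C6(2)[OF x] \<sigma> unfolding x_def y2 by (intro mult_left_mono) auto
        finally show ?thesis .
      qed
      have Dm: "\<bar>D m\<bar> \<le> 1 / fact n"
        using conv_coef_close[of m] by (simp add: D_def n_def)
      have yv: "(\<alpha> * y) ^ n * (1 / sqrt \<theta>) ^ n = v ^ n"
        by (simp add: v_def power_divide)
      have sf: "1 / fact n * sqrt (fact n) * (sqrt (fact n) :: real) = 1" by simp
      have "cmod (of_real (kap * D m) * mu z ^ m * B m) = kap * \<bar>D m\<bar> * ((\<sigma> * x) ^ r * (\<alpha> * y) ^ n) * cmod (B m)"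
        using kap by (simp add: norm_mult norm_power muz abs_mult)
      also have "\<dots> \<le> kap * (1 / fact n) * ((\<sigma> * x) ^ r * (\<alpha> * y) ^ n) * (C5 * H * (sqrt (fact n) * (1 / sqrt \<theta>) ^ n))"
        using kap Dm Bm[of m] \<sigma> x \<alpha>_pos unfolding n_def[symmetric]
        by (intro mult_mono mult_left_mono mult_nonneg_nonneg) (auto simp: y_def)
      also have "\<dots> = kap * (C5 * H) * (\<sigma> * x) ^ r * (1 / fact n * sqrt (fact n)) * v ^ n"
        unfolding yv[symmetric] by (simp only: mult_ac)
      also have "\<dots> \<le> kap * (C5 * H) * ((1 + \<sigma>) ^ l * (C6 * exp (1 / 6 * (\<alpha> * y\<^sup>2)))) * (1 / fact n * sqrt (fact n))
          * (sqrt (fact n) * q ^ n * exp (5 / 6 * (\<alpha> * y\<^sup>2)))"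
        using kap C5 H xr vn \<sigma> x v C6 by (intro mult_mono mult_left_mono mult_right_mono mult_nonneg_nonneg) auto
      also have "\<dots> = kap * (C5 * H) * ((1 + \<sigma>) ^ l * C6) * (1 / fact n * sqrt (fact n) * sqrt (fact n))
          * q ^ n * (exp (1 / 6 * (\<alpha> * y\<^sup>2)) * exp (5 / 6 * (\<alpha> * y\<^sup>2)))"
        by (simp only: mult_ac)
      also have "exp (1 / 6 * (\<alpha> * y\<^sup>2)) * exp (5 / 6 * (\<alpha> * y\<^sup>2)) = Z"
        unfolding Z_def exp_add[symmetric] by (simp add: field_simps)
      finally show ?thesis unfolding sf by (simp add: n_def mult_ac)
    qed
    have "cmod (small_hankel \<alpha> l b F z - of_real d * cnj (b \<zeta>)) \<le> C7 * H * Z"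
    proof -
      define c where "c = kap * (C5 * ((1 + \<sigma>) ^ l * C6)) * H * Z"
      have cs: "summable (\<lambda>m. c * q ^ (m div l))" by (intro summable_mult Qs)
      have "cmod (small_hankel \<alpha> l b F z - of_real d * cnj (b \<zeta>)) \<le> (\<Sum>m. c * q ^ (m div l))"
        unfolding sums_unique[OF S3] using tm unfolding c_def[symmetric] by (intro norm_suminf_le cs)
      also have "\<dots> = c * Q" unfolding Q_def by (rule suminf_mult[OF Qs])
      also have "\<dots> = C7 * H * Z" by (simp add: c_def C7_def)
      finally show ?thesis .
    qed
    moreover have "cmod (small_hankel \<alpha> l b F z) \<le> C1 * C8 * H * Z"
    proof -
      define e where "e = exp (\<alpha> * y\<^sup>2 / 2)"
      have e: "e > 0" "e * e = Z" "e * weight \<alpha> l z = 1"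
        using inverse_weight[of \<alpha> z l] by (simp_all add: e_def Z_def exp_add[symmetric] y2)
      have "cmod (small_hankel \<alpha> l b F z) = e * (cmod (small_hankel \<alpha> l b F z) * weight \<alpha> l z)"
        using e(3) by (metis mult.left_commute mult.right_neutral)
      also have "\<dots> \<le> e * (C1 * \<Lambda> z * (H * N F))"
        using point[OF F, of z] e by (intro mult_left_mono) auto
      also have "\<dots> \<le> e * (C1 * \<Lambda> z * (H * (C8 * e / \<Lambda> z)))"
        using C8(2)[of z] C1(1) H \<Lambda>_pos[of z] e unfolding F_def y2 e_def[symmetric]
        by (intro mult_left_mono mult_nonneg_nonneg) auto
      also have "\<dots> = C1 * C8 * H * (e * e)" using \<Lambda>_pos[of z] by simp
      finally show ?thesis by (simp add: e(2))
    qed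
    ultimately have "cmod (of_real d * cnj (b \<zeta>)) \<le> C1 * C8 * H * Z + C7 * H * Z"
      using norm_triangle_sub[of "of_real d * cnj (b \<zeta>)" "small_hankel \<alpha> l b F z"]
      by (simp add: norm_minus_commute)
    then have main: "d * cmod (b \<zeta>) \<le> (C1 * C8 + C7) * H * Z"
      using d by (simp add: norm_mult distrib_right)
    have "weight (\<alpha> / 2) l \<zeta> = exp (- (\<alpha> * y\<^sup>2))"
    proof -
      have "cmod \<zeta> ^ (2 * l) = (cmod dil ^ l)\<^sup>2 * cmod z ^ (2 * l)"
        by (simp add: \<zeta> norm_mult power_mult_distrib power_mult[symmetric] mult.commute)
      then show ?thesis unfolding dil_power_l y2 by (simp add: weight_def)
    qed
    then have wZ: "Z * weight (\<alpha> / 2) l \<zeta> = 1" by (simp add: Z_def exp_minus)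
    have "d * (cmod (b \<zeta>) * weight (\<alpha> / 2) l \<zeta>) \<le> (C1 * C8 + C7) * H * (Z * weight (\<alpha> / 2) l \<zeta>)"
      using mult_right_mono[OF main, of "weight (\<alpha> / 2) l \<zeta>"] by (simp add: mult.assoc)
    then show "cmod (b \<zeta>) * weight (\<alpha> / 2) l \<zeta> \<le> (C1 * C8 + C7) / d * H"
      unfolding wZ using d by (simp add: field_simps)
  qed
qed

text \<open>The norm is homogeneous only on \<open>X\<close>, and \<open>N f = 0\<close> does not formally exclude \<open>f \<noteq> 0\<close>; that case is
  covered by the boundedness of \<open>T\<close>.\<close>

lemma extension_operator_norm:
  assumes T: "hankel_extension \<alpha> l b X N T"
  shows "bdd_above ((\<lambda>f. conj_norm N (T f)) ` {f \<in> X. N f \<le> 1})"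
    and "0 \<le> operator_norm X N (conj_norm N) T"
    and "f \<in> X \<Longrightarrow> conj_norm N (T f) \<le> operator_norm X N (conj_norm N) T * N f"
proof -
  from T obtain B where TX: "\<And>f. f \<in> X \<Longrightarrow> T f \<in> conj_space X"
    and Ts: "\<And>c f. f \<in> X \<Longrightarrow> T (\<lambda>z. c * f z) = (\<lambda>z. c * T f z)"
    and TB: "\<And>f. f \<in> X \<Longrightarrow> conj_norm N (T f) \<le> B * N f"
    unfolding hankel_extension_def bounded_operator_def by blast
  show bdd: "bdd_above ((\<lambda>f. conj_norm N (T f)) ` {f \<in> X. N f \<le> 1})"
  proof (rule bdd_aboveI2)
    fix f assume "f \<in> {f \<in> X. N f \<le> 1}"
    then have f: "f \<in> X" "N f \<le> 1" by auto
    have "B * N f \<le> \<bar>B\<bar> * 1" using f N_nonneg[of f] by (intro mult_mono) auto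
    with TB[OF f(1)] show "conj_norm N (T f) \<le> \<bar>B\<bar>" by simp
  qed
  have up: "conj_norm N (T f) \<le> operator_norm X N (conj_norm N) T" if "f \<in> X" "N f \<le> 1" for f
    unfolding operator_norm_def by (rule cSUP_upper[OF _ bdd]) (use that in auto)
  have z: "(\<lambda>_. 0) \<in> X" "N (\<lambda>_. 0) = 0"
  proof -
    have o: "(\<lambda>w. w ^ 0) \<in> X" using E_space_monomial[of 0] E_sub by blast
    show "(\<lambda>_. 0) \<in> X" using X_scale[OF o, of 0] by simp
    show "N (\<lambda>_. 0) = 0" using N_scale[OF o, of 0] by simp
  qed
  show nn: "0 \<le> operator_norm X N (conj_norm N) T"
    using up[OF z(1)] z(2) N_nonneg[of "\<lambda>z. cnj (T (\<lambda>_. 0) z)"] by (simp add: conj_norm_def)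
  show "conj_norm N (T f) \<le> operator_norm X N (conj_norm N) T * N f" if f: "f \<in> X"
  proof (cases "N f = 0")
    case True
    then show ?thesis using TB[OF f] by simp
  next
    case False
    then have p: "N f > 0" using N_nonneg[of f] by simp
    define c where "c = complex_of_real (1 / N f)"
    have c: "cmod c = 1 / N f" using p by (simp add: c_def norm_divide)
    have "N (\<lambda>z. c * f z) \<le> 1" using N_scale[OF f, of c] c p by simp
    then have "conj_norm N (T (\<lambda>z. c * f z)) \<le> operator_norm X N (conj_norm N) T"
      by (rule up[OF X_scale[OF f]])
    moreover have "conj_norm N (T (\<lambda>z. c * f z)) = 1 / N f * conj_norm N (T f)"
      using N_scale[of "\<lambda>z. cnj (T f z)" "cnj c"] TX[OF f] c
      by (simp add: Ts[OF f] conj_norm_def conj_space_iff)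
    ultimately show ?thesis using p by (simp add: field_simps)
  qed
qed

theorem hankel_characterisation:
  "(\<forall>b\<in>H_space \<alpha> l. hankel_bounded \<alpha> l b X N \<longleftrightarrow> b \<in> Finf (\<alpha> / 2) l) \<and>
   (\<exists>C>0. \<forall>b\<in>H_space \<alpha> l. \<forall>T. hankel_extension \<alpha> l b X N T \<longrightarrow>
        inverse C * Linf_norm (\<alpha> / 2) l b \<le> operator_norm X N (conj_norm N) T \<and>
        operator_norm X N (conj_norm N) T \<le> C * Linf_norm (\<alpha> / 2) l b)"
proof -
  obtain C1 where C1: "C1 > 0" "\<And>b H \<zeta>. b \<in> H_space \<alpha> l \<Longrightarrow> H \<ge> 0 \<Longrightarrow>
     (\<And>f. f \<in> E_space l \<Longrightarrow> small_hankel \<alpha> l b f \<in> conj_space X \<and> conj_norm N (small_hankel \<alpha> l b f) \<le> H * N f) \<Longrightarrow>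
     cmod (b \<zeta>) * weight (\<alpha> / 2) l \<zeta> \<le> C1 * H"
    by (rule hankel_lower) blast
  obtain C2 where C2: "C2 > 0" "\<And>b T f. b \<in> H_space \<alpha> l \<Longrightarrow> b \<in> Finf (\<alpha> / 2) l \<Longrightarrow> hankel_extension \<alpha> l b X N T \<Longrightarrow>
     f \<in> X \<Longrightarrow> conj_norm N (T f) \<le> C2 * Linf_norm (\<alpha> / 2) l b * N f"
    by (rule hankel_upper) blast
  have lower: "b \<in> Finf (\<alpha> / 2) l" "Linf_norm (\<alpha> / 2) l b \<le> C1 * operator_norm X N (conj_norm N) T"
    if b: "b \<in> H_space \<alpha> l" and T: "hankel_extension \<alpha> l b X N T" for b T
  proof -
    have E: "small_hankel \<alpha> l b f \<in> conj_space X \<and>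
        conj_norm N (small_hankel \<alpha> l b f) \<le> operator_norm X N (conj_norm N) T * N f" if "f \<in> E_space l" for f
    proof -
      have fX: "f \<in> X" using that E_sub by blast
      have "T f = small_hankel \<alpha> l b f" "T f \<in> conj_space X"
        using T that fX unfolding hankel_extension_def bounded_operator_def by auto
      then show ?thesis using extension_operator_norm(3)[OF T fX] by simp
    qed
    have "cmod (b \<zeta>) * weight (\<alpha> / 2) l \<zeta> \<le> C1 * operator_norm X N (conj_norm N) T" for \<zeta>
      by (rule C1(2)[OF b extension_operator_norm(2)[OF T] E])
    from Linf_norm_le[OF H_space_entire[OF b] this]
    show "b \<in> Finf (\<alpha> / 2) l" "Linf_norm (\<alpha> / 2) l b \<le> C1 * operator_norm X N (conj_norm N) T" .
  qed
  have upper: "operator_norm X N (conj_norm N) T \<le> C2 * Linf_norm (\<alpha> / 2) l b"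
    if b: "b \<in> H_space \<alpha> l" and T: "hankel_extension \<alpha> l b X N T" for b T
    unfolding operator_norm_def
  proof (rule cSUP_least)
    have o: "(\<lambda>w. w ^ 0) \<in> X" using E_space_monomial[of 0] E_sub by blast
    show "{f \<in> X. N f \<le> 1} \<noteq> {}"
      using X_scale[OF o, of 0] N_scale[OF o, of 0] by (auto intro!: exI[of _ "\<lambda>_. 0"])
    fix f assume "f \<in> {f \<in> X. N f \<le> 1}"
    then have f: "f \<in> X" "N f \<le> 1" by auto
    have "conj_norm N (T f) \<le> C2 * Linf_norm (\<alpha> / 2) l b * N f"
      by (rule C2(2)[OF b lower(1)[OF b T] T f(1)])
    also have "\<dots> \<le> C2 * Linf_norm (\<alpha> / 2) l b * 1"
      using f C2(1) Linf_norm_nonneg by (intro mult_left_mono) auto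
    finally show "conj_norm N (T f) \<le> C2 * Linf_norm (\<alpha> / 2) l b" by simp
  qed
  define C where "C = max C1 C2"
  have C: "C > 0" "C1 \<le> C" "C2 \<le> C" using C1(1) by (auto simp: C_def)
  have "inverse C * Linf_norm (\<alpha> / 2) l b \<le> operator_norm X N (conj_norm N) T \<and>
        operator_norm X N (conj_norm N) T \<le> C * Linf_norm (\<alpha> / 2) l b"
    if b: "b \<in> H_space \<alpha> l" and T: "hankel_extension \<alpha> l b X N T" for b T
  proof
    have "Linf_norm (\<alpha> / 2) l b \<le> C * operator_norm X N (conj_norm N) T"
      using lower(2)[OF b T] mult_right_mono[OF C(2) extension_operator_norm(2)[OF T]] by linarith
    then show "inverse C * Linf_norm (\<alpha> / 2) l b \<le> operator_norm X N (conj_norm N) T"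
      using C(1) by (simp add: field_simps)
    show "operator_norm X N (conj_norm N) T \<le> C * Linf_norm (\<alpha> / 2) l b"
      using upper[OF b T] mult_right_mono[OF C(3) Linf_norm_nonneg] order_trans by blast
  qed
  moreover have "hankel_bounded \<alpha> l b X N \<longleftrightarrow> b \<in> Finf (\<alpha> / 2) l" if b: "b \<in> H_space \<alpha> l" for b
    using lower(1)[OF b] hankel_extension_exists[OF b] unfolding hankel_bounded_def by blast
  ultimately show ?thesis using C(1) by blast
qed

end

section \<open>The weighted kernel\<close>

context fock_params begin

definition wker :: "complex \<Rightarrow> complex \<Rightarrow> real" where
  "wker z w = cmod (bergman_kernel \<alpha> l z w) * weight \<alpha> l z * weight \<alpha> l w"

lemma wker_nonneg: "0 \<le> wker z w"
  by (simp add: wker_def)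

lemma wker_commute: "wker z w = wker w z"
proof -
  have "cmod (bergman_kernel \<alpha> l z w) = cmod (bergman_kernel \<alpha> l w z)"
    by (metis bergman_kernel_cnj complex_mod_cnj)
  then show ?thesis by (simp add: wker_def)
qed

lemma measurable_kernel [measurable]:
  "(\<lambda>p. bergman_kernel \<alpha> l (fst p) (snd p)) \<in> borel_measurable (borel \<Otimes>\<^sub>M borel)"
proof -
  have "(\<lambda>p. bergman_kernel \<alpha> l (fst p) (snd p)) = (\<lambda>p. \<Sum>m. of_real (kcoef \<alpha> l m) * (fst p * cnj (snd p)) ^ m)"
    using bergman_kernel_sums by (auto simp: sums_iff)
  also have "\<dots> \<in> borel_measurable (borel \<Otimes>\<^sub>M borel)"
    by measurable
  finally show ?thesis .
qed

lemma measurable_wker [measurable]: "(\<lambda>p. wker (fst p) (snd p)) \<in> borel_measurable (borel \<Otimes>\<^sub>M borel)"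
  unfolding wker_def by measurable

lemma measurable_wker2 [measurable]: "wker z \<in> borel_measurable borel"
  unfolding wker_def by measurable

lemma wker_row:
  obtains A where "A > 0" "\<And>z. (\<integral>\<^sup>+w. ennreal (wker z w) \<partial>lborel) \<le> ennreal A"
proof -
  obtain A where A: "A > 0"
    "\<And>z. (\<integral>\<^sup>+w. ennreal (cmod (bergman_kernel \<alpha> l w z) * weight \<alpha> l w) \<partial>lborel) \<le> ennreal (A * exp (\<alpha> * cmod z ^ (2 * l) / 2))"
    by (rule kernel_row_integral) blast
  have "(\<integral>\<^sup>+w. ennreal (wker z w) \<partial>lborel) \<le> ennreal A" for z
  proof -
    have "(\<integral>\<^sup>+w. ennreal (wker z w) \<partial>lborel)
       = (\<integral>\<^sup>+w. ennreal (weight \<alpha> l z) * ennreal (cmod (bergman_kernel \<alpha> l w z) * weight \<alpha> l w) \<partial>lborel)"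
    proof (rule nn_integral_cong)
      fix w
      have "wker z w = weight \<alpha> l z * (cmod (bergman_kernel \<alpha> l w z) * weight \<alpha> l w)"
        unfolding wker_commute[of z] by (simp add: wker_def)
      then show "ennreal (wker z w) = ennreal (weight \<alpha> l z) * ennreal (cmod (bergman_kernel \<alpha> l w z) * weight \<alpha> l w)"
        by (simp add: ennreal_mult)
    qed
    also have "\<dots> = ennreal (weight \<alpha> l z) * (\<integral>\<^sup>+w. ennreal (cmod (bergman_kernel \<alpha> l w z) * weight \<alpha> l w) \<partial>lborel)"
      by (rule nn_integral_cmult) measurable
    also have "\<dots> \<le> ennreal (weight \<alpha> l z) * ennreal (A * exp (\<alpha> * cmod z ^ (2 * l) / 2))"
      by (intro mult_left_mono A) auto
    also have "\<dots> = ennreal (A * (exp (\<alpha> * cmod z ^ (2 * l) / 2) * weight \<alpha> l z))"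
      using A(1) by (subst ennreal_mult[symmetric]) (auto simp: mult_ac)
    finally show ?thesis unfolding inverse_weight by simp
  qed
  with A(1) show thesis by (rule that)
qed

text \<open>Far from \<open>|w| = |z|\<close> the Gaussian factors beat the growth of the kernel.\<close>

lemma wker_sup:
  obtains C where "C > 0" "\<And>z w. wker z w \<le> C * (1 + cmod z) ^ (2 * l - 2)"
proof -
  obtain C where C: "C > 0" "\<And>x. x \<ge> 0 \<Longrightarrow> kser \<alpha> l x \<le> C * (1 + x) ^ (l - 1) * exp (\<alpha> * x ^ l)"
    using kser_bound by metis
  obtain D where D: "D > 0" "\<And>x. x \<ge> 0 \<Longrightarrow> (1 + x) ^ (2 * l - 2) * exp (0 * x ^ l) \<le> D * exp (\<alpha> / 8 * x ^ (2 * l))"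
    using poly_exp_bound[of "\<alpha> / 8" "2 * l - 2" 0] \<alpha>_pos by (metis divide_pos_pos zero_less_numeral)
  have e2: "2 * (l - 1) = 2 * l - 2" by simp
  show thesis
  proof (rule that[of "C * (2 ^ (l - 1) + D)"])
    show "C * (2 ^ (l - 1) + D) > 0" using C D by (simp add: add_pos_pos)
    fix z w
    define x t where "x = cmod z" and "t = cmod w"
    have x: "x \<ge> 0" "t \<ge> 0" by (auto simp: x_def t_def)
    have base: "wker z w \<le> C * (1 + x * t) ^ (l - 1) * exp (- (\<alpha> * (t ^ l - x ^ l)\<^sup>2 / 2))"
    proof -
      have "wker z w \<le> (C * (1 + x * t) ^ (l - 1) * exp (\<alpha> * (x * t) ^ l)) * weight \<alpha> l z * weight \<alpha> l w"
        unfolding wker_def x_def t_def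
        by (intro mult_right_mono order_trans[OF norm_bergman_kernel_le] C(2)) auto
      also have "\<dots> = C * (1 + x * t) ^ (l - 1) * (exp (\<alpha> * (x * t) ^ l) * weight \<alpha> l z * weight \<alpha> l w)"
        by (simp only: mult_ac)
      also have "exp (\<alpha> * (x * t) ^ l) * weight \<alpha> l z * weight \<alpha> l w = exp (- (\<alpha> * (t ^ l - x ^ l)\<^sup>2 / 2))"
      proof -
        have "x ^ (2 * l) = x ^ l * x ^ l" "t ^ (2 * l) = t ^ l * t ^ l" by (simp_all add: mult_2 power_add)
        then show ?thesis
          unfolding weight_def x_def[symmetric] t_def[symmetric] exp_add[symmetric]
          by (simp add: power_mult_distrib power2_eq_square algebra_simps add_divide_distrib diff_divide_distrib)
      qed
      finally show ?thesis .
    qed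
    have p1: "1 \<le> (1 + x) ^ (2 * l - 2)" using x by (intro one_le_power) auto
    show "wker z w \<le> C * (2 ^ (l - 1) + D) * (1 + cmod z) ^ (2 * l - 2)"
    proof (cases "t \<le> 2 * x")
      case True
      have "1 + x * t \<le> 2 * (1 + x)\<^sup>2"
        using mult_left_mono[OF True x(1)] x by (simp add: power2_eq_square algebra_simps)
      then have "(1 + x * t) ^ (l - 1) \<le> (2 * (1 + x)\<^sup>2) ^ (l - 1)" using x by (intro power_mono) auto
      also have "\<dots> = 2 ^ (l - 1) * (1 + x) ^ (2 * l - 2)"
        by (simp only: power_mult_distrib power_mult[symmetric] e2)
      finally have p: "(1 + x * t) ^ (l - 1) \<le> 2 ^ (l - 1) * (1 + x) ^ (2 * l - 2)" .
      have "wker z w \<le> C * (1 + x * t) ^ (l - 1) * exp (- (\<alpha> * (t ^ l - x ^ l)\<^sup>2 / 2))" by (rule base)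
      also have "\<dots> \<le> C * (1 + x * t) ^ (l - 1) * 1"
        using C(1) x \<alpha>_pos by (intro mult_left_mono) auto
      also have "\<dots> \<le> C * (2 ^ (l - 1) * (1 + x) ^ (2 * l - 2))"
        using C(1) p by simp
      also have "\<dots> \<le> C * (2 ^ (l - 1) + D) * (1 + x) ^ (2 * l - 2)"
        using C(1) D(1) p1 by (simp add: distrib_left distrib_right)
      finally show ?thesis by (simp add: x_def)
    next
      case False
      have "1 + x * t \<le> (1 + t)\<^sup>2"
      proof -
        have "x * t \<le> t * t" using False x by (intro mult_right_mono) auto
        then show ?thesis using x by (simp add: power2_eq_square algebra_simps)
      qed
      then have "(1 + x * t) ^ (l - 1) \<le> ((1 + t)\<^sup>2) ^ (l - 1)" using x by (intro power_mono) auto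
      also have "\<dots> = (1 + t) ^ (2 * l - 2)" by (simp only: power_mult[symmetric] e2)
      also have "\<dots> \<le> D * exp (\<alpha> / 8 * t ^ (2 * l))" using D(2)[OF x(2)] by simp
      finally have p: "(1 + x * t) ^ (l - 1) \<le> D * exp (\<alpha> / 8 * t ^ (2 * l))" .
      have g: "t ^ l / 2 \<le> t ^ l - x ^ l"
      proof -
        have "(2 * x) ^ l \<le> t ^ l" using False x by (intro power_mono) auto
        then have "2 ^ l * x ^ l \<le> t ^ l" by (simp add: power_mult_distrib)
        moreover have "2 * x ^ l \<le> 2 ^ l * x ^ l"
          using self_le_power[of "2::real" l] l_pos x by (intro mult_right_mono) auto
        ultimately show ?thesis by simp
      qed
      have "(t ^ l / 2)\<^sup>2 \<le> (t ^ l - x ^ l)\<^sup>2" using g x by (intro power_mono) auto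
      then have "\<alpha> * (t ^ l / 2)\<^sup>2 \<le> \<alpha> * (t ^ l - x ^ l)\<^sup>2" using \<alpha>_pos by (intro mult_left_mono) auto
      moreover have "\<alpha> * (t ^ l / 2)\<^sup>2 = 2 * (\<alpha> / 8 * t ^ (2 * l))"
        by (simp add: power_divide power_mult[symmetric] mult.commute)
      ultimately have ex: "exp (- (\<alpha> * (t ^ l - x ^ l)\<^sup>2 / 2)) \<le> exp (- (\<alpha> / 8 * t ^ (2 * l)))" by simp
      have "wker z w \<le> C * (1 + x * t) ^ (l - 1) * exp (- (\<alpha> * (t ^ l - x ^ l)\<^sup>2 / 2))" by (rule base)
      also have "\<dots> \<le> C * (D * exp (\<alpha> / 8 * t ^ (2 * l))) * exp (- (\<alpha> / 8 * t ^ (2 * l)))"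
        using C(1) D(1) p x ex by (intro mult_mono mult_left_mono) auto
      also have "\<dots> = C * D" by (simp add: exp_minus)
      also have "\<dots> \<le> C * (2 ^ (l - 1) + D) * (1 + x) ^ (2 * l - 2)"
      proof -
        have "C * D * 1 \<le> C * (2 ^ (l - 1) + D) * (1 + x) ^ (2 * l - 2)"
          using C(1) D(1) p1 by (intro mult_mono mult_left_mono) auto
        then show ?thesis by simp
      qed
      finally show ?thesis by (simp add: x_def)
    qed
  qed
qed

lemma proj_weighted_le:
  assumes "tame g"
  shows "ennreal (cmod (proj g z) * weight \<alpha> l z) \<le> (\<integral>\<^sup>+w. ennreal (wker z w * (cmod (g w) * weight \<alpha> l w)) \<partial>lborel)"
proof -
  have [measurable]: "g \<in> borel_measurable borel" using assms by (rule tame_measurable)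
  have "ennreal (cmod (proj g z) * weight \<alpha> l z) = ennreal (weight \<alpha> l z) * ennreal (cmod (proj g z))"
    by (simp add: ennreal_mult mult.commute)
  also have "\<dots> \<le> ennreal (weight \<alpha> l z) * (\<integral>\<^sup>+w. ennreal (cmod (bergman_kernel \<alpha> l z w * (g w * of_real (gauss \<alpha> l w)))) \<partial>lborel)"
    unfolding proj_def by (intro mult_left_mono integral_norm_bound_ennreal proj_integrable assms) simp
  also have "\<dots> = (\<integral>\<^sup>+w. ennreal (weight \<alpha> l z) * ennreal (cmod (bergman_kernel \<alpha> l z w * (g w * of_real (gauss \<alpha> l w)))) \<partial>lborel)"
    by (rule nn_integral_cmult[symmetric]) measurable
  also have "\<dots> = (\<integral>\<^sup>+w. ennreal (wker z w * (cmod (g w) * weight \<alpha> l w)) \<partial>lborel)"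
  proof (rule nn_integral_cong)
    fix w
    have "weight \<alpha> l z * cmod (bergman_kernel \<alpha> l z w * (g w * of_real (gauss \<alpha> l w))) = wker z w * (cmod (g w) * weight \<alpha> l w)"
      unfolding weight_square[symmetric] by (simp add: wker_def norm_mult mult_ac)
    then show "ennreal (weight \<alpha> l z) * ennreal (cmod (bergman_kernel \<alpha> l z w * (g w * of_real (gauss \<alpha> l w))))
        = ennreal (wker z w * (cmod (g w) * weight \<alpha> l w))"
      by (simp add: ennreal_mult[symmetric])
  qed
  finally show ?thesis .
qed

lemma proj_weighted_sup:
  assumes A: "A > 0" "\<And>z. (\<integral>\<^sup>+w. ennreal (wker z w) \<partial>lborel) \<le> ennreal A"
    and "tame g" and B: "B \<ge> 0" "\<And>w. cmod (g w) * weight \<alpha> l w \<le> B"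
  shows "cmod (proj g z) * weight \<alpha> l z \<le> A * B"
proof -
  have "ennreal (cmod (proj g z) * weight \<alpha> l z) \<le> (\<integral>\<^sup>+w. ennreal (wker z w * (cmod (g w) * weight \<alpha> l w)) \<partial>lborel)"
    by (rule proj_weighted_le) fact
  also have "\<dots> \<le> (\<integral>\<^sup>+w. ennreal (wker z w) * ennreal B \<partial>lborel)"
    using B wker_nonneg by (intro nn_integral_mono) (simp add: ennreal_mult[symmetric] mult_left_mono ennreal_leI)
  also have "\<dots> = (\<integral>\<^sup>+w. ennreal (wker z w) \<partial>lborel) * ennreal B"
    by (rule nn_integral_multc) measurable
  also have "\<dots> \<le> ennreal A * ennreal B" by (intro mult_right_mono A) auto
  also have "\<dots> = ennreal (A * B)" using A B by (simp add: ennreal_mult)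
  finally show ?thesis using A B by (subst (asm) ennreal_le_iff) auto
qed

text \<open>Completing the square: the weighted test function is largest at the \<open>l\<close> points with \<open>w\<^sup>l = z\<^sup>l\<close>.\<close>

lemma exp_weight:
  "cmod (exp (of_real \<alpha> * cnj z ^ l * w ^ l)) * weight \<alpha> l w
    = exp (\<alpha> * cmod z ^ (2 * l) / 2) * exp (- (\<alpha> / 2 * (cmod (w ^ l - z ^ l))\<^sup>2))"
proof -
  have "(cmod (a - b))\<^sup>2 = (cmod a)\<^sup>2 + (cmod b)\<^sup>2 - 2 * Re (cnj b * a)" for a b :: complex
    unfolding cmod_power2 by (simp add: power2_eq_square algebra_simps)
  from this[of "w ^ l" "z ^ l"]
  have D: "(cmod (w ^ l - z ^ l))\<^sup>2 = (cmod (w ^ l))\<^sup>2 + (cmod (z ^ l))\<^sup>2 - 2 * Re (cnj (z ^ l) * w ^ l)" .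
  have S: "(cmod (w ^ l))\<^sup>2 = cmod w ^ (2 * l)" "(cmod (z ^ l))\<^sup>2 = cmod z ^ (2 * l)"
    by (simp_all add: norm_power power_mult[symmetric] mult.commute)
  have "\<alpha> * R + - (\<alpha> * a / 2) = \<alpha> * b / 2 + - (\<alpha> / 2 * (a + b - 2 * R))" for a b R :: real
    by (simp add: algebra_simps)
  then have "\<alpha> * Re (cnj (z ^ l) * w ^ l) + - (\<alpha> * cmod w ^ (2 * l) / 2)
     = \<alpha> * cmod z ^ (2 * l) / 2 + - (\<alpha> / 2 * (cmod (w ^ l - z ^ l))\<^sup>2)"
    unfolding D S .
  moreover have "Re (of_real \<alpha> * cnj z ^ l * w ^ l) = \<alpha> * Re (cnj (z ^ l) * w ^ l)"
    by (simp add: mult.assoc)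
  ultimately show ?thesis
    unfolding norm_exp_eq_Re weight_def exp_add[symmetric] by simp
qed

lemma E_space_decay:
  assumes "f \<in> E_space l"
  obtains M where "M \<ge> 0" "\<And>w. cmod (f w) * weight \<alpha> l w \<le> M * gauss (\<alpha> / 16) l w"
proof -
  obtain C \<beta> where C: "C > 0" "\<beta> > 0" "\<And>w. cmod (f w) \<le> C * exp (\<beta> * cmod w ^ l)"
    using E_space_bound[OF assms] by metis
  obtain D where D: "D > 0" "\<And>x. x \<ge> 0 \<Longrightarrow> (1 + x) ^ 0 * exp (\<beta> * x ^ l) \<le> D * exp (7 / 16 * \<alpha> * x ^ (2 * l))"
    using poly_exp_bound[of "7 / 16 * \<alpha>" 0 \<beta>] \<alpha>_pos by (metis mult_pos_pos divide_pos_pos zero_less_numeral)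
  have "cmod (f w) * weight \<alpha> l w \<le> (C * D) * gauss (\<alpha> / 16) l w" for w
  proof -
    define X where "X = cmod w ^ (2 * l)"
    have "exp (\<beta> * cmod w ^ l) \<le> D * exp (7 / 16 * \<alpha> * X)" using D(2)[of "cmod w"] by (simp add: X_def)
    from order_trans[OF C(3) mult_left_mono[OF this less_imp_le[OF C(1)]]]
    have "cmod (f w) \<le> C * (D * exp (7 / 16 * \<alpha> * X))" .
    then have "cmod (f w) * weight \<alpha> l w \<le> C * (D * exp (7 / 16 * \<alpha> * X)) * weight \<alpha> l w"
      by (rule mult_right_mono) simp
    also have "\<dots> = C * D * (exp (7 / 16 * \<alpha> * X) * exp (- (\<alpha> * X / 2)))"
      by (simp add: weight_def X_def)
    also have "exp (7 / 16 * \<alpha> * X) * exp (- (\<alpha> * X / 2)) = gauss (\<alpha> / 16) l w"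
      unfolding exp_add[symmetric] gauss_def X_def[symmetric] by (simp add: field_simps)
    finally show ?thesis .
  qed
  then show thesis using C D by (intro that[of "C * D"]) auto
qed

lemma gauss_le_1: "\<gamma> \<ge> 0 \<Longrightarrow> gauss \<gamma> l w \<le> 1"
  by (simp add: gauss_def)

end

section \<open>The little Fock space\<close>

lemma tendsto_zero_dominated:
  fixes f g :: "'a \<Rightarrow> real"
  assumes "(g \<longlongrightarrow> 0) F" "\<And>x. 0 \<le> f x" "\<And>x. f x \<le> g x"
  shows "(f \<longlongrightarrow> 0) F"
  by (rule tendsto_sandwich[OF _ _ tendsto_const assms(1)]) (use assms in auto)

lemma Linf_norm_scale:
  assumes "f \<in> Finf \<gamma> l"
  shows "Linf_norm \<gamma> l (\<lambda>z. c * f z) = cmod c * Linf_norm \<gamma> l f"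
proof -
  have le: "(\<lambda>z. c * g z) \<in> Finf \<gamma> l \<and> Linf_norm \<gamma> l (\<lambda>z. c * g z) \<le> cmod c * Linf_norm \<gamma> l g"
    if g: "g \<in> Finf \<gamma> l" for c g
  proof -
    have "(\<lambda>z. c * g z) \<in> entire" using g by (auto simp: Finf_def entire_def intro!: holomorphic_intros)
    moreover have "cmod (c * g z) * weight \<gamma> l z \<le> cmod c * Linf_norm \<gamma> l g" for z
      using mult_left_mono[OF Linf_norm_bound[OF g, of z], of "cmod c"] by (simp add: norm_mult mult.assoc)
    ultimately show ?thesis using Linf_norm_le by blast
  qed
  show ?thesis
  proof (cases "c = 0")
    case True
    then show ?thesis using le[OF assms, of 0] Linf_norm_nonneg[of \<gamma> l "\<lambda>z. 0"] by simp
  next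
    case False
    have "Linf_norm \<gamma> l f \<le> cmod (1 / c) * Linf_norm \<gamma> l (\<lambda>z. c * f z)"
      using le[of "\<lambda>z. c * f z" "1 / c"] le[OF assms, of c] False by simp
    then have "cmod c * Linf_norm \<gamma> l f \<le> Linf_norm \<gamma> l (\<lambda>z. c * f z)"
      using False by (simp add: norm_divide field_simps)
    with le[OF assms, of c] show ?thesis by simp
  qed
qed

lemma little_Fock_Finf:
  assumes "f \<in> little_Fock \<gamma> l" shows "f \<in> Finf \<gamma> l"
proof -
  define g where "g z = cmod (f z) * weight \<gamma> l z" for z
  have fe: "f \<in> entire" and lim: "(g \<longlongrightarrow> 0) at_infinity"
    using assms by (auto simp: little_Fock_def g_def[abs_def])
  have cg: "continuous_on UNIV g"
    unfolding g_def weight_def by (intro continuous_intros entire_continuous fe) auto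
  have "eventually (\<lambda>z. g z < 1) at_infinity" using lim by (rule order_tendstoD) simp
  then obtain R where R: "\<And>z. R \<le> cmod z \<Longrightarrow> g z < 1" by (auto simp: eventually_at_infinity)
  have "bounded (g ` cball 0 R)"
    by (intro compact_imp_bounded compact_continuous_image continuous_on_subset[OF cg]) auto
  then obtain B where "\<forall>z\<in>cball 0 R. \<bar>g z\<bar> \<le> B" by (auto simp: bounded_iff)
  then have B': "\<And>z. cmod z \<le> R \<Longrightarrow> \<bar>g z\<bar> \<le> B" by simp
  have B: "g z \<le> \<bar>B\<bar> + 1" if "cmod z \<le> R" for z
    using B'[OF that] by linarith
  have "g z \<le> \<bar>B\<bar> + 1" for z
    using R[of z] B[of z] by (cases "R \<le> cmod z") auto
  then show ?thesis using Linf_norm_le(1)[OF fe] unfolding g_def by blast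
qed

context fock_params begin

lemma Finf_tame:
  assumes "f \<in> Finf \<alpha> l" shows "tame f"
proof (rule tame_growth[where \<delta>="\<alpha> / 2" and C="Linf_norm \<alpha> l f" and k=0])
  have "f \<in> entire" using assms by (simp add: Finf_def)
  then show "f \<in> borel_measurable borel" by (rule entire_measurable)
  fix w
  have "cmod (f w) = cmod (f w) * weight \<alpha> l w * exp (\<alpha> * cmod w ^ (2 * l) / 2)"
    using inverse_weight[of \<alpha> w l] by (simp add: mult.assoc mult.commute[of "weight _ _ _"])
  also have "\<dots> \<le> Linf_norm \<alpha> l f * exp (\<alpha> * cmod w ^ (2 * l) / 2)"
    by (intro mult_right_mono Linf_norm_bound assms) simp
  finally show "cmod (f w) \<le> Linf_norm \<alpha> l f * (1 + cmod w) ^ 0 * exp (\<alpha> / 2 * cmod w ^ (2 * l))" by simp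
qed (use \<alpha>_pos in simp)

lemma E_space_little_Fock:
  assumes "f \<in> E_space l" shows "f \<in> little_Fock \<alpha> l"
proof -
  obtain M where M: "M \<ge> 0" "\<And>w. cmod (f w) * weight \<alpha> l w \<le> M * gauss (\<alpha> / 16) l w"
    using E_space_decay[OF assms] by metis
  have "filterlim (\<lambda>w::complex. cmod w ^ (2 * l)) at_top at_infinity"
    using l_pos by (intro filterlim_pow_at_top filterlim_at_infinity_imp_norm_at_top filterlim_ident) auto
  then have "filterlim (\<lambda>w::complex. \<alpha> / 16 * cmod w ^ (2 * l)) at_top at_infinity"
    using \<alpha>_pos by (intro filterlim_tendsto_pos_mult_at_top[OF tendsto_const]) auto
  then have "((\<lambda>w. exp (- (\<alpha> / 16 * cmod w ^ (2 * l)))) \<longlongrightarrow> 0) (at_infinity :: complex filter)"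
    by (intro filterlim_compose[OF exp_at_bot] filterlim_uminus_at_bot[THEN iffD2]) auto
  then have "((\<lambda>w. M * gauss (\<alpha> / 16) l w) \<longlongrightarrow> M * 0) at_infinity"
    unfolding gauss_def by (intro tendsto_mult tendsto_const)
  then have "((\<lambda>w. cmod (f w) * weight \<alpha> l w) \<longlongrightarrow> 0) at_infinity"
    by (intro tendsto_zero_dominated[OF _ _ M(2)]) auto
  then show ?thesis using assms by (simp add: little_Fock_def E_space_def)
qed

lemma little_Fock_tail:
  assumes "f \<in> little_Fock \<alpha> l" "\<epsilon> > 0"
  obtains R where "\<And>w. \<not> cmod w \<le> R \<Longrightarrow> cmod (f w) * weight \<alpha> l w \<le> \<epsilon>"
proof -
  have "((\<lambda>z. cmod (f z) * weight \<alpha> l z) \<longlongrightarrow> 0) at_infinity"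
    using assms by (simp add: little_Fock_def)
  then have "eventually (\<lambda>z. cmod (f z) * weight \<alpha> l z < \<epsilon>) at_infinity"
    by (rule order_tendstoD) (use assms in simp)
  then obtain R where "\<And>z. R \<le> cmod z \<Longrightarrow> cmod (f z) * weight \<alpha> l z < \<epsilon>"
    by (auto simp: eventually_at_infinity)
  then show thesis by (intro that[of R]) (simp add: less_imp_le)
qed

text \<open>For the decay at infinity, split \<open>g\<close> at a large radius: the inner part projects into \<open>E\<close>, and the outer part
  has small weighted supremum.\<close>

lemma little_Fock_proj:
  assumes A: "A > 0" "\<And>z. (\<integral>\<^sup>+w. ennreal (wker z w) \<partial>lborel) \<le> ennreal A"
    and f: "f \<in> little_Fock \<alpha> l" and M: "M \<ge> 0" and [measurable]: "g \<in> borel_measurable borel"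
    and g: "\<And>w. cmod (g w) \<le> M * cmod (f w)"
  shows "proj g \<in> little_Fock \<alpha> l" "Linf_norm \<alpha> l (proj g) \<le> A * M * Linf_norm \<alpha> l f"
proof -
  note fF = little_Fock_Finf[OF f]
  have tg: "tame g" by (rule tame_bounded[OF Finf_tame[OF fF] _ g]) simp
  have gw: "cmod (g w) * weight \<alpha> l w \<le> M * (cmod (f w) * weight \<alpha> l w)" for w
    using mult_right_mono[OF g[of w], of "weight \<alpha> l w"] by simp
  have gb: "cmod (g w) * weight \<alpha> l w \<le> M * Linf_norm \<alpha> l f" for w
    using order_trans[OF gw mult_left_mono[OF Linf_norm_bound[OF fF] M]] .
  have "cmod (proj g z) * weight \<alpha> l z \<le> A * (M * Linf_norm \<alpha> l f)" for z
    by (rule proj_weighted_sup[OF A tg _ gb]) (use M Linf_norm_nonneg in simp)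
  from Linf_norm_le(2)[OF proj_entire[OF tg] this]
  show "Linf_norm \<alpha> l (proj g) \<le> A * M * Linf_norm \<alpha> l f" by (simp add: mult.assoc)
  have "((\<lambda>z. cmod (proj g z) * weight \<alpha> l z) \<longlongrightarrow> 0) at_infinity"
  proof (rule tendstoI)
    fix e :: real assume e: "e > 0"
    define \<epsilon> where "\<epsilon> = e / (4 * A * (M + 1))"
    have \<epsilon>: "\<epsilon> > 0" using e A M by (simp add: \<epsilon>_def)
    obtain R where R: "\<And>w. \<not> cmod w \<le> R \<Longrightarrow> cmod (f w) * weight \<alpha> l w \<le> \<epsilon>"
      using little_Fock_tail[OF f \<epsilon>] by metis
    define g1 g2 where "g1 = (\<lambda>w. if cmod w \<le> R then g w else 0)"
      and "g2 = (\<lambda>w. if cmod w \<le> R then 0 else g w)"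
    have m: "g1 \<in> borel_measurable borel" "g2 \<in> borel_measurable borel"
      unfolding g1_def g2_def by measurable
    have t: "tame g1" "tame g2"
      by (rule tame_bounded[OF tg, of _ 1]; use m in \<open>auto simp: g1_def g2_def\<close>)+
    have "(\<lambda>w. g1 w + g2 w) = g" by (auto simp: g1_def g2_def)
    then have split: "proj g z = proj g1 z + proj g2 z" for z using proj_add[OF t, of z] by simp
    have "proj g1 \<in> E_space l" by (rule proj_cutoff_E_space[OF t(1), of R]) (simp add: g1_def)
    then have "((\<lambda>z. cmod (proj g1 z) * weight \<alpha> l z) \<longlongrightarrow> 0) at_infinity"
      using E_space_little_Fock by (auto simp: little_Fock_def)
    then have ev: "eventually (\<lambda>z. cmod (proj g1 z) * weight \<alpha> l z < e / 2) at_infinity"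
      by (rule order_tendstoD) (use e in simp)
    have s2: "cmod (proj g2 z) * weight \<alpha> l z \<le> A * (M * \<epsilon>)" for z
    proof (rule proj_weighted_sup[OF A t(2)])
      show "cmod (g2 w) * weight \<alpha> l w \<le> M * \<epsilon>" for w
        using order_trans[OF gw mult_left_mono[OF R M]] M \<epsilon> by (auto simp: g2_def)
    qed (use M \<epsilon> in simp)
    have "A * (M * \<epsilon>) < e / 2"
    proof -
      have "A * (M * \<epsilon>) \<le> A * ((M + 1) * \<epsilon>)" using A \<epsilon> by simp
      also have "\<dots> = e / 4"
      proof -
        have "M + 1 \<noteq> 0" using M by simp
        then show ?thesis using A(1) by (simp add: \<epsilon>_def)
      qed
      finally show ?thesis using e by simp
    qed
    note small = this
    show "eventually (\<lambda>z. dist (cmod (proj g z) * weight \<alpha> l z) 0 < e) at_infinity"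
      using ev
    proof eventually_elim
      case (elim z)
      have "cmod (proj g z) * weight \<alpha> l z \<le> (cmod (proj g1 z) + cmod (proj g2 z)) * weight \<alpha> l z"
        unfolding split by (intro mult_right_mono norm_triangle_ineq) simp
      also have "\<dots> < e" using elim s2[of z] small by (simp add: distrib_right)
      finally show ?case by simp
    qed
  qed
  then show "proj g \<in> little_Fock \<alpha> l" using proj_entire[OF tg] by (simp add: little_Fock_def)
qed

lemma little_Fock_type: "fock_type_space \<alpha> l (little_Fock \<alpha> l) (Linf_norm \<alpha> l) (\<lambda>_. 1)"
proof
  obtain A where A: "A > 0" "\<And>z. (\<integral>\<^sup>+w. ennreal (wker z w) \<partial>lborel) \<le> ennreal A"
    by (rule wker_row) blast
  fix f assume f: "f \<in> little_Fock \<alpha> l"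
  note fF = little_Fock_Finf[OF f]
  show "f \<in> entire" using f by (simp add: little_Fock_def)
  show "tame f" by (rule Finf_tame[OF fF])
  show "Linf_norm \<alpha> l (\<lambda>z. c * f z) = cmod c * Linf_norm \<alpha> l f" for c
    by (rule Linf_norm_scale[OF fF])
  show "(\<lambda>z. c * f z) \<in> little_Fock \<alpha> l" for c
  proof -
    have "((\<lambda>z. cmod c * (cmod (f z) * weight \<alpha> l z)) \<longlongrightarrow> cmod c * 0) at_infinity"
      using f by (intro tendsto_mult tendsto_const) (simp add: little_Fock_def)
    then show ?thesis using f
      by (auto simp: little_Fock_def entire_def norm_mult mult.assoc intro!: holomorphic_intros)
  qed
  show "\<exists>R. Linf_norm \<alpha> l (proj (\<lambda>w. if cmod w \<le> R then 0 else f w)) \<le> \<epsilon>" if \<epsilon>: "0 < \<epsilon>" for \<epsilon>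
  proof -
    obtain R where R: "\<And>w. \<not> cmod w \<le> R \<Longrightarrow> cmod (f w) * weight \<alpha> l w \<le> \<epsilon> / A"
      using little_Fock_tail[OF f, of "\<epsilon> / A"] \<epsilon> A(1) by (metis divide_pos_pos)
    define g where "g = (\<lambda>w. if cmod w \<le> R then 0 else f w)"
    have [measurable]: "f \<in> borel_measurable borel" by (rule tame_measurable[OF Finf_tame[OF fF]])
    have tg: "tame g"
      by (rule tame_bounded[OF Finf_tame[OF fF], of _ 1]) (auto simp: g_def)
    have "cmod (proj g z) * weight \<alpha> l z \<le> A * (\<epsilon> / A)" for z
      by (rule proj_weighted_sup[OF A tg]) (use R A(1) \<epsilon> in \<open>auto simp: g_def\<close>)
    then show ?thesis using Linf_norm_le(2)[OF proj_entire[OF tg], of \<alpha> l \<epsilon>] A(1) unfolding g_def by auto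
  qed
  fix g assume g: "g \<in> little_Fock \<alpha> l"
  note gF = little_Fock_Finf[OF g]
  have ent: "(\<lambda>z. f z + g z) \<in> entire"
    using f g by (auto simp: little_Fock_def entire_def intro!: holomorphic_intros)
  have tri: "cmod (f z + g z) * weight \<alpha> l z \<le> cmod (f z) * weight \<alpha> l z + cmod (g z) * weight \<alpha> l z" for z
    unfolding distrib_right[symmetric] by (intro mult_right_mono norm_triangle_ineq) simp
  have "((\<lambda>z. cmod (f z) * weight \<alpha> l z + cmod (g z) * weight \<alpha> l z) \<longlongrightarrow> 0 + 0) at_infinity"
    using f g by (intro tendsto_add) (auto simp: little_Fock_def)
  then have "((\<lambda>z. cmod (f z + g z) * weight \<alpha> l z) \<longlongrightarrow> 0) at_infinity"
    by (intro tendsto_zero_dominated[OF _ _ tri]) auto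
  then show "(\<lambda>z. f z + g z) \<in> little_Fock \<alpha> l" using ent by (simp add: little_Fock_def)
  have "Linf_norm \<alpha> l (\<lambda>z. f z + g z) \<le> Linf_norm \<alpha> l f + Linf_norm \<alpha> l g"
    by (intro Linf_norm_le(2)[OF ent] order_trans[OF tri] add_mono Linf_norm_bound fF gF)
  then show "Linf_norm \<alpha> l (\<lambda>z. f z + g z) \<le> 2 * (Linf_norm \<alpha> l f + Linf_norm \<alpha> l g)"
    using Linf_norm_nonneg[of \<alpha> l f] Linf_norm_nonneg[of \<alpha> l g] by simp
next
  show "E_space l \<subseteq> little_Fock \<alpha> l" using E_space_little_Fock by blast
  show "0 \<le> Linf_norm \<alpha> l f" for f by (rule Linf_norm_nonneg)
  show "(0::real) < 1" by simp
  obtain A where A: "A > 0" "\<And>z. (\<integral>\<^sup>+w. ennreal (wker z w) \<partial>lborel) \<le> ennreal A"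
    by (rule wker_row) blast
  show "\<exists>A>0. \<forall>f\<in>little_Fock \<alpha> l. \<forall>M\<ge>0. \<forall>g\<in>borel_measurable borel. (\<forall>w. cmod (g w) \<le> M * cmod (f w)) \<longrightarrow>
        proj g \<in> little_Fock \<alpha> l \<and> Linf_norm \<alpha> l (proj g) \<le> A * M * Linf_norm \<alpha> l f"
    using little_Fock_proj[OF A] A(1) by blast
  show "\<exists>C>0. \<forall>f\<in>little_Fock \<alpha> l. \<forall>z. cmod (f z) * weight \<alpha> l z \<le> C * 1 * Linf_norm \<alpha> l f"
    using Linf_norm_bound[OF little_Fock_Finf] by (intro exI[of _ 1]) auto
  show "\<exists>C>0. \<forall>z. Linf_norm \<alpha> l (\<lambda>w. exp (of_real \<alpha> * cnj z ^ l * w ^ l)) \<le> C * exp (\<alpha> * cmod z ^ (2 * l) / 2) / 1"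
  proof (intro exI[of _ 1] conjI allI)
    fix z
    have "cmod (exp (of_real \<alpha> * cnj z ^ l * w ^ l)) * weight \<alpha> l w \<le> exp (\<alpha> * cmod z ^ (2 * l) / 2)" for w
      unfolding exp_weight using \<alpha>_pos by simp
    from Linf_norm_le(2)[OF E_space_entire[OF E_space_exp] this]
    show "Linf_norm \<alpha> l (\<lambda>w. exp (of_real \<alpha> * cnj z ^ l * w ^ l)) \<le> 1 * exp (\<alpha> * cmod z ^ (2 * l) / 2) / 1" by simp
  qed simp
  show "\<exists>C>0. \<forall>M\<ge>0. \<forall>f\<in>E_space l. (\<forall>w. cmod (f w) * weight \<alpha> l w \<le> M * gauss (\<alpha> / 16) l w) \<longrightarrow> Linf_norm \<alpha> l f \<le> C * M"
  proof (intro exI[of _ 1] conjI allI impI ballI)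
    fix M :: real and f assume M: "M \<ge> 0" and f: "f \<in> E_space l"
      and le: "\<forall>w. cmod (f w) * weight \<alpha> l w \<le> M * gauss (\<alpha> / 16) l w"
    have "M * gauss (\<alpha> / 16) l w \<le> M * 1" for w
      using M gauss_le_1[of "\<alpha> / 16" w] \<alpha>_pos by (intro mult_left_mono) auto
    then have "cmod (f w) * weight \<alpha> l w \<le> 1 * M" for w
      using le[rule_format, of w] by (metis mult.commute order_trans)
    then show "Linf_norm \<alpha> l f \<le> 1 * M" by (rule Linf_norm_le(2)[OF E_space_entire[OF f]])
  qed simp
qed

end

section \<open>The Fock spaces with finite exponent\<close>

lemma powr_add_superadditive:
  fixes a b p :: real
  assumes "0 \<le> a" "0 \<le> b" "1 \<le> p"
  shows "a powr p + b powr p \<le> (a + b) powr p"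
proof (cases "a = 0 \<or> b = 0")
  case False
  then have ab: "a > 0" "b > 0" using assms by auto
  have "a powr p + b powr p = a * a powr (p - 1) + b * b powr (p - 1)"
    using ab by (simp add: powr_mult_base)
  also have "\<dots> \<le> a * (a + b) powr (p - 1) + b * (a + b) powr (p - 1)"
    using ab assms by (intro add_mono mult_left_mono powr_mono2) auto
  also have "\<dots> = (a + b) * (a + b) powr (p - 1)" by (simp add: distrib_right)
  also have "\<dots> = (a + b) powr p" using ab by (simp add: powr_mult_base)
  finally show ?thesis .
qed (use assms in auto)

lemma powr_sum_le:
  fixes a b p :: real
  assumes "0 \<le> a" "0 \<le> b" "0 \<le> p"
  shows "(a + b) powr p \<le> 2 powr p * (a powr p + b powr p)"
proof -
  have "(a + b) powr p \<le> (2 * max a b) powr p"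
    using assms by (intro powr_mono2) auto
  also have "\<dots> = 2 powr p * max a b powr p" using assms by (simp add: powr_mult)
  also have "max a b powr p \<le> a powr p + b powr p" by (auto simp: max_def)
  finally show ?thesis by simp
qed

lemma Lp_int_lborel: "Lp_int p \<gamma> l f = (\<integral>\<^sup>+z. ennreal ((cmod (f z) * weight \<gamma> l z) powr p) \<partial>lborel)"
  unfolding Lp_int_def by (rule nn_integral_completion)

lemma Lp_norm_nonneg: "0 \<le> Lp_norm p \<gamma> l f"
  by (simp add: Lp_norm_def)

lemma Lp_int_eq_norm:
  assumes "p \<ge> 1" "Lp_int p \<gamma> l f < \<infinity>"
  shows "Lp_int p \<gamma> l f = ennreal (Lp_norm p \<gamma> l f powr p)"
  using assms by (simp add: Lp_norm_def powr_powr)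

lemma Lp_norm_le:
  assumes p: "p \<ge> 1" and f: "f \<in> entire" and B: "B \<ge> 0" "Lp_int p \<gamma> l f \<le> ennreal (B powr p)"
  shows "f \<in> Fp p \<gamma> l" "Lp_norm p \<gamma> l f \<le> B"
proof -
  have fin: "Lp_int p \<gamma> l f < \<infinity>" by (rule le_less_trans[OF B(2)]) simp
  then show "f \<in> Fp p \<gamma> l"
    using f measurable_lebesgue_I[OF entire_measurable[OF f]] by (simp add: Fp_def Lp_space_def)
  have "enn2real (Lp_int p \<gamma> l f) \<le> B powr p"
    using B by (intro enn2real_leI) auto
  then have "enn2real (Lp_int p \<gamma> l f) powr (1 / p) \<le> (B powr p) powr (1 / p)"
    using p by (intro powr_mono2) auto
  then show "Lp_norm p \<gamma> l f \<le> B" using p B by (simp add: Lp_norm_def powr_powr)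
qed

lemma Fp_D: "f \<in> Fp p \<gamma> l \<Longrightarrow> f \<in> entire" "f \<in> Fp p \<gamma> l \<Longrightarrow> Lp_int p \<gamma> l f < \<infinity>"
  by (auto simp: Fp_def Lp_space_def)

lemma Lp_norm_scale:
  assumes "p \<ge> 1" "f \<in> Fp p \<gamma> l"
  shows "(\<lambda>z. c * f z) \<in> Fp p \<gamma> l" "Lp_norm p \<gamma> l (\<lambda>z. c * f z) = cmod c * Lp_norm p \<gamma> l f"
proof -
  have [measurable]: "f \<in> borel_measurable borel" by (rule entire_measurable[OF Fp_D(1)[OF assms(2)]])
  have eq: "Lp_int p \<gamma> l (\<lambda>z. c * f z) = ennreal (cmod c powr p) * Lp_int p \<gamma> l f"
  proof -
    have "ennreal ((cmod (c * f z) * weight \<gamma> l z) powr p) = ennreal (cmod c powr p) * ennreal ((cmod (f z) * weight \<gamma> l z) powr p)" for z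
      by (simp add: norm_mult mult.assoc powr_mult ennreal_mult)
    then show ?thesis unfolding Lp_int_lborel by (simp add: nn_integral_cmult)
  qed
  have "(\<lambda>z. c * f z) \<in> entire"
    using Fp_D(1)[OF assms(2)] by (auto simp: entire_def intro!: holomorphic_intros)
  moreover have "Lp_int p \<gamma> l (\<lambda>z. c * f z) < \<infinity>"
    unfolding eq using Fp_D(2)[OF assms(2)] by (simp add: ennreal_mult_less_top)
  ultimately show "(\<lambda>z. c * f z) \<in> Fp p \<gamma> l"
    using measurable_lebesgue_I[OF entire_measurable] by (simp add: Fp_def Lp_space_def)
  show "Lp_norm p \<gamma> l (\<lambda>z. c * f z) = cmod c * Lp_norm p \<gamma> l f"
    unfolding Lp_norm_def eq using assms(1) by (simp add: enn2real_mult powr_mult powr_powr)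
qed

lemma Lp_norm_add:
  assumes p: "p \<ge> 1" and f: "f \<in> Fp p \<gamma> l" and g: "g \<in> Fp p \<gamma> l"
  shows "(\<lambda>z. f z + g z) \<in> Fp p \<gamma> l" "Lp_norm p \<gamma> l (\<lambda>z. f z + g z) \<le> 2 * (Lp_norm p \<gamma> l f + Lp_norm p \<gamma> l g)"
proof -
  have [measurable]: "f \<in> borel_measurable borel" "g \<in> borel_measurable borel"
    by (rule entire_measurable[OF Fp_D(1)], fact)+
  define v where "v h z = cmod (h z) * weight \<gamma> l z" for h z
  define a b where "a = Lp_norm p \<gamma> l f" and "b = Lp_norm p \<gamma> l g"
  have ab: "a \<ge> 0" "b \<ge> 0" by (simp_all add: a_def b_def Lp_norm_nonneg)
  have pt: "v (\<lambda>z. f z + g z) z powr p \<le> 2 powr p * (v f z powr p + v g z powr p)" for z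
  proof -
    have "v (\<lambda>z. f z + g z) z \<le> v f z + v g z"
      unfolding v_def distrib_right[symmetric] by (intro mult_right_mono norm_triangle_ineq) simp
    then have "v (\<lambda>z. f z + g z) z powr p \<le> (v f z + v g z) powr p"
      using p by (intro powr_mono2) (auto simp: v_def)
    also have "\<dots> \<le> 2 powr p * (v f z powr p + v g z powr p)"
      using p by (intro powr_sum_le) (auto simp: v_def)
    finally show ?thesis .
  qed
  have "Lp_int p \<gamma> l (\<lambda>z. f z + g z) \<le> (\<integral>\<^sup>+z. ennreal (2 powr p) * (ennreal (v f z powr p) + ennreal (v g z powr p)) \<partial>lborel)"
    unfolding Lp_int_lborel
  proof (rule nn_integral_mono)
    fix z
    have "ennreal (2 powr p) * (ennreal (v f z powr p) + ennreal (v g z powr p)) = ennreal (2 powr p * (v f z powr p + v g z powr p))"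
      by (simp add: ennreal_mult ennreal_plus)
    then show "ennreal ((cmod (f z + g z) * weight \<gamma> l z) powr p) \<le> ennreal (2 powr p) * (ennreal (v f z powr p) + ennreal (v g z powr p))"
      using ennreal_leI[OF pt[of z]] by (simp only: v_def)
  qed
  also have "\<dots> = ennreal (2 powr p) * (Lp_int p \<gamma> l f + Lp_int p \<gamma> l g)"
    unfolding Lp_int_lborel v_def by (simp add: nn_integral_cmult nn_integral_add)
  also have "\<dots> = ennreal (2 powr p * (a powr p + b powr p))"
    unfolding Lp_int_eq_norm[OF p Fp_D(2)[OF f]] Lp_int_eq_norm[OF p Fp_D(2)[OF g]] a_def[symmetric] b_def[symmetric]
    by (simp add: ennreal_mult ennreal_plus)
  also have "\<dots> \<le> ennreal ((2 * (a + b)) powr p)"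
  proof (rule ennreal_leI)
    have "(2 * (a + b)) powr p = 2 powr p * (a + b) powr p" by (subst powr_mult) (use ab in auto)
    then show "2 powr p * (a powr p + b powr p) \<le> (2 * (a + b)) powr p"
      using mult_left_mono[OF powr_add_superadditive[OF ab p], of "2 powr p"] by simp
  qed
  finally have "Lp_int p \<gamma> l (\<lambda>z. f z + g z) \<le> ennreal ((2 * (a + b)) powr p)" .
  moreover have "(\<lambda>z. f z + g z) \<in> entire"
    using Fp_D(1)[OF f] Fp_D(1)[OF g] by (auto simp: entire_def intro!: holomorphic_intros)
  ultimately show "(\<lambda>z. f z + g z) \<in> Fp p \<gamma> l" "Lp_norm p \<gamma> l (\<lambda>z. f z + g z) \<le> 2 * (Lp_norm p \<gamma> l f + Lp_norm p \<gamma> l g)"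
    using Lp_norm_le[OF p, of "\<lambda>z. f z + g z" "2 * (a + b)"] ab by (simp_all add: a_def b_def)
qed

text \<open>A weak form of Jensen's inequality: split the values of \<open>h\<close> at a level \<open>t\<close> that is optimised
  afterwards.\<close>

lemma nn_integral_powr_le:
  fixes k h :: "'a \<Rightarrow> real" and U :: real
  assumes [measurable]: "k \<in> borel_measurable M" "h \<in> borel_measurable M"
    and k: "\<And>w. 0 \<le> k w" and h: "\<And>w. 0 \<le> h w" and p: "1 \<le> p" and A: "A > 0"
    and kA: "(\<integral>\<^sup>+w. ennreal (k w) \<partial>M) \<le> ennreal A"
    and U: "0 \<le> U" "ennreal U \<le> (\<integral>\<^sup>+w. ennreal (k w * h w) \<partial>M)"
  shows "ennreal (U powr p) \<le> ennreal (2 powr p * A powr (p - 1)) * (\<integral>\<^sup>+w. ennreal (k w * h w powr p) \<partial>M)"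
proof (cases "(\<integral>\<^sup>+w. ennreal (k w * h w powr p) \<partial>M)")
  case top
  then show ?thesis using A by (simp add: ennreal_mult_top)
next
  case (real j)
  have level: "U \<le> t powr (1 - p) * j + t * A" if t: "t > 0" for t
  proof -
    have pt: "h w \<le> t powr (1 - p) * h w powr p + t" for w
    proof (cases "h w \<le> t")
      case True
      then show ?thesis using t by (simp add: add_increasing)
    next
      case False
      then have hp: "h w > 0" "t \<le> h w" using t by auto
      have "h w = h w powr (1 - p) * h w powr p" using hp by (simp add: powr_add[symmetric])
      also have "\<dots> \<le> t powr (1 - p) * h w powr p"
        using hp t p by (intro mult_right_mono powr_mono2') auto
      finally show ?thesis using t by simp
    qed
    have "ennreal U \<le> (\<integral>\<^sup>+w. ennreal (t powr (1 - p)) * ennreal (k w * h w powr p) + ennreal t * ennreal (k w) \<partial>M)"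
    proof (rule order_trans[OF U(2) nn_integral_mono])
      fix w
      have "k w * h w \<le> k w * (t powr (1 - p) * h w powr p + t)"
        by (intro mult_left_mono pt k)
      also have "\<dots> = t powr (1 - p) * (k w * h w powr p) + t * k w" by (simp add: algebra_simps)
      finally have "ennreal (k w * h w) \<le> ennreal (t powr (1 - p) * (k w * h w powr p) + t * k w)"
        by (rule ennreal_leI)
      also have "\<dots> = ennreal (t powr (1 - p)) * ennreal (k w * h w powr p) + ennreal t * ennreal (k w)"
        by (rule ennreal_sum_mult) (use t k in auto)
      finally show "ennreal (k w * h w) \<le> \<dots>" .
    qed
    also have "\<dots> = ennreal (t powr (1 - p)) * ennreal j + ennreal t * (\<integral>\<^sup>+w. ennreal (k w) \<partial>M)"
      by (simp add: nn_integral_add nn_integral_cmult real(2))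
    also have "\<dots> \<le> ennreal (t powr (1 - p)) * ennreal j + ennreal t * ennreal A"
      by (intro add_left_mono mult_left_mono kA) auto
    also have "\<dots> = ennreal (t powr (1 - p) * j + t * A)"
      by (rule ennreal_sum_mult[symmetric]) (use t A real in auto)
    finally show ?thesis using t A real by (subst (asm) ennreal_le_iff) auto
  qed
  have "U powr p \<le> 2 powr p * A powr (p - 1) * j"
  proof (cases "j = 0")
    case True
    have "U \<le> 0"
    proof (rule field_le_epsilon)
      fix e :: real assume "e > 0"
      then show "U \<le> 0 + e" using level[of "e / A"] A True by simp
    qed
    then show ?thesis using U(1) True by simp
  next
    case False
    then have j: "j > 0" using real by simp
    define t where "t = (j / A) powr (1 / p)"
    have t: "t > 0" using j A by (simp add: t_def)
    have tp: "t powr p = j / A" using j A p by (simp add: t_def powr_powr)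
    have eq: "t powr (1 - p) * j = t * A"
    proof -
      have "t powr (1 - p) * t powr p = t" using t by (simp add: powr_add[symmetric])
      then have "t powr (1 - p) * (j / A) = t" unfolding tp .
      then show ?thesis using A by (simp add: field_simps)
    qed
    have "U \<le> 2 * (t * A)" using level[OF t] unfolding eq by (simp only: mult_2)
    then have "U powr p \<le> (2 * (t * A)) powr p" using U(1) p by (intro powr_mono2) auto
    also have "\<dots> = 2 powr p * (j / A * A powr p)" using t A by (simp add: powr_mult tp)
    also have "j / A * A powr p = A powr (p - 1) * j" using A by (simp add: powr_diff)
    finally show ?thesis by (simp add: mult.assoc)
  qed
  then show ?thesis unfolding real(2) using real(1) by (simp add: ennreal_mult[symmetric] ennreal_leI)
qed

context fock_params begin

text \<open>Jensen's inequality in each row of the kernel, followed by Tonelli's theorem.\<close>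

lemma Lp_proj:
  assumes p: "1 \<le> p" and A: "A > 0" "\<And>z. (\<integral>\<^sup>+w. ennreal (wker z w) \<partial>lborel) \<le> ennreal A"
    and tg: "tame g" and B: "B \<ge> 0" "Lp_int p \<alpha> l g \<le> ennreal (B powr p)"
  shows "proj g \<in> Fp p \<alpha> l" "Lp_norm p \<alpha> l (proj g) \<le> 2 * A * B"
    and "ennreal ((cmod (proj g z) * weight \<alpha> l z) powr p)
      \<le> ennreal (2 powr p * A powr (p - 1)) * (\<integral>\<^sup>+w. ennreal (wker z w * (cmod (g w) * weight \<alpha> l w) powr p) \<partial>lborel)"
proof -
  have [measurable]: "g \<in> borel_measurable borel" using tg by (rule tame_measurable)
  define h where "h w = cmod (g w) * weight \<alpha> l w" for w
  have [measurable]: "h \<in> borel_measurable borel" unfolding h_def by measurable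
  have pt: "ennreal ((cmod (proj g z) * weight \<alpha> l z) powr p)
      \<le> ennreal (2 powr p * A powr (p - 1)) * (\<integral>\<^sup>+w. ennreal (wker z w * h w powr p) \<partial>lborel)" for z
    using proj_weighted_le[OF tg, of z] unfolding h_def[symmetric]
    by (intro nn_integral_powr_le[OF _ _ _ _ p A(1) A(2)[of z]]) (auto simp: wker_nonneg h_def)
  then show "ennreal ((cmod (proj g z) * weight \<alpha> l z) powr p)
      \<le> ennreal (2 powr p * A powr (p - 1)) * (\<integral>\<^sup>+w. ennreal (wker z w * (cmod (g w) * weight \<alpha> l w) powr p) \<partial>lborel)"
    unfolding h_def .
  have [measurable]: "(\<lambda>(z, w). ennreal (wker z w * h w powr p)) \<in> borel_measurable (lborel \<Otimes>\<^sub>M lborel)"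
    unfolding split_beta by measurable
  have "Lp_int p \<alpha> l (proj g)
      \<le> (\<integral>\<^sup>+z. ennreal (2 powr p * A powr (p - 1)) * (\<integral>\<^sup>+w. ennreal (wker z w * h w powr p) \<partial>lborel) \<partial>lborel)"
    unfolding Lp_int_lborel by (intro nn_integral_mono pt)
  also have "\<dots> = ennreal (2 powr p * A powr (p - 1)) * (\<integral>\<^sup>+z. \<integral>\<^sup>+w. ennreal (wker z w * h w powr p) \<partial>lborel \<partial>lborel)"
    by (rule nn_integral_cmult) measurable
  also have "(\<integral>\<^sup>+z. \<integral>\<^sup>+w. ennreal (wker z w * h w powr p) \<partial>lborel \<partial>lborel)
      = (\<integral>\<^sup>+w. \<integral>\<^sup>+z. ennreal (wker z w * h w powr p) \<partial>lborel \<partial>lborel)"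
    by (rule lborel_pair.Fubini'[symmetric]) measurable
  also have "\<dots> \<le> (\<integral>\<^sup>+w. ennreal A * ennreal (h w powr p) \<partial>lborel)"
  proof (rule nn_integral_mono)
    fix w
    have "(\<integral>\<^sup>+z. ennreal (wker z w * h w powr p) \<partial>lborel) = (\<integral>\<^sup>+z. ennreal (wker w z) * ennreal (h w powr p) \<partial>lborel)"
      unfolding wker_commute[of _ w] by (simp add: ennreal_mult wker_nonneg)
    also have "\<dots> = (\<integral>\<^sup>+z. ennreal (wker w z) \<partial>lborel) * ennreal (h w powr p)"
      by (rule nn_integral_multc) measurable
    also have "\<dots> \<le> ennreal A * ennreal (h w powr p)" by (intro mult_right_mono A) simp
    finally show "(\<integral>\<^sup>+z. ennreal (wker z w * h w powr p) \<partial>lborel) \<le> ennreal A * ennreal (h w powr p)" .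
  qed
  also have "\<dots> = ennreal A * Lp_int p \<alpha> l g"
    unfolding Lp_int_lborel h_def by (rule nn_integral_cmult) measurable
  also have "\<dots> \<le> ennreal A * ennreal (B powr p)" by (intro mult_left_mono B) simp
  finally have "Lp_int p \<alpha> l (proj g) \<le> ennreal (2 powr p * A powr (p - 1)) * (ennreal A * ennreal (B powr p))"
    by (simp add: mult_left_mono)
  also have "\<dots> = ennreal ((2 * A * B) powr p)"
  proof -
    have "A powr (p - 1) * A = A powr p" using A(1) by (simp add: powr_diff)
    then have "2 powr p * A powr (p - 1) * (A * B powr p) = (2 * A * B) powr p"
      using A(1) B(1) by (simp add: powr_mult mult_ac)
    then show ?thesis using A(1) by (simp add: ennreal_mult[symmetric])
  qed
  finally have "Lp_int p \<alpha> l (proj g) \<le> ennreal ((2 * A * B) powr p)" .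
  then show "proj g \<in> Fp p \<alpha> l" "Lp_norm p \<alpha> l (proj g) \<le> 2 * A * B"
    using Lp_norm_le[OF p proj_entire[OF tg], of "2 * A * B"] A(1) B(1) by auto
qed

text \<open>The weighted function is integrable to the power \<open>p\<close>, hence bounded by \<open>1\<close> plus an integrable function,
  and the remaining weight absorbs the exponential factor.\<close>

lemma Fp_tame:
  assumes p: "1 \<le> p" and f: "f \<in> Fp p \<alpha> l" shows "tame f"
  unfolding tame_def
proof safe
  show [measurable]: "f \<in> borel_measurable borel" by (rule entire_measurable[OF Fp_D(1)[OF f]])
  fix \<beta> :: real
  define v where "v z = cmod (f z) * weight \<alpha> l z" for z
  have [measurable]: "v \<in> borel_measurable borel" unfolding v_def by measurable
  have vi: "integrable lborel (\<lambda>z. v z powr p)"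
    by (rule integrableI_bounded) (use Fp_D(2)[OF f] in \<open>auto simp: Lp_int_lborel v_def\<close>)
  interpret q: fock_params "\<alpha> / 4" l using \<alpha>_pos l_pos by unfold_locales auto
  obtain D where D: "D > 0" "\<And>x. x \<ge> 0 \<Longrightarrow> (1 + x) ^ 0 * exp (\<beta> * x ^ l) \<le> D * exp (\<alpha> / 4 * x ^ (2 * l))"
    using poly_exp_bound[of "\<alpha> / 4" 0 \<beta>] \<alpha>_pos by (metis divide_pos_pos zero_less_numeral)
  show "integrable lborel (\<lambda>w. cmod (f w) * exp (\<beta> * cmod w ^ l) * gauss \<alpha> l w)"
  proof (rule integrable_dominated)
    show "integrable lborel (\<lambda>w. D * (gauss (\<alpha> / 4) l w + v w powr p))"
      using q.integrable_gauss vi by auto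
    fix w
    have v1: "v w \<le> 1 + v w powr p"
    proof (cases "v w \<le> 1")
      case False
      then have "v w powr 1 \<le> v w powr p" using p by (intro powr_mono) auto
      then show ?thesis using False by simp
    qed (simp add: add_increasing2)
    have ew: "exp (\<beta> * cmod w ^ l) * weight \<alpha> l w \<le> D * gauss (\<alpha> / 4) l w"
    proof -
      have "exp (\<beta> * cmod w ^ l) * weight \<alpha> l w \<le> D * exp (\<alpha> / 4 * cmod w ^ (2 * l)) * weight \<alpha> l w"
        using D(2)[of "cmod w"] by (intro mult_right_mono) auto
      also have "\<dots> = D * (exp (\<alpha> / 4 * cmod w ^ (2 * l)) * exp (- (\<alpha> * cmod w ^ (2 * l) / 2)))"
        by (simp add: weight_def)
      also have "exp (\<alpha> / 4 * cmod w ^ (2 * l)) * exp (- (\<alpha> * cmod w ^ (2 * l) / 2)) = gauss (\<alpha> / 4) l w"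
        unfolding exp_add[symmetric] gauss_def by (simp add: field_simps)
      finally show ?thesis .
    qed
    have "norm (cmod (f w) * exp (\<beta> * cmod w ^ l) * gauss \<alpha> l w) = v w * (exp (\<beta> * cmod w ^ l) * weight \<alpha> l w)"
      unfolding weight_square[symmetric] v_def by (simp add: abs_mult mult_ac)
    also have "\<dots> \<le> (1 + v w powr p) * (D * gauss (\<alpha> / 4) l w)"
      by (intro mult_mono v1 ew) (auto simp: v_def)
    also have "\<dots> = D * (gauss (\<alpha> / 4) l w + v w powr p * gauss (\<alpha> / 4) l w)" by (simp add: algebra_simps)
    also have "\<dots> \<le> D * (gauss (\<alpha> / 4) l w + v w powr p * 1)"
      using D(1) gauss_le_1[of "\<alpha> / 4" w] \<alpha>_pos by (intro mult_left_mono add_left_mono) auto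
    finally show "norm (cmod (f w) * exp (\<beta> * cmod w ^ l) * gauss \<alpha> l w) \<le> D * (gauss (\<alpha> / 4) l w + v w powr p)"
      by simp
  qed measurable
qed

lemma Lp_decay:
  assumes p: "1 \<le> p"
  obtains C where "C > 0" "\<And>M f. M \<ge> 0 \<Longrightarrow> f \<in> entire \<Longrightarrow>
    (\<And>w. cmod (f w) * weight \<alpha> l w \<le> M * gauss (\<alpha> / 16) l w) \<Longrightarrow> f \<in> Fp p \<alpha> l \<and> Lp_norm p \<alpha> l f \<le> C * M"
proof -
  interpret s: fock_params "p * (\<alpha> / 16)" l using \<alpha>_pos l_pos p by unfold_locales auto
  define I where "I = integral\<^sup>L lborel (gauss (p * (\<alpha> / 16)) l)"
  have I0: "I \<ge> 0" unfolding I_def by (intro integral_nonneg_AE) auto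
  have gI: "(\<integral>\<^sup>+w. ennreal (gauss (p * (\<alpha> / 16)) l w) \<partial>lborel) = ennreal I"
    unfolding I_def by (intro nn_integral_eq_integral s.integrable_gauss) auto
  define C where "C = (I + 1) powr (1 / p)"
  have C: "C > 0" using I0 by (simp add: C_def)
  have Cp: "C powr p = I + 1" using I0 p by (simp add: C_def powr_powr)
  have gp: "gauss (\<alpha> / 16) l w powr p = gauss (p * (\<alpha> / 16)) l w" for w
    by (simp add: gauss_def powr_def)
  show thesis
  proof (rule that[OF C])
    fix M f assume M: "M \<ge> 0" and f: "f \<in> entire"
      and le: "\<And>w. cmod (f w) * weight \<alpha> l w \<le> M * gauss (\<alpha> / 16) l w"
    have "Lp_int p \<alpha> l f \<le> (\<integral>\<^sup>+w. ennreal (M powr p) * ennreal (gauss (p * (\<alpha> / 16)) l w) \<partial>lborel)"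
      unfolding Lp_int_lborel
    proof (rule nn_integral_mono)
      fix w
      have "(cmod (f w) * weight \<alpha> l w) powr p \<le> (M * gauss (\<alpha> / 16) l w) powr p"
        using p by (intro powr_mono2 le) auto
      also have "\<dots> = M powr p * gauss (p * (\<alpha> / 16)) l w"
        using M by (simp add: powr_mult gp)
      finally show "ennreal ((cmod (f w) * weight \<alpha> l w) powr p) \<le> ennreal (M powr p) * ennreal (gauss (p * (\<alpha> / 16)) l w)"
        by (simp add: ennreal_mult[symmetric] ennreal_leI)
    qed
    also have "\<dots> = ennreal (M powr p) * ennreal I"
      unfolding gI[symmetric] by (rule nn_integral_cmult) measurable
    also have "\<dots> = ennreal (M powr p * I)" using I0 by (simp add: ennreal_mult)
    also have "\<dots> \<le> ennreal ((C * M) powr p)"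
    proof (rule ennreal_leI)
      have "M powr p * I \<le> M powr p * (I + 1)" by (intro mult_left_mono) auto
      then show "M powr p * I \<le> (C * M) powr p" using M C by (simp add: powr_mult Cp mult.commute)
    qed
    finally show "f \<in> Fp p \<alpha> l \<and> Lp_norm p \<alpha> l f \<le> C * M"
      using Lp_norm_le[OF p f, of "C * M"] M C by auto
  qed
qed

text \<open>By completing the square, the weighted test function decays exponentially in \<open>y = |w\<^sup>l - z\<^sup>l|\<^sup>2\<close>, so its
  \<open>p\<close>-th power is dominated by a multiple of \<open>(1 + y)\<^sup>-\<^sup>2\<close>, whose integral is known.\<close>

lemma Lp_exp_norm:
  assumes p: "1 \<le> p"
  obtains C where "C > 0" "\<And>z. Lp_norm p \<alpha> l (\<lambda>w. exp (of_real \<alpha> * cnj z ^ l * w ^ l))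
     \<le> C * exp (\<alpha> * cmod z ^ (2 * l) / 2) / ((1 + cmod z) ^ (2 * l - 2)) powr (1 / p)"
proof -
  obtain J where J: "J > 0"
    "\<And>z. (\<integral>\<^sup>+w. ennreal (1 / (1 + (cmod (w ^ l - z ^ l))\<^sup>2)\<^sup>2) \<partial>lborel) \<le> ennreal (J / (1 + cmod z) ^ (2 * l - 2))"
    using nn_integral_power_distance[OF l_pos] by metis
  define s where "s = p * \<alpha> / 4"
  have s: "s > 0" using p \<alpha>_pos by (simp add: s_def)
  define K where "K = (1 + 1 / s)\<^sup>2"
  have K: "K > 0" unfolding K_def using s by (intro zero_less_power add_pos_pos) auto
  have dec: "exp (- (2 * s * y)) \<le> K * (1 / (1 + y)\<^sup>2)" if y: "y \<ge> 0" for y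
  proof -
    have "1 + y \<le> (1 + 1 / s) * (1 + s * y)" using s y by (simp add: field_simps)
    also have "\<dots> \<le> (1 + 1 / s) * exp (s * y)"
      using s by (intro mult_left_mono exp_ge_add_one_self) auto
    finally have "(1 + y)\<^sup>2 \<le> ((1 + 1 / s) * exp (s * y))\<^sup>2" using y by (intro power_mono) auto
    also have "\<dots> = K * exp (2 * s * y)"
      by (simp add: K_def power_mult_distrib power2_eq_square exp_add[symmetric])
    finally have "(1 + y)\<^sup>2 * exp (- (2 * s * y)) \<le> K * exp (2 * s * y) * exp (- (2 * s * y))"
      by (rule mult_right_mono) simp
    also have "\<dots> = K" by (simp add: exp_minus)
    finally have "exp (- (2 * s * y)) * (1 + y)\<^sup>2 \<le> K" by (simp add: mult.commute)
    moreover have "(1 + y)\<^sup>2 > 0" using y by (intro zero_less_power) auto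
    ultimately show ?thesis by (simp add: le_divide_eq)
  qed
  define C where "C = (K * J) powr (1 / p)"
  have C: "C > 0" using K J by (simp add: C_def)
  have Cp: "C powr p = K * J" using K J p by (simp add: C_def powr_powr)
  show thesis
  proof (rule that[OF C])
    fix z :: complex
    define e where "e = exp (\<alpha> * cmod z ^ (2 * l) / 2)"
    have e: "e > 0" by (simp add: e_def)
    define P where "P = (1 + cmod z) ^ (2 * l - 2)"
    have P: "P > 0" unfolding P_def by (rule one_plus_norm_power_pos)
    define y where "y w = (cmod (w ^ l - z ^ l))\<^sup>2" for w
    have [measurable]: "y \<in> borel_measurable borel" unfolding y_def by measurable
    have "Lp_int p \<alpha> l (\<lambda>w. exp (of_real \<alpha> * cnj z ^ l * w ^ l))
        \<le> (\<integral>\<^sup>+w. ennreal (e powr p * K) * ennreal (1 / (1 + y w)\<^sup>2) \<partial>lborel)"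
      unfolding Lp_int_lborel exp_weight e_def[symmetric] y_def[symmetric]
    proof (rule nn_integral_mono)
      fix w
      have "(e * exp (- (\<alpha> / 2 * y w))) powr p = e powr p * exp (- (2 * s * y w))"
        using e by (simp add: powr_mult s_def powr_def[of "exp _"] algebra_simps)
      also have "\<dots> \<le> e powr p * (K * (1 / (1 + y w)\<^sup>2))"
        by (intro mult_left_mono dec) (auto simp: y_def)
      finally show "ennreal ((e * exp (- (\<alpha> / 2 * y w))) powr p) \<le> ennreal (e powr p * K) * ennreal (1 / (1 + y w)\<^sup>2)"
        using K by (simp only: ennreal_mult'[symmetric] mult_nonneg_nonneg mult.assoc ennreal_leI powr_ge_zero less_imp_le)
    qed
    also have "\<dots> = ennreal (e powr p * K) * (\<integral>\<^sup>+w. ennreal (1 / (1 + y w)\<^sup>2) \<partial>lborel)"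
      by (rule nn_integral_cmult) measurable
    also have "\<dots> \<le> ennreal (e powr p * K) * ennreal (J / P)"
      unfolding y_def P_def by (intro mult_left_mono J) simp
    also have "\<dots> = ennreal ((C * e / P powr (1 / p)) powr p)"
    proof -
      have "(C * e / P powr (1 / p)) powr p = K * J * e powr p / P"
        using C e P p by (simp add: powr_mult powr_divide powr_powr Cp)
      then show ?thesis using K J(1) P by (simp add: ennreal_mult[symmetric] mult_ac)
    qed
    finally show "Lp_norm p \<alpha> l (\<lambda>w. exp (of_real \<alpha> * cnj z ^ l * w ^ l)) \<le> C * e / P powr (1 / p)"
      using C e by (intro Lp_norm_le(2)[OF p E_space_entire[OF E_space_exp]]) auto
  qed
qed

text \<open>Evaluation at \<open>z\<close> is bounded through \<open>f = P f\<close> and the supremum of the weighted kernel, which gives the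
  growth \<open>(1 + |z|)\<^sup>2\<^sup>l\<^sup>-\<^sup>2\<close> for the \<open>p\<close>-th power; the tail estimate is dominated convergence.\<close>

lemma Fp_type:
  assumes p: "1 \<le> p"
  shows "fock_type_space \<alpha> l (Fp p \<alpha> l) (Lp_norm p \<alpha> l) (\<lambda>z. ((1 + cmod z) ^ (2 * l - 2)) powr (1 / p))"
proof
  obtain A where A: "A > 0" "\<And>z. (\<integral>\<^sup>+w. ennreal (wker z w) \<partial>lborel) \<le> ennreal A"
    by (rule wker_row) blast
  fix f assume f: "f \<in> Fp p \<alpha> l"
  show "f \<in> entire" by (rule Fp_D(1)[OF f])
  show "tame f" by (rule Fp_tame[OF p f])
  show "(\<lambda>z. c * f z) \<in> Fp p \<alpha> l" "Lp_norm p \<alpha> l (\<lambda>z. c * f z) = cmod c * Lp_norm p \<alpha> l f" for c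
    by (rule Lp_norm_scale[OF p f])+
  show "(\<lambda>z. f z + g z) \<in> Fp p \<alpha> l" "Lp_norm p \<alpha> l (\<lambda>z. f z + g z) \<le> 2 * (Lp_norm p \<alpha> l f + Lp_norm p \<alpha> l g)"
    if "g \<in> Fp p \<alpha> l" for g
    by (rule Lp_norm_add[OF p f that])+
  show "\<exists>R. Lp_norm p \<alpha> l (proj (\<lambda>w. if cmod w \<le> R then 0 else f w)) \<le> \<epsilon>" if \<epsilon>: "0 < \<epsilon>" for \<epsilon>
  proof -
    have [measurable]: "f \<in> borel_measurable borel" by (rule entire_measurable[OF Fp_D(1)[OF f]])
    define v where "v w = (cmod (f w) * weight \<alpha> l w) powr p" for w
    have [measurable]: "v \<in> borel_measurable borel" unfolding v_def by measurable
    have vi: "integrable lborel v"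
      by (rule integrableI_bounded) (use Fp_D(2)[OF f] in \<open>auto simp: Lp_int_lborel v_def\<close>)
    define u where "u n w = (if cmod w \<le> real n then 0 else v w)" for n :: nat and w
    have [measurable]: "u n \<in> borel_measurable borel" for n unfolding u_def by measurable
    have u0: "0 \<le> u n w" "u n w \<le> v w" for n w by (auto simp: u_def v_def)
    have ui: "integrable lborel (u n)" for n
      by (rule integrable_dominated[OF vi]) (use u0 in auto)
    have "(\<lambda>n. integral\<^sup>L lborel (u n)) \<longlonglongrightarrow> integral\<^sup>L lborel (\<lambda>_::complex. 0)"
    proof (rule integral_dominated_convergence[where w=v])
      show "AE w in lborel. (\<lambda>n. u n w) \<longlonglongrightarrow> 0"
      proof (rule AE_I2)
        fix w
        obtain N where N: "cmod w \<le> real N" using real_arch_simple by blast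
        have "eventually (\<lambda>n. u n w = 0) sequentially"
          using eventually_ge_at_top[of N] by eventually_elim (use N in \<open>auto simp: u_def\<close>)
        then show "(\<lambda>n. u n w) \<longlonglongrightarrow> 0" by (rule tendsto_eventually)
      qed
      show "\<And>n. AE w in lborel. norm (u n w) \<le> v w" using u0 by auto
    qed (use vi in auto)
    then have "(\<lambda>n. integral\<^sup>L lborel (u n)) \<longlonglongrightarrow> 0" by simp
    then have "eventually (\<lambda>n. integral\<^sup>L lborel (u n) < (\<epsilon> / (2 * A)) powr p) sequentially"
      by (rule order_tendstoD) (use \<epsilon> A(1) in simp)
    then obtain n where n: "integral\<^sup>L lborel (u n) < (\<epsilon> / (2 * A)) powr p"
      by (auto simp: eventually_sequentially)
    define g where "g = (\<lambda>w. if cmod w \<le> real n then 0 else f w)"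
    have tg: "tame g"
      by (rule tame_bounded[OF Fp_tame[OF p f], of _ 1]) (auto simp: g_def)
    have "Lp_int p \<alpha> l g = (\<integral>\<^sup>+w. ennreal (u n w) \<partial>lborel)"
      unfolding Lp_int_lborel using p by (intro nn_integral_cong) (auto simp: g_def u_def v_def)
    also have "\<dots> = ennreal (integral\<^sup>L lborel (u n))"
      by (intro nn_integral_eq_integral ui) (use u0 in auto)
    also have "\<dots> \<le> ennreal ((\<epsilon> / (2 * A)) powr p)" using n by (intro ennreal_leI) simp
    finally have "Lp_norm p \<alpha> l (proj g) \<le> 2 * A * (\<epsilon> / (2 * A))"
      by (intro Lp_proj(2)[OF p A tg]) (use \<epsilon> A(1) in auto)
    then show ?thesis using A(1) unfolding g_def by auto
  qed
next
  obtain A where A: "A > 0" "\<And>z. (\<integral>\<^sup>+w. ennreal (wker z w) \<partial>lborel) \<le> ennreal A"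
    by (rule wker_row) blast
  obtain Cd where Cd: "Cd > 0" "\<And>M f. M \<ge> 0 \<Longrightarrow> f \<in> entire \<Longrightarrow>
    (\<And>w. cmod (f w) * weight \<alpha> l w \<le> M * gauss (\<alpha> / 16) l w) \<Longrightarrow> f \<in> Fp p \<alpha> l \<and> Lp_norm p \<alpha> l f \<le> Cd * M"
    by (rule Lp_decay[OF p]) blast
  show "E_space l \<subseteq> Fp p \<alpha> l"
  proof
    fix f assume f: "f \<in> E_space l"
    obtain M where "M \<ge> 0" "\<And>w. cmod (f w) * weight \<alpha> l w \<le> M * gauss (\<alpha> / 16) l w"
      using E_space_decay[OF f] by metis
    then show "f \<in> Fp p \<alpha> l" using Cd(2)[OF _ E_space_entire[OF f]] by blast
  qed
  show "0 \<le> Lp_norm p \<alpha> l f" for f by (rule Lp_norm_nonneg)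
  show "0 < ((1 + cmod z) ^ (2 * l - 2)) powr (1 / p)" for z
    using one_plus_norm_power_pos[of z "2 * l - 2"] by (simp only: powr_gt_zero)
  show "\<exists>C>0. \<forall>M\<ge>0. \<forall>f\<in>E_space l. (\<forall>w. cmod (f w) * weight \<alpha> l w \<le> M * gauss (\<alpha> / 16) l w) \<longrightarrow> Lp_norm p \<alpha> l f \<le> C * M"
    using Cd E_space_entire by blast
  obtain Ce where Ce: "Ce > 0" "\<And>z. Lp_norm p \<alpha> l (\<lambda>w. exp (of_real \<alpha> * cnj z ^ l * w ^ l))
     \<le> Ce * exp (\<alpha> * cmod z ^ (2 * l) / 2) / ((1 + cmod z) ^ (2 * l - 2)) powr (1 / p)"
    by (rule Lp_exp_norm[OF p]) blast
  then show "\<exists>C>0. \<forall>z. Lp_norm p \<alpha> l (\<lambda>w. exp (of_real \<alpha> * cnj z ^ l * w ^ l))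
     \<le> C * exp (\<alpha> * cmod z ^ (2 * l) / 2) / ((1 + cmod z) ^ (2 * l - 2)) powr (1 / p)"
    by blast
  show "\<exists>A>0. \<forall>f\<in>Fp p \<alpha> l. \<forall>M\<ge>0. \<forall>g\<in>borel_measurable borel. (\<forall>w. cmod (g w) \<le> M * cmod (f w)) \<longrightarrow>
        proj g \<in> Fp p \<alpha> l \<and> Lp_norm p \<alpha> l (proj g) \<le> A * M * Lp_norm p \<alpha> l f"
  proof (intro exI[of _ "2 * A"] conjI ballI allI impI)
    fix f M and g :: "complex \<Rightarrow> complex"
    assume f: "f \<in> Fp p \<alpha> l" and M: "0 \<le> M" and g: "g \<in> borel_measurable borel"
      and le: "\<forall>w. cmod (g w) \<le> M * cmod (f w)"
    have [measurable]: "f \<in> borel_measurable borel" by (rule entire_measurable[OF Fp_D(1)[OF f]])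
    have tg: "tame g" by (rule tame_bounded[OF Fp_tame[OF p f] g]) (use le in blast)
    define B where "B = M * Lp_norm p \<alpha> l f"
    have B: "B \<ge> 0" using M by (simp add: B_def Lp_norm_nonneg)
    have "Lp_int p \<alpha> l g \<le> (\<integral>\<^sup>+w. ennreal (M powr p) * ennreal ((cmod (f w) * weight \<alpha> l w) powr p) \<partial>lborel)"
      unfolding Lp_int_lborel
    proof (rule nn_integral_mono)
      fix w
      have "cmod (g w) * weight \<alpha> l w \<le> M * (cmod (f w) * weight \<alpha> l w)"
        using mult_right_mono[OF le[rule_format, of w], of "weight \<alpha> l w"] by simp
      then have "(cmod (g w) * weight \<alpha> l w) powr p \<le> (M * (cmod (f w) * weight \<alpha> l w)) powr p"
        using p by (intro powr_mono2) auto
      also have "\<dots> = M powr p * (cmod (f w) * weight \<alpha> l w) powr p" using M by (simp add: powr_mult)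
      finally show "ennreal ((cmod (g w) * weight \<alpha> l w) powr p) \<le> ennreal (M powr p) * ennreal ((cmod (f w) * weight \<alpha> l w) powr p)"
        by (simp add: ennreal_mult[symmetric] ennreal_leI)
    qed
    also have "\<dots> = ennreal (M powr p) * Lp_int p \<alpha> l f"
      unfolding Lp_int_lborel by (rule nn_integral_cmult) measurable
    also have "\<dots> = ennreal (B powr p)"
      unfolding Lp_int_eq_norm[OF p Fp_D(2)[OF f]] B_def using M Lp_norm_nonneg
      by (simp add: powr_mult ennreal_mult)
    finally have BB: "Lp_int p \<alpha> l g \<le> ennreal (B powr p)" .
    show "proj g \<in> Fp p \<alpha> l" by (rule Lp_proj(1)[OF p A tg B BB])
    show "Lp_norm p \<alpha> l (proj g) \<le> 2 * A * M * Lp_norm p \<alpha> l f"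
      using Lp_proj(2)[OF p A tg B BB] by (simp add: B_def mult.assoc)
  qed (use A in auto)
  obtain S where S: "S > 0" "\<And>z w. wker z w \<le> S * (1 + cmod z) ^ (2 * l - 2)"
    by (rule wker_sup) blast
  define C where "C = 2 * (A powr (p - 1) * S) powr (1 / p)"
  have C: "C > 0" using A S by (simp add: C_def)
  have "cmod (f z) * weight \<alpha> l z \<le> C * ((1 + cmod z) ^ (2 * l - 2)) powr (1 / p) * Lp_norm p \<alpha> l f"
    if f: "f \<in> Fp p \<alpha> l" for f z
  proof -
    have [measurable]: "f \<in> borel_measurable borel" by (rule entire_measurable[OF Fp_D(1)[OF f]])
    define N where "N = Lp_norm p \<alpha> l f"
    have N: "N \<ge> 0" by (simp add: N_def Lp_norm_nonneg)
    have IN: "Lp_int p \<alpha> l f = ennreal (N powr p)" unfolding N_def by (rule Lp_int_eq_norm[OF p Fp_D(2)[OF f]])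
    define P where "P = (1 + cmod z) ^ (2 * l - 2)"
    have P: "P > 0" unfolding P_def by (rule one_plus_norm_power_pos)
    define U where "U = cmod (f z) * weight \<alpha> l z"
    have U: "U \<ge> 0" by (simp add: U_def)
    have "ennreal (U powr p) \<le> ennreal (2 powr p * A powr (p - 1)) * (\<integral>\<^sup>+w. ennreal (wker z w * (cmod (f w) * weight \<alpha> l w) powr p) \<partial>lborel)"
      using Lp_proj(3)[OF p A Fp_tame[OF p f] N, of z] IN
      unfolding proj_reproducing[OF Fp_D(1)[OF f] Fp_tame[OF p f]] U_def by simp
    also have "(\<integral>\<^sup>+w. ennreal (wker z w * (cmod (f w) * weight \<alpha> l w) powr p) \<partial>lborel)
        \<le> (\<integral>\<^sup>+w. ennreal (S * P) * ennreal ((cmod (f w) * weight \<alpha> l w) powr p) \<partial>lborel)"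
      using S P unfolding P_def
      by (intro nn_integral_mono) (auto simp: ennreal_mult[symmetric] intro!: ennreal_leI mult_right_mono)
    also have "\<dots> = ennreal (S * P) * ennreal (N powr p)"
      unfolding IN[symmetric] Lp_int_lborel by (rule nn_integral_cmult) measurable
    finally have "ennreal (U powr p) \<le> ennreal (2 powr p * A powr (p - 1)) * (ennreal (S * P) * ennreal (N powr p))"
      by (simp add: mult_left_mono)
    also have "\<dots> = ennreal (2 powr p * A powr (p - 1) * (S * P * N powr p))"
      using S(1) P by (simp add: ennreal_mult[symmetric])
    finally have le: "U powr p \<le> 2 powr p * A powr (p - 1) * (S * P * N powr p)"
      using S(1) P by (subst (asm) ennreal_le_iff) auto
    have "2 powr p * A powr (p - 1) * (S * P * N powr p) = (C * P powr (1 / p) * N) powr p"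
      using A(1) S(1) P N p by (simp add: C_def powr_mult powr_powr)
    with le have le': "U powr p \<le> (C * P powr (1 / p) * N) powr p" by (simp only:)
    have "(U powr p) powr (1 / p) \<le> ((C * P powr (1 / p) * N) powr p) powr (1 / p)"
      by (rule powr_mono2[OF _ powr_ge_zero le']) (use p in simp)
    then show ?thesis using p U C N by (simp add: powr_powr U_def P_def N_def)
  qed
  with C show "\<exists>C>0. \<forall>f\<in>Fp p \<alpha> l. \<forall>z. cmod (f z) * weight \<alpha> l z
      \<le> C * ((1 + cmod z) ^ (2 * l - 2)) powr (1 / p) * Lp_norm p \<alpha> l f"
    by blast
qed

end

theorem theorem1p1:
  fixes \<alpha> p :: real and l :: nat
  assumes "\<alpha> > 0" and "l \<ge> 1" and "1 \<le> p"
  shows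
    "(\<forall>b\<in>H_space \<alpha> l.
        hankel_bounded \<alpha> l b (Fp p \<alpha> l) (Lp_norm p \<alpha> l) \<longleftrightarrow> b \<in> Finf (\<alpha> / 2) l) \<and>
     (\<exists>C>0. \<forall>b\<in>H_space \<alpha> l. \<forall>T. hankel_extension \<alpha> l b (Fp p \<alpha> l) (Lp_norm p \<alpha> l) T \<longrightarrow>
        inverse C * Linf_norm (\<alpha> / 2) l b
          \<le> operator_norm (Fp p \<alpha> l) (Lp_norm p \<alpha> l) (conj_norm (Lp_norm p \<alpha> l)) T \<and>
        operator_norm (Fp p \<alpha> l) (Lp_norm p \<alpha> l) (conj_norm (Lp_norm p \<alpha> l)) T
          \<le> C * Linf_norm (\<alpha> / 2) l b) \<and>
     (\<forall>b\<in>H_space \<alpha> l.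
        hankel_bounded \<alpha> l b (little_Fock \<alpha> l) (Linf_norm \<alpha> l) \<longleftrightarrow> b \<in> Finf (\<alpha> / 2) l) \<and>
     (\<exists>C>0. \<forall>b\<in>H_space \<alpha> l. \<forall>T. hankel_extension \<alpha> l b (little_Fock \<alpha> l) (Linf_norm \<alpha> l) T \<longrightarrow>
        inverse C * Linf_norm (\<alpha> / 2) l b
          \<le> operator_norm (little_Fock \<alpha> l) (Linf_norm \<alpha> l) (conj_norm (Linf_norm \<alpha> l)) T \<and>
        operator_norm (little_Fock \<alpha> l) (Linf_norm \<alpha> l) (conj_norm (Linf_norm \<alpha> l)) T
          \<le> C * Linf_norm (\<alpha> / 2) l b)"
proof -
  interpret fock_params \<alpha> l
    using assms by unfold_locales
  interpret F: fock_type_space \<alpha> l "Fp p \<alpha> l" "Lp_norm p \<alpha> l" "\<lambda>z. ((1 + cmod z) ^ (2 * l - 2)) powr (1 / p)"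
    by (rule Fp_type[OF assms(3)])
  interpret f: fock_type_space \<alpha> l "little_Fock \<alpha> l" "Linf_norm \<alpha> l" "\<lambda>_. 1"
    by (rule little_Fock_type)
  show ?thesis
    using F.hankel_characterisation f.hankel_characterisation by blast
qed

end
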